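(* Let $\sigma\colon\Gamma\to 2^V$ be a quasi-geometric homology triangulation of a simplex with vertex set $V=\{v_1,\ldots,v_n\}$, let $E$ be a face of $\Gamma$, let $d=n-|E|$ and $b=n-|\sigma(E)|$, and label so that $\sigma(E)^c=\{v_1,\ldots,v_b\}$. Let $\theta_1,\ldots,\theta_d$ be a special l.s.o.p. for $k[\mathrm{lk}_\Gamma(E)]$, ordered so that $\mathrm{supp}(\theta_i)\subset\{w\in\mathrm{lk}_\Gamma(E): v_i\in\sigma(w)\}$ for $1\le i\le b$. For $S\subset\{v_1,\ldots,v_d\}$ let $I_S\subset k[\mathrm{lk}_\Gamma(E)]$ be the ideal $I_S=(x^F: F\in\mathrm{lk}_\Gamma(E),\ \sigma(F\sqcup E)^c\subset S)$; for $v_i\in S$ let $\lambda_i\colon I_S\to I_{S\smallsetminus\{v_i\}}$ be the degree-one map given by multiplication by $\theta_i$. Then there is an exact sequence of graded $k[\mathrm{lk}_\Gamma(E)]$-modules $$0\to k[\mathrm{lk}_\Gamma(E)][-d]\to\bigoplus_{|S|=d-1}I_S[-(d-1)]\to\cdots\to\bigoplus_{|S|=1}I_S[-1]\to I\to L(\Gamma,E)\to 0,$$ where the sums are over subsets $S\subset\{v_1,\ldots,v_d\}$ of the indicated size, $I=I_\emptyset$, the map $I\to L(\Gamma,E)$ is the natural surjection, and for $S=\{v_{i_0},\ldots,v_{i_k}\}$ with $i_0<\cdots<i_k$ the differential restricted to $I_S$ is $\bigoplus_{j=0}^k(-1)^j\lambda_{i_j}$.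
   Context: Fix an infinite field $k$; homology is taken with coefficients in $k$. A $d$-dimensional simplicial complex $\Gamma$ with trivial reduced homology is a homology ball of dimension $d$ if there is a subcomplex $\partial\Gamma$ such that $\partial\Gamma$ is a homology sphere of dimension $d-1$, $\mathrm{lk}_\Gamma(F)$ is a homology sphere of dimension $d-|F|$ for $F\notin\partial\Gamma$, and $\mathrm{lk}_\Gamma(F)$ is a homology ball of dimension $d-|F|$ for nonempty $F\in\partial\Gamma$; its interior faces are those not in $\partial\Gamma$. A homology triangulation of the simplex $2^V$ ($V$ a finite set) is a finite simplicial complex $\Gamma$ with a map $\sigma\colon\Gamma\to 2^V$ such that for every nonempty $U\subset V$, $\Gamma_U:=\sigma^{-1}(2^U)$ is a homology ball of dimension $|U|-1$ and $\sigma^{-1}(U)$ is its set of interior faces. $\sigma(F)$ is the carrier of $F$; for a vertex $w$ write $\sigma(w)=\sigma(\{w\})$. It is quasi-geometric if there is no face $F$ and $U\subset V$ with $\dim\Gamma_U<\dim F$ and $\sigma(w)\subset U$ for every vertex $w\in F$. For $U\subset V$, $U^c=V\smallsetminus U$. A face $G$ of $\Gamma$ is interior if $\sigma(G)=V$. For a simplicial complex $\Delta$, $k[\Delta]$ is the face ring (polynomial ring in variables $x_w$, $w$ a vertex, modulo the monomials $x^F=\prod_{w\in F}x_w$ for non-faces $F$), graded by degree. The support of $\theta=\sum a_wx_w$ is $\{w:a_w\ne0\}$. A linear system of parameters (l.s.o.p.) for a finitely generated graded $k$-algebra $R$ of Krull dimension $d$ is a sequence of $d$ degree-one elements $\theta_1,\ldots,\theta_d$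 with $R/(\theta_1,\ldots,\theta_d)$ finite-dimensional over $k$. For a face $E$ of $\Gamma$, an l.s.o.p. $\theta_1,\ldots,\theta_d$ of $k[\mathrm{lk}_\Gamma(E)]$ ($d=|V|-|E|$) is special if for each $v\in V\smallsetminus\sigma(E)$ there is an element $\theta_v$ of it whose support consists of vertices $w$ of $\mathrm{lk}_\Gamma(E)$ with $v\in\sigma(w)$, with $\theta_v\ne\theta_{v'}$ for $v\ne v'$. The local face module $L(\Gamma,E)$ is the image of the ideal $I=(x^F: F\in\mathrm{lk}_\Gamma(E),\ F\sqcup E\text{ interior})$ in $k[\mathrm{lk}_\Gamma(E)]/(\theta_1,\ldots,\theta_d)$. For a graded module $M$, $M[-j]_i=M_{i-j}$. *)

theory Defs
  imports Main "HOL-Library.Poly_Mapping"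
begin

definition simplicial_complex :: "'w set set \<Rightarrow> bool" where
  "simplicial_complex \<Delta> \<longleftrightarrow> finite \<Delta> \<and> (\<forall>F\<in>\<Delta>. finite F) \<and> (\<forall>F\<in>\<Delta>. \<forall>G. G \<subseteq> F \<longrightarrow> G \<in> \<Delta>)"

definition link :: "'w set set \<Rightarrow> 'w set \<Rightarrow> 'w set set" where
  "link \<Delta> F = {G \<in> \<Delta>. G \<inter> F = {} \<and> G \<union> F \<in> \<Delta>}"

definition vertices :: "'w set set \<Rightarrow> 'w set" where
  "vertices \<Delta> = {w. {w} \<in> \<Delta>}"

text \<open>Dimension of a (finite) complex: maximal face cardinality minus one
  (the void complex gets dimension -1 by convention).\<close>
definition cdim :: "'w set set \<Rightarrow> int" where
  "cdim \<Delta> = int (Max (insert 0 (card ` \<Delta>))) - 1"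

text \<open>q-chains: k-valued functions supported on faces of cardinality q+1
  (q = -1 is the augmentation degree, spanned by the empty face).\<close>
definition chains :: "'w set set \<Rightarrow> int \<Rightarrow> ('w set \<Rightarrow> 'k::field) set" where
  "chains \<Delta> q = {c. \<forall>F. c F \<noteq> 0 \<longrightarrow> F \<in> \<Delta> \<and> int (card F) = q + 1}"

text \<open>Simplicial boundary, using the linear order on vertices for orientations.\<close>
definition bdry :: "'w::linorder set set \<Rightarrow> ('w set \<Rightarrow> 'k::field) \<Rightarrow> 'w set \<Rightarrow> 'k" where
  "bdry \<Delta> c G = (\<Sum>w\<in>(\<Union>\<Delta>) - G. (-1) ^ card {u\<in>G. u < w} * c (insert w G))"

definition h_vanish :: "'k::field itself \<Rightarrow> 'w::linorder set set \<Rightarrow> int \<Rightarrow> bool" where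
  "h_vanish K \<Delta> q \<longleftrightarrow>
     (\<forall>c::'w set \<Rightarrow> 'k. c \<in> chains \<Delta> q \<and> bdry \<Delta> c = (\<lambda>_. 0) \<longrightarrow> (\<exists>e\<in>chains \<Delta> (q+1). bdry \<Delta> e = c))"

definition h_is_k :: "'k::field itself \<Rightarrow> 'w::linorder set set \<Rightarrow> int \<Rightarrow> bool" where
  "h_is_k K \<Delta> q \<longleftrightarrow>
     (\<exists>z::'w set \<Rightarrow> 'k. z \<in> chains \<Delta> q \<and> bdry \<Delta> z = (\<lambda>_. 0) \<and>
        \<not> (\<exists>e\<in>chains \<Delta> (q+1). bdry \<Delta> e = z) \<and>
        (\<forall>c\<in>chains \<Delta> q. bdry \<Delta> c = (\<lambda>_. 0) \<longrightarrow>
            (\<exists>a::'k. \<exists>e\<in>chains \<Delta> (q+1). c = (\<lambda>F. bdry \<Delta> e F + a * z F))))"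

definition acyclic :: "'k::field itself \<Rightarrow> 'w::linorder set set \<Rightarrow> bool" where
  "acyclic K \<Delta> \<longleftrightarrow> (\<forall>q. h_vanish K \<Delta> q)"

definition homology_of_sphere :: "'k::field itself \<Rightarrow> 'w::linorder set set \<Rightarrow> int \<Rightarrow> bool" where
  "homology_of_sphere K \<Delta> m \<longleftrightarrow> (\<forall>q. (q \<noteq> m \<longrightarrow> h_vanish K \<Delta> q) \<and> (q = m \<longrightarrow> h_is_k K \<Delta> q))"

definition homology_sphere :: "'k::field itself \<Rightarrow> 'w::linorder set set \<Rightarrow> int \<Rightarrow> bool" where
  "homology_sphere K \<Delta> d \<longleftrightarrow> simplicial_complex \<Delta> \<and> \<Delta> \<noteq> {} \<and>
     (\<forall>F\<in>\<Delta>. homology_of_sphere K (link \<Delta> F) (d - int (card F)))"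

text \<open>Homology balls (the recursion is well-founded since the dimension strictly decreases).\<close>
inductive homology_ball :: "'k::field itself \<Rightarrow> 'w::linorder set set \<Rightarrow> int \<Rightarrow> bool" for K where
  "\<lbrakk> simplicial_complex \<Delta>; \<Delta> \<noteq> {}; cdim \<Delta> = d; acyclic K \<Delta>;
     B \<subseteq> \<Delta>; simplicial_complex B; homology_sphere K B (d - 1);
     \<forall>F\<in>\<Delta> - B. homology_of_sphere K (link \<Delta> F) (d - int (card F));
     \<forall>F\<in>B. F \<noteq> {} \<longrightarrow> homology_ball K (link \<Delta> F) (d - int (card F)) \<rbrakk>
   \<Longrightarrow> homology_ball K \<Delta> d"

definition homology_ball_bd :: "'k::field itself \<Rightarrow> 'w::linorder set set \<Rightarrow> 'w set set \<Rightarrow> int \<Rightarrow> bool" where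
  "homology_ball_bd K \<Delta> B d \<longleftrightarrow>
     simplicial_complex \<Delta> \<and> \<Delta> \<noteq> {} \<and> cdim \<Delta> = d \<and> acyclic K \<Delta> \<and>
     B \<subseteq> \<Delta> \<and> simplicial_complex B \<and> homology_sphere K B (d - 1) \<and>
     (\<forall>F\<in>\<Delta> - B. homology_of_sphere K (link \<Delta> F) (d - int (card F))) \<and>
     (\<forall>F\<in>B. F \<noteq> {} \<longrightarrow> homology_ball K (link \<Delta> F) (d - int (card F)))"

definition restr :: "'w set set \<Rightarrow> ('w set \<Rightarrow> 'v set) \<Rightarrow> 'v set \<Rightarrow> 'w set set" where
  "restr \<Gamma> \<sigma> U = {F \<in> \<Gamma>. \<sigma> F \<subseteq> U}"

definition homology_triangulation ::
  "'k::field itself \<Rightarrow> 'w::linorder set set \<Rightarrow> ('w set \<Rightarrow> 'v set) \<Rightarrow> 'v set \<Rightarrow> bool" where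
  "homology_triangulation K \<Gamma> \<sigma> V \<longleftrightarrow> finite V \<and> simplicial_complex \<Gamma> \<and> (\<forall>F\<in>\<Gamma>. \<sigma> F \<subseteq> V) \<and>
     (\<forall>U. U \<subseteq> V \<and> U \<noteq> {} \<longrightarrow>
        (\<exists>B. homology_ball_bd K (restr \<Gamma> \<sigma> U) B (int (card U) - 1) \<and>
             {F \<in> \<Gamma>. \<sigma> F = U} = restr \<Gamma> \<sigma> U - B))"

definition quasi_geometric :: "'w set set \<Rightarrow> ('w set \<Rightarrow> 'v set) \<Rightarrow> 'v set \<Rightarrow> bool" where
  "quasi_geometric \<Gamma> \<sigma> V \<longleftrightarrow>
     \<not> (\<exists>F\<in>\<Gamma>. \<exists>U. U \<subseteq> V \<and> cdim (restr \<Gamma> \<sigma> U) < int (card F) - 1 \<and> (\<forall>w\<in>F. \<sigma> {w} \<subseteq> U))"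

type_synonym ('w, 'k) mpoly = "('w \<Rightarrow>\<^sub>0 nat) \<Rightarrow>\<^sub>0 'k"

definition Var :: "'w \<Rightarrow> ('w, 'k::comm_ring_1) mpoly" where
  "Var w = Poly_Mapping.single (Poly_Mapping.single w 1) 1"

definition Const :: "'k::comm_ring_1 \<Rightarrow> ('w, 'k) mpoly" where
  "Const c = Poly_Mapping.single 0 c"

definition monom :: "'w set \<Rightarrow> ('w, 'k::comm_ring_1) mpoly" where
  "monom F = (\<Prod>w\<in>F. Var w)"

definition ideal_gen :: "('w, 'k::comm_ring_1) mpoly set \<Rightarrow> ('w, 'k) mpoly set" where
  "ideal_gen G = {p. \<exists>A r. finite A \<and> A \<subseteq> G \<and> p = (\<Sum>g\<in>A. r g * g)}"

text \<open>Generators of the Stanley-Reisner ideal; the face ring \<open>k[\<Delta>]\<close> is the polynomial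
  ring modulo the ideal they generate (variables of non-vertices are killed too).\<close>
definition SR_gens :: "'w set set \<Rightarrow> ('w, 'k::comm_ring_1) mpoly set" where
  "SR_gens \<Delta> = {monom F | F. finite F \<and> F \<notin> \<Delta>}"

definition SR_ideal :: "'w set set \<Rightarrow> ('w, 'k::comm_ring_1) mpoly set" where
  "SR_ideal \<Delta> = ideal_gen (SR_gens \<Delta>)"

definition linform :: "'w set set \<Rightarrow> ('w \<Rightarrow> 'k::comm_ring_1) \<Rightarrow> ('w, 'k) mpoly" where
  "linform \<Delta> a = (\<Sum>w\<in>vertices \<Delta>. Const (a w) * Var w)"

definition supp :: "('w \<Rightarrow> 'k::zero) \<Rightarrow> 'w set" where
  "supp a = {w. a w \<noteq> 0}"

text \<open>l.s.o.p. of \<open>k[\<Delta>]\<close>: d degree-one elements, d the Krull dimension of the face ring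
  (= dim \<Delta> + 1), such that \<open>k[\<Delta>]/(\<theta>)\<close> is finite-dimensional over k.\<close>
definition lsop :: "'w set set \<Rightarrow> (nat \<Rightarrow> 'w \<Rightarrow> 'k::field) \<Rightarrow> nat \<Rightarrow> bool" where
  "lsop \<Delta> \<theta> d \<longleftrightarrow> (\<forall>i<d. supp (\<theta> i) \<subseteq> vertices \<Delta>) \<and> int d = cdim \<Delta> + 1 \<and>
     (\<exists>B. finite B \<and> (\<forall>p. \<exists>c. p - (\<Sum>b\<in>B. Const (c b) * b)
            \<in> ideal_gen ((\<lambda>i. linform \<Delta> (\<theta> i)) ` {..<d} \<union> SR_gens \<Delta>)))"

definition special_lsop ::
  "'w set set \<Rightarrow> ('w set \<Rightarrow> 'v set) \<Rightarrow> 'v set \<Rightarrow> 'w set \<Rightarrow> (nat \<Rightarrow> 'w \<Rightarrow> 'k::field) \<Rightarrow> bool" where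
  "special_lsop \<Gamma> \<sigma> V E \<theta> \<longleftrightarrow>
     (let \<Delta> = link \<Gamma> E; d = card V - card E in
       lsop \<Delta> \<theta> d \<and>
       (\<exists>f. inj_on f (V - \<sigma> E) \<and> f ` (V - \<sigma> E) \<subseteq> {..<d} \<and>
            (\<forall>v\<in>V - \<sigma> E. supp (\<theta> (f v)) \<subseteq> {w \<in> vertices \<Delta>. v \<in> \<sigma> {w}})))"

end

theory Submission
  imports Defs
begin

text \<open>
  Write \<open>\<Delta>\<close> for the link of \<open>E\<close> and \<open>k[F]\<close> for the polynomial ring on the vertices of a face \<open>F\<close>.
  For fixed \<open>S\<close>, the ideal \<open>I\<^sub>S\<close> has the coresolution
  \<open>I\<^sub>S \<rightarrow> \<Oplus>\<^bsub>|F|=d\<^esub> k[F] \<rightarrow> \<Oplus>\<^bsub>|F|=d-1\<^esub> k[F] \<rightarrow> \<dots>\<close> over the faces with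
  \<open>S \<subseteq> \<sigma>(F \<union> E)\<close>: in the degree of a monomial with support \<open>G\<close> it computes the homology of the star of
  \<open>G\<close> relative to the faces whose carrier misses an element of \<open>S\<close>, which by the ball and sphere
  conditions is concentrated in the top dimension. The first map multiplies by a relative fundamental
  class, which vanishes on no facet because links are connected.

  For fixed \<open>F\<close>, the Koszul complex on \<open>k[F]\<close> only involves the \<open>\<theta>\<^sub>i\<close> with \<open>i \<in> \<sigma>(F \<union> E)\<close>, since the
  other ones restrict to zero on \<open>F\<close>. As the \<open>\<theta>\<^sub>i\<close> have no common zero on \<open>F\<close>, its homology vanishes in
  all degrees \<open>j > |\<sigma>(F \<union> E)| - |E| - |F|\<close>. A diagram chase in the resulting double complex, lowering
  \<open>|F|\<close> while raising \<open>|S|\<close> so that this bound is kept, gives the exactness.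
\<close>

section \<open>Signed sums over inserted elements\<close>

text \<open>The obstacle is the right end of the sequence. For |S| = j \<ge> 1 the chase starts on
  facets, where |\<sigma>(F \<union> E)| = n and the bound just says j > 0. At I itself it would
  start with j = 0, where the bound fails: an element of I need not be a boundary. What is given
  there is p = \<Sum> r_i \<theta>_i with arbitrary coefficients r_i. Embedded by the fundamental
  class, they have a row boundary supported on faces with d - 1 vertices that are not interior.
  There |\<sigma>(F \<union> E)| \<le> n - 1, so the bound holds again with |S| = 1, and the chase
  corrects each r_i to an element of I_{i}. Specialness of the parameters is used twice: for
  commuting squares, since an index i that is cut away at F has \<theta>_i = 0 on F, and for
  \<lambda>_i to map I_S to the ideal of S without i. All elements are representatives in the
  polynomial ring, compared modulo the Stanley-Reisner ideal. Rows split by monomials, so the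
  topology enters only through chains with coefficients in k.\<close>

definition ksgn :: "'a::linorder \<Rightarrow> 'a set \<Rightarrow> 'r::comm_ring_1" where
  "ksgn i T = (- 1) ^ card {u\<in>T. u < i}"

text \<open>With unit coefficients this is the simplicial boundary, with linear forms as coefficients
  the Koszul differential.\<close>
definition kz :: "'a::linorder set \<Rightarrow> ('a \<Rightarrow> 'r::comm_ring_1) \<Rightarrow> ('a set \<Rightarrow> 'r) \<Rightarrow> 'a set \<Rightarrow> 'r" where
  "kz A c f T = (\<Sum>i\<in>A - T. ksgn i T * c i * f (insert i T))"

text \<open>For distinct \<open>i\<close> and \<open>j\<close> exactly one of the two orders of
  insertion picks up a sign. This is the source of d^2 = 0 for boundary and Koszul differential
  alike.\<close>

lemma ksgn_insert:
  assumes "finite T" "j \<notin> T"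
  shows "ksgn i (insert j T) = (if j < i then - ksgn i T else ksgn i T)"
proof (cases "j < i")
  case True
  then have "{u \<in> insert j T. u < i} = insert j {u\<in>T. u < i}" by auto
  with True assms show ?thesis by (simp add: ksgn_def)
next
  case False
  then have "{u \<in> insert j T. u < i} = {u\<in>T. u < i}" by auto
  with False show ?thesis by (simp add: ksgn_def)
qed

lemma ksgn_sq [simp]: "ksgn i T * ksgn i T = 1"
  by (simp add: ksgn_def minus_one_mult_self)

text \<open>The diagonal has its own hypothesis because antisymmetry does not make it vanish in
  characteristic 2.\<close>

lemma antisymmetric_sum_eq_0:
  fixes u :: "'a \<Rightarrow> 'a \<Rightarrow> 'r::comm_ring_1"
  assumes "finite B" "\<And>i j. u j i = - u i j" "\<And>i. u i i = 0"
  shows "(\<Sum>i\<in>B. \<Sum>j\<in>B. u i j) = 0"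
  using assms(1)
proof (induction B rule: finite_induct)
  case empty
  show ?case by simp
next
  case (insert x B)
  have "(\<Sum>i\<in>B. u i x) = - (\<Sum>j\<in>B. u x j)"
    by (subst assms(2)) (simp add: sum_negf)
  with insert show ?case by (simp add: sum.distrib assms(3))
qed

lemma kz_kz:
  assumes "finite A" "finite T"
  shows "kz A c (kz A c f) T = 0"
proof -
  \<comment> \<open>The term for inserting \<open>i\<close> and then \<open>j\<close>. Extending it
    by zero lets both indices run over the same set, which makes the double sum
    antisymmetric.\<close>
  define u where "u i j = (if i = j then 0 else
    ksgn i T * c i * (ksgn j (insert i T) * c j * f (insert j (insert i T))))" for i j
  let ?u = "\<lambda>i j. if i \<in> T \<or> j \<in> T then 0 else u i j"
  have "kz A c (kz A c f) T = (\<Sum>i\<in>A - T. \<Sum>j\<in>A - T. ?u i j)"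
    unfolding kz_def sum_distrib_left
  proof (rule sum.cong[OF refl])
    fix i assume i: "i \<in> A - T"
    have "(\<Sum>j\<in>A - insert i T. ksgn i T * c i * (ksgn j (insert i T) * c j * f (insert j (insert i T))))
        = (\<Sum>j\<in>A - insert i T. ?u i j)"
      using i by (intro sum.cong) (auto simp: u_def)
    also have "\<dots> = (\<Sum>j\<in>A - T. ?u i j)"
      using assms i by (intro sum.mono_neutral_left) (auto simp: u_def)
    finally show "(\<Sum>j\<in>A - insert i T. ksgn i T * c i * (ksgn j (insert i T) * c j * f (insert j (insert i T))))
        = (\<Sum>j\<in>A - T. ?u i j)" .
  qed
  also have "\<dots> = 0"
  proof (rule antisymmetric_sum_eq_0)
    fix i j
    show "?u j i = - ?u i j"
      using assms(2) by (auto simp: u_def ksgn_insert insert_commute algebra_simps)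
  qed (use assms in \<open>auto simp: u_def\<close>)
  finally show ?thesis .
qed

lemma kz_cong:
  assumes "\<And>i. i \<in> A \<Longrightarrow> i \<notin> T \<Longrightarrow> f (insert i T) = g (insert i T)"
  shows "kz A c f T = kz A c g T"
  unfolding kz_def using assms by (intro sum.cong) auto

lemma kz_diff: "kz A c (\<lambda>S. f S - g S) T = kz A c f T - kz A c g T"
  by (simp add: kz_def sum_subtractf algebra_simps)

lemma kz_mult: "kz A c (\<lambda>S. a * f S) T = a * kz A c f T"
  by (simp add: kz_def sum_distrib_left algebra_simps)

lemma kz_zero [simp]: "kz A c (\<lambda>S. 0) T = 0"
  by (simp add: kz_def)

lemma kz_eq_0I:
  assumes "\<And>i. i \<in> A \<Longrightarrow> i \<notin> T \<Longrightarrow> f (insert i T) = 0"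
  shows "kz A c f T = 0"
  using kz_cong[of A T f "\<lambda>_. 0"] assms by simp

section \<open>Chains on convex families of faces\<close>

text \<open>Degrees count vertices, one more than the dimension, so the augmentation degree is 0 and
  natural numbers suffice.\<close>

definition chain_on :: "'w set set \<Rightarrow> nat \<Rightarrow> ('w set \<Rightarrow> 'k::field) \<Rightarrow> bool" where
  "chain_on X q c \<longleftrightarrow> (\<forall>F. c F \<noteq> 0 \<longrightarrow> F \<in> X \<and> card F = q)"

text \<open>The boundary is tested only on members of \<open>X\<close>: all other faces count as
  zero, as in a relative chain complex.\<close>

definition cycle_on :: "'w::linorder set \<Rightarrow> 'w set set \<Rightarrow> nat \<Rightarrow> ('w set \<Rightarrow> 'k::field) \<Rightarrow> bool" where
  "cycle_on W X q c \<longleftrightarrow> chain_on X q c \<and> (\<forall>G\<in>X. kz W (\<lambda>_. 1) c G = 0)"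

definition exact_at :: "'k::field itself \<Rightarrow> 'w::linorder set \<Rightarrow> 'w set set \<Rightarrow> nat \<Rightarrow> bool" where
  "exact_at K W X q \<longleftrightarrow> (\<forall>c :: 'w set \<Rightarrow> 'k. cycle_on W X q c \<longrightarrow>
     (\<exists>e. chain_on X (Suc q) e \<and> (\<forall>G\<in>X. kz W (\<lambda>_. 1) e G = c G)))"

text \<open>About cycles instead of homology classes: it is applied in top degree, where there are
  no boundaries.\<close>

definition line_at :: "'k::field itself \<Rightarrow> 'w::linorder set \<Rightarrow> 'w set set \<Rightarrow> nat \<Rightarrow> bool" where
  "line_at K W X q \<longleftrightarrow> (\<exists>z :: 'w set \<Rightarrow> 'k. cycle_on W X q z \<and> (\<exists>F. z F \<noteq> 0) \<and>
     (\<forall>c. cycle_on W X q c \<longrightarrow> (\<exists>a. \<forall>F. c F = a * z F)))"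

definition convex_family :: "'w set set \<Rightarrow> bool" where
  "convex_family X \<longleftrightarrow> (\<forall>F\<in>X. finite F) \<and> (\<forall>F\<in>X. \<forall>H\<in>X. \<forall>G. F \<subseteq> G \<and> G \<subseteq> H \<longrightarrow> G \<in> X)"

lemma convex_family_finite: "convex_family X \<Longrightarrow> F \<in> X \<Longrightarrow> finite F"
  unfolding convex_family_def by blast

text \<open>Truncation to \<open>X\<close> could spoil d^2 = 0. By convexity the values that are cut
  away are already zero, because a face between \<open>G\<close> and a member of \<open>X\<close>
  belongs to \<open>X\<close>.\<close>

lemma kz_boundary:
  assumes "finite W" "convex_family X" "chain_on X q c" "G \<in> X"
  shows "kz W (\<lambda>_. 1) (\<lambda>F. if F \<in> X then kz W (\<lambda>_. 1) c F else 0) G = 0"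
proof -
  have "kz W (\<lambda>_. 1) (\<lambda>F. if F \<in> X then kz W (\<lambda>_. 1) c F else 0) G = kz W (\<lambda>_. 1) (kz W (\<lambda>_. 1) c) G"
  proof (rule kz_cong)
    fix i assume i: "i \<in> W" "i \<notin> G"
    show "(if insert i G \<in> X then kz W (\<lambda>_. 1) c (insert i G) else 0) = kz W (\<lambda>_. 1) c (insert i G)"
    proof (cases "insert i G \<in> X")
      case False
      have "kz W (\<lambda>_. 1) c (insert i G) = 0"
      proof (rule kz_eq_0I)
        fix j
        show "c (insert j (insert i G)) = 0"
        proof (rule ccontr)
          assume "c (insert j (insert i G)) \<noteq> 0"
          then have "insert j (insert i G) \<in> X" using assms(3) by (auto simp: chain_on_def)
          moreover have "G \<subseteq> insert i G" "insert i G \<subseteq> insert j (insert i G)" by auto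
          ultimately have "insert i G \<in> X"
            using assms(2,4) unfolding convex_family_def by blast
          with False show False by simp
        qed
      qed
      then show ?thesis by simp
    qed simp
  qed
  also have "\<dots> = 0"
    by (rule kz_kz[OF assms(1) convex_family_finite[OF assms(2,4)]])
  finally show ?thesis .
qed

lemma kz_chain_on:
  assumes "chain_on X (Suc q) c" "finite G" "kz W (\<lambda>_. 1) c G \<noteq> 0"
  shows "card G = q"
proof -
  obtain i where i: "i \<notin> G" "c (insert i G) \<noteq> 0"
    using assms(3) kz_eq_0I[of W G c "\<lambda>_. 1"] by metis
  then have "card (insert i G) = Suc q" using assms(1) by (simp add: chain_on_def)
  with i(1) assms(2) show ?thesis by simp
qed

section \<open>A subfamily, its quotient and the long exact sequence\<close>

context
  fixes W :: "'w::linorder set" and X Y :: "'w set set"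
  assumes W: "finite W" and X: "convex_family X" and Y: "Y \<subseteq> X"
    and down: "\<And>F H. F \<in> X \<Longrightarrow> H \<in> Y \<Longrightarrow> F \<subseteq> H \<Longrightarrow> F \<in> Y"
begin

lemma kz_subfamily_eq_0:
  assumes "chain_on Y q c" "G \<in> X - Y"
  shows "kz W (\<lambda>_. 1) c G = 0"
proof (rule kz_eq_0I)
  fix i
  have "insert i G \<notin> Y" using assms(2) down[of G "insert i G"] by blast
  then show "c (insert i G) = 0" using assms(1) by (auto simp: chain_on_def)
qed

lemma cycle_on_subfamily:
  assumes "cycle_on W Y q c"
  shows "cycle_on W X q c"
  unfolding cycle_on_def
proof
  show "chain_on X q c" using assms Y by (auto simp: cycle_on_def chain_on_def)
  show "\<forall>G\<in>X. kz W (\<lambda>_. 1) c G = 0"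
    using assms kz_subfamily_eq_0 unfolding cycle_on_def by blast
qed

text \<open>The connecting homomorphism.\<close>

lemma cycle_on_quotient_boundary:
  assumes "cycle_on W (X - Y) (Suc q) c"
  shows "cycle_on W Y q (\<lambda>F. if F \<in> X then kz W (\<lambda>_. 1) c F else 0)"
proof -
  have c: "chain_on X (Suc q) c" using assms by (auto simp: cycle_on_def chain_on_def)
  have "F \<in> Y \<and> card F = q" if F: "(if F \<in> X then kz W (\<lambda>_. 1) c F else 0) \<noteq> 0" for F
  proof -
    from F have "F \<in> X" "kz W (\<lambda>_. 1) c F \<noteq> 0" by (auto split: if_splits)
    moreover from this have "finite F" using X convex_family_finite by blast
    ultimately show ?thesis using assms kz_chain_on[OF c, of F W] unfolding cycle_on_def by blast
  qed
  then show ?thesis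
    using kz_boundary[OF W X c] Y unfolding cycle_on_def chain_on_def by blast
qed

text \<open>The segment H_q(X) \<rightarrow> H_q(X - Y) \<rightarrow> H_{q-1}(Y) of the long exact
  sequence, with both ends zero. For q = 0 the right end is absent, whence the guard in the second
  assumption.\<close>

lemma exact_at_diff:
  assumes "exact_at K W X q" and "\<And>r. q = Suc r \<Longrightarrow> exact_at K W Y r"
  shows "exact_at K W (X - Y) q"
  unfolding exact_at_def
proof (intro allI impI)
  fix c :: "'w set \<Rightarrow> 'a" assume c: "cycle_on W (X - Y) q c"
  have cX: "chain_on X q c" using c by (auto simp: cycle_on_def chain_on_def)
  obtain e where e: "chain_on Y q e" "\<And>G. G \<in> X \<Longrightarrow> kz W (\<lambda>_. 1) e G = kz W (\<lambda>_. 1) c G"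
  proof (cases q)
    case 0
    have "kz W (\<lambda>_. 1) c G = 0" if "G \<in> X" for G
    proof (rule kz_eq_0I)
      fix i
      have "card (insert i G) \<noteq> 0" using convex_family_finite[OF X that] by simp
      then show "c (insert i G) = 0" using cX 0 by (metis chain_on_def)
    qed
    then show ?thesis by (intro that[of "\<lambda>_. 0"]) (auto simp: chain_on_def)
  next
    case (Suc r)
    have "cycle_on W Y r (\<lambda>F. if F \<in> X then kz W (\<lambda>_. 1) c F else 0)"
      using cycle_on_quotient_boundary c Suc by blast
    with assms(2)[OF Suc] obtain e where e: "chain_on Y q e"
      "\<And>G. G \<in> Y \<Longrightarrow> kz W (\<lambda>_. 1) e G = (if G \<in> X then kz W (\<lambda>_. 1) c G else 0)"
      unfolding exact_at_def Suc by blast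
    show ?thesis
    proof (rule that[OF e(1)])
      fix G assume "G \<in> X"
      then show "kz W (\<lambda>_. 1) e G = kz W (\<lambda>_. 1) c G"
        using e(2)[of G] kz_subfamily_eq_0[OF e(1), of G] c by (cases "G \<in> Y") (auto simp: cycle_on_def)
    qed
  qed
  \<comment> \<open>Filling the boundary of \<open>c\<close> inside \<open>Y\<close> turns the
    relative cycle into an absolute one.\<close>
  have "cycle_on W X q (\<lambda>F. c F - e F)"
  proof -
    have "chain_on X q (\<lambda>F. c F - e F)"
      unfolding chain_on_def
    proof (intro allI impI)
      fix F assume "c F - e F \<noteq> 0"
      then have "c F \<noteq> 0 \<or> e F \<noteq> 0" by auto
      then show "F \<in> X \<and> card F = q" using cX e(1) Y unfolding chain_on_def by blast
    qed
    then show ?thesis using e(2) by (simp add: cycle_on_def kz_diff)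
  qed
  with assms(1) obtain h where h: "chain_on X (Suc q) h"
    "\<And>G. G \<in> X \<Longrightarrow> kz W (\<lambda>_. 1) h G = c G - e G"
    unfolding exact_at_def by blast
  \<comment> \<open>Erasing the values on \<open>Y\<close> is the passage to the quotient. It
    changes no boundary outside \<open>Y\<close>, since \<open>Y\<close> is closed downwards in
    \<open>X\<close>.\<close>
  define h' where "h' F = (if F \<in> Y then 0 else h F)" for F
  have "kz W (\<lambda>_. 1) h' G = c G" if G: "G \<in> X - Y" for G
  proof -
    have "kz W (\<lambda>_. 1) h' G = kz W (\<lambda>_. 1) h G"
      using G down[of G] by (intro kz_cong) (auto simp: h'_def)
    with h(2)[of G] G e(1) show ?thesis by (auto simp: chain_on_def)
  qed
  then show "\<exists>e. chain_on (X - Y) (Suc q) e \<and> (\<forall>G\<in>X - Y. kz W (\<lambda>_. 1) e G = c G)"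
    using h(1) by (intro exI[of _ h']) (auto simp: h'_def chain_on_def)
qed

text \<open>As \<open>X\<close> is exact in both degrees, the connecting map is an isomorphism. The
  last two assumptions make both degrees the top ones, so that cycles are determined themselves and
  not only up to boundaries.\<close>

lemma line_at_diff:
  assumes X1: "exact_at K W X (Suc q)" and X0: "exact_at K W X q" and line: "line_at K W Y q"
    and noX: "\<And>F. F \<in> X \<Longrightarrow> card F \<noteq> Suc (Suc q)" and noY: "\<And>F. F \<in> Y \<Longrightarrow> card F \<noteq> Suc q"
  shows "line_at K W (X - Y) (Suc q)"
proof -
  obtain z :: "'w set \<Rightarrow> 'a" where z: "cycle_on W Y q z" "\<exists>F. z F \<noteq> 0"
    "\<And>c. cycle_on W Y q c \<Longrightarrow> \<exists>a. \<forall>F. c F = a * z F"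
    using line unfolding line_at_def by blast
  \<comment> \<open>A filling in \<open>X\<close> of the generator of \<open>Y\<close>; read as a
    relative chain it generates the quotient.\<close>
  obtain h where h: "chain_on X (Suc q) h" "\<And>G. G \<in> X \<Longrightarrow> kz W (\<lambda>_. 1) h G = z G"
    using X0 cycle_on_subfamily[OF z(1)] unfolding exact_at_def by blast
  have hZ: "chain_on (X - Y) (Suc q) h"
    using h(1) noY by (auto simp: chain_on_def)
  have zY: "z G = 0" if "G \<notin> Y" for G using z(1) that by (auto simp: cycle_on_def chain_on_def)
  have "cycle_on W (X - Y) (Suc q) h"
    using hZ h(2) zY by (auto simp: cycle_on_def)
  moreover have "\<exists>F. h F \<noteq> 0"
  proof (rule ccontr)
    assume "\<not> (\<exists>F. h F \<noteq> 0)"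
    then have "h = (\<lambda>_. 0)" by auto
    then have "z G = 0" for G using h(2)[of G] zY[of G] Y by auto
    with z(2) show False by blast
  qed
  moreover have "\<exists>a. \<forall>F. c F = a * h F" if c: "cycle_on W (X - Y) (Suc q) c" for c
  proof -
    obtain a where a: "\<And>F. (if F \<in> X then kz W (\<lambda>_. 1) c F else 0) = a * z F"
      using z(3)[OF cycle_on_quotient_boundary[OF c]] by blast
    have "cycle_on W X (Suc q) (\<lambda>F. c F - a * h F)"
    proof -
      have "chain_on X (Suc q) (\<lambda>F. c F - a * h F)"
        unfolding chain_on_def
      proof (intro allI impI)
        fix F assume "c F - a * h F \<noteq> 0"
        then have "c F \<noteq> 0 \<or> h F \<noteq> 0" by auto
        then show "F \<in> X \<and> card F = Suc q"
          using c h(1) unfolding cycle_on_def chain_on_def by blast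
      qed
      moreover have "kz W (\<lambda>_. 1) c G - a * kz W (\<lambda>_. 1) h G = 0" if "G \<in> X" for G
        using a[of G] h(2)[OF that] that by simp
      ultimately show ?thesis by (simp add: cycle_on_def kz_diff kz_mult)
    qed
    with X1 obtain e where e: "chain_on X (Suc (Suc q)) e"
      "\<And>G. G \<in> X \<Longrightarrow> kz W (\<lambda>_. 1) e G = c G - a * h G"
      unfolding exact_at_def by blast
    from e(1) noX have "e = (\<lambda>_. 0)" by (auto simp: chain_on_def)
    then have "c G = a * h G" for G
    proof (cases "G \<in> X")
      case False
      then have "h G = 0" "c G = 0" using h(1) c unfolding chain_on_def cycle_on_def by blast+
      then show ?thesis by simp
    qed (use e(2)[of G] \<open>e = (\<lambda>_. 0)\<close> in auto)
    then show ?thesis by blast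
  qed
  ultimately show ?thesis unfolding line_at_def by blast
qed

end

section \<open>Substitution in polynomials\<close>

abbreviation "keys \<equiv> Poly_Mapping.keys"
abbreviation "lookup \<equiv> Poly_Mapping.lookup"

lemma Const_0 [simp]: "Const 0 = 0" by (simp add: Const_def)

lemma Const_1 [simp]: "Const 1 = 1" by (simp add: Const_def)

lemma Const_add: "Const (a + b) = Const a + Const b" by (simp add: Const_def single_add)

lemma Const_uminus: "Const (- a) = - Const a" by (simp add: Const_def single_uminus)

lemma Const_diff: "Const (a - b) = Const a - Const b" by (simp add: Const_def single_diff)

lemma Const_mult: "Const (a * b) = Const a * Const b" by (simp add: Const_def mult_single)

lemma Const_sum: "Const (sum f A) = (\<Sum>i\<in>A. Const (f i))"
  by (induction A rule: infinite_finite_induct) (auto simp: Const_add)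

lemma Const_eq_0_iff [simp]: "Const a = 0 \<longleftrightarrow> a = 0"
  by (metis Const_def Const_0 lookup_single_eq lookup_zero)

lemma Const_mult_single: "Const a * Poly_Mapping.single m b = Poly_Mapping.single m (a * b)"
  by (simp add: Const_def mult_single)

lemma sum_single_lookup:
  assumes "finite A" "keys p \<subseteq> A"
  shows "(\<Sum>m\<in>A. Poly_Mapping.single m (lookup p m)) = p"
proof (rule poly_mapping_eqI)
  fix m
  have "lookup (\<Sum>m\<in>A. Poly_Mapping.single m (lookup p m)) m = (\<Sum>m'\<in>A. if m' = m then lookup p m else 0)"
    by (auto simp: lookup_sum lookup_single when_def intro!: sum.cong)
  also have "\<dots> = lookup p m"
    using assms by (auto simp: in_keys_iff)
  finally show "lookup (\<Sum>m\<in>A. Poly_Mapping.single m (lookup p m)) m = lookup p m" .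
qed

definition mexp :: "('w \<Rightarrow> 'r::comm_semiring_1) \<Rightarrow> ('w \<Rightarrow>\<^sub>0 nat) \<Rightarrow> 'r" where
  "mexp s m = (\<Prod>w\<in>keys m. s w ^ lookup m w)"

lemma mexp_superset:
  assumes "finite A" "keys m \<subseteq> A"
  shows "mexp s m = (\<Prod>w\<in>A. s w ^ lookup m w)"
  unfolding mexp_def using assms by (intro prod.mono_neutral_left) (auto simp: in_keys_iff)

lemma mexp_0 [simp]: "mexp s 0 = 1"
  by (simp add: mexp_def)

lemma mexp_single [simp]: "mexp s (Poly_Mapping.single w k) = s w ^ k"
  by (simp add: mexp_def)

lemma mexp_add: "mexp s (m + m') = mexp s m * mexp s m'"
proof -
  let ?A = "keys m \<union> keys m'"
  have "keys (m + m') \<subseteq> ?A" by (rule keys_add)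
  then show ?thesis
    by (simp add: mexp_superset[of ?A] lookup_add power_add prod.distrib)
qed

text \<open>The k-algebra homomorphism with x_w \<mapsto> \<open>s w\<close>. Restriction to a face,
  elimination of a variable and evaluation along a line are all instances.\<close>

definition psubst :: "('w \<Rightarrow> ('v, 'k::comm_ring_1) mpoly) \<Rightarrow> ('w, 'k) mpoly \<Rightarrow> ('v, 'k) mpoly" where
  "psubst s p = (\<Sum>m\<in>keys p. Const (lookup p m) * mexp s m)"

lemma psubst_superset:
  assumes "finite A" "keys p \<subseteq> A"
  shows "psubst s p = (\<Sum>m\<in>A. Const (lookup p m) * mexp s m)"
  unfolding psubst_def using assms by (intro sum.mono_neutral_left) (auto simp: in_keys_iff)

lemma psubst_0 [simp]: "psubst s 0 = 0"
  by (simp add: psubst_def)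

lemma psubst_add [simp]: "psubst s (p + q) = psubst s p + psubst s q"
proof -
  let ?A = "keys p \<union> keys q"
  have "keys (p + q) \<subseteq> ?A" by (rule keys_add)
  then show ?thesis
    by (simp add: psubst_superset[of ?A] lookup_add Const_add sum.distrib algebra_simps)
qed

lemma psubst_single: "psubst s (Poly_Mapping.single m c) = Const c * mexp s m"
  by (simp add: psubst_def)

lemma psubst_Const [simp]: "psubst s (Const c) = Const c"
  by (simp add: Const_def psubst_single)

lemma psubst_1 [simp]: "psubst s 1 = 1"
  using psubst_Const[of s 1] by simp

lemma psubst_Var [simp]: "psubst s (Var w) = s w"
  by (simp add: Var_def psubst_single)

lemma psubst_sum [simp]: "psubst s (sum f A) = (\<Sum>i\<in>A. psubst s (f i))"
  by (induction A rule: infinite_finite_induct) auto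

lemma psubst_mult [simp]: "psubst s (p * q) = psubst s p * psubst s q"
proof -
  have "p * q = (\<Sum>m\<in>keys p. Poly_Mapping.single m (lookup p m)) * (\<Sum>m\<in>keys q. Poly_Mapping.single m (lookup q m))"
    by (simp add: sum_single_lookup)
  also have "\<dots> = (\<Sum>m\<in>keys p. \<Sum>m'\<in>keys q. Poly_Mapping.single (m + m') (lookup p m * lookup q m'))"
    by (simp add: sum_product mult_single)
  finally have "psubst s (p * q) = (\<Sum>m\<in>keys p. \<Sum>m'\<in>keys q.
      (Const (lookup p m) * mexp s m) * (Const (lookup q m') * mexp s m'))"
    by (simp add: psubst_single mexp_add Const_mult algebra_simps)
  then show ?thesis by (simp add: psubst_def sum_product)
qed

lemma psubst_uminus [simp]: "psubst s (- p) = - psubst s p"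
proof -
  have "psubst s (- p) + psubst s p = psubst s (- p + p)" by (simp only: psubst_add)
  then show ?thesis by (simp add: eq_neg_iff_add_eq_0)
qed

lemma psubst_diff [simp]: "psubst s (p - q) = psubst s p - psubst s q"
  using psubst_add[of s p "- q"] by (simp del: psubst_add)

lemma psubst_power [simp]: "psubst s (p ^ k) = psubst s p ^ k"
  by (induction k) auto

lemma psubst_prod [simp]: "psubst s (prod f A) = (\<Prod>i\<in>A. psubst s (f i))"
  by (induction A rule: infinite_finite_induct) auto

lemma psubst_mexp: "psubst s (mexp t m) = mexp (\<lambda>w. psubst s (t w)) m"
  by (simp add: mexp_def)

lemma psubst_psubst: "psubst s (psubst t p) = psubst (\<lambda>w. psubst s (t w)) p"
  by (simp add: psubst_def[of t] psubst_def[of "\<lambda>w. psubst s (t w)"] psubst_mexp)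

lemma psubst_ksgn [simp]: "psubst s (ksgn i T) = ksgn i T"
  by (simp add: ksgn_def)

lemma psubst_kz: "psubst s (kz A c f T) = kz A (\<lambda>i. psubst s (c i)) (\<lambda>S. psubst s (f S)) T"
  by (simp add: kz_def)

lemma mexp_Var: "mexp Var m = Poly_Mapping.single m 1"
proof -
  have pow: "(Var w :: ('a, 'b) mpoly) ^ k = Poly_Mapping.single (Poly_Mapping.single w k) 1" for w k
    by (induction k) (auto simp: Var_def mult_single simp flip: single_add)
  have "(\<Prod>w\<in>A. Poly_Mapping.single (g w) (1::'b)) = Poly_Mapping.single (sum g A) 1"
    if "finite A" for g :: "'a \<Rightarrow> ('a \<Rightarrow>\<^sub>0 nat)" and A
    using that by (induction A rule: finite_induct) (auto simp: mult_single)
  then show ?thesis by (simp add: mexp_def pow sum_single_lookup)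
qed

lemma psubst_Var_id [simp]: "psubst Var p = p"
  by (simp add: psubst_def mexp_Var Const_mult_single sum_single_lookup)

section \<open>Restriction to a set of variables\<close>

text \<open>The retraction onto k[F]. Membership of \<open>p\<close> in k[F] is expressed throughout
  by \<open>pres F p = p\<close>.\<close>

definition pres :: "'w set \<Rightarrow> ('w, 'k::comm_ring_1) mpoly \<Rightarrow> ('w, 'k) mpoly" where
  "pres F = psubst (\<lambda>w. if w \<in> F then Var w else 0)"

lemma lookup_pres:
  fixes p :: "('w, 'k::comm_ring_1) mpoly"
  shows "lookup (pres F p) m = (if keys m \<subseteq> F then lookup p m else 0)"
proof -
  have mexp: "mexp (\<lambda>w. if w \<in> F then Var w else 0) m' =
      (if keys m' \<subseteq> F then Poly_Mapping.single m' (1::'k) else 0)" for m' :: "'w \<Rightarrow>\<^sub>0 nat"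
  proof (cases "keys m' \<subseteq> F")
    case True
    then have "mexp (\<lambda>w. if w \<in> F then Var w else 0) m' = mexp (Var :: 'w \<Rightarrow> ('w, 'k) mpoly) m'"
      unfolding mexp_def by (intro prod.cong) auto
    with True show ?thesis by (simp add: mexp_Var)
  next
    case False
    then obtain w where "w \<in> keys m'" "w \<notin> F" by auto
    with False show ?thesis
      unfolding mexp_def by (auto simp: in_keys_iff power_0_left intro!: prod_zero bexI[of _ w])
  qed
  have "lookup (pres F p) m = (\<Sum>m'\<in>keys p. if m' = m then (if keys m \<subseteq> F then lookup p m else 0) else 0)"
    unfolding pres_def psubst_def mexp lookup_sum
    by (intro sum.cong) (auto simp: Const_mult_single lookup_single when_def)
  then show ?thesis by (simp add: in_keys_iff)
qed

lemma pres_hom [simp]: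
  "pres F 0 = 0" "pres F 1 = 1" "pres F (Const c) = Const c"
  "pres F (p + q) = pres F p + pres F q" "pres F (p - q) = pres F p - pres F q"
  "pres F (- p) = - pres F p" "pres F (p * q) = pres F p * pres F q"
  "pres F (sum f A) = (\<Sum>i\<in>A. pres F (f i))" "pres F (ksgn i T) = ksgn i T"
  by (simp_all add: pres_def)

lemma pres_Var: "pres F (Var w) = (if w \<in> F then Var w else 0)"
  by (simp add: pres_def)

lemma pres_kz: "pres F (kz A c f T) = kz A (\<lambda>i. pres F (c i)) (\<lambda>S. pres F (f S)) T"
  by (simp add: kz_def)

lemma pres_pres: "pres F (pres G p) = pres (F \<inter> G) p"
  by (rule poly_mapping_eqI) (auto simp: lookup_pres)

lemma pres_mono: "pres F p = p \<Longrightarrow> F \<subseteq> G \<Longrightarrow> pres G p = p"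
  by (metis pres_pres inf.absorb_iff2)

lemma psubst_pres: "psubst s (pres F p) = psubst (\<lambda>w. if w \<in> F then s w else 0) p"
  unfolding pres_def psubst_psubst by (rule arg_cong2[of _ _ _ _ psubst]) auto

definition lin :: "'w set \<Rightarrow> ('w \<Rightarrow> 'k::comm_ring_1) \<Rightarrow> ('w, 'k) mpoly" where
  "lin F a = (\<Sum>w\<in>F. Const (a w) * Var w)"

lemma psubst_lin: "psubst s (lin F a) = (\<Sum>w\<in>F. Const (a w) * s w)"
  by (simp add: lin_def)

lemma pres_lin:
  assumes "finite G"
  shows "pres F (lin G a) = lin (F \<inter> G) a"
proof -
  have "pres F (lin G a) = (\<Sum>w\<in>G. if w \<in> F then Const (a w) * Var w else 0)"
    by (auto simp: lin_def pres_Var intro!: sum.cong)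
  also have "\<dots> = lin (F \<inter> G) a"
    using assms by (simp add: lin_def sum.inter_restrict[symmetric] Int_commute)
  finally show ?thesis .
qed

lemma dvd_mult_diff:
  fixes t :: "'r::comm_ring_1"
  assumes "t dvd a - b" "t dvd c - d"
  shows "t dvd a * c - b * d"
proof -
  have "a * c - b * d = (a - b) * c + b * (c - d)" by (simp add: algebra_simps)
  with assms show ?thesis by simp
qed

text \<open>Congruent substitutions have congruent values. With \<open>s = Var\<close> and
  \<open>s'\<close> changed at one variable only, this is the factor theorem.\<close>

lemma dvd_psubst_diff:
  assumes "\<And>w. t dvd s w - s' w"
  shows "t dvd psubst s p - psubst s' p"
proof -
  have pow: "t dvd s w ^ k - s' w ^ k" for w k
    by (induction k) (auto intro: dvd_mult_diff assms)
  have "t dvd (\<Prod>w\<in>A. s w ^ f w) - (\<Prod>w\<in>A. s' w ^ f w)" for A f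
    by (induction A rule: infinite_finite_induct) (auto intro: dvd_mult_diff pow)
  then have "t dvd mexp s m - mexp s' m" for m by (simp add: mexp_def)
  then have "t dvd (\<Sum>m\<in>keys p. Const (lookup p m) * (mexp s m - mexp s' m))"
    by (intro dvd_sum dvd_mult) auto
  then show ?thesis by (simp add: psubst_def right_diff_distrib sum_subtractf)
qed

section \<open>Exactness of Koszul complexes of linear forms\<close>

text \<open>One variable and one form are eliminated at a time: the quotient of the polynomial ring by
  a linear form is a polynomial ring in one variable less, and the form is a nonzerodivisor.\<close>
lemma koszul_exact:
  fixes a :: "'i::linorder \<Rightarrow> 'w::linorder \<Rightarrow> 'k::field"
  assumes "finite F" and "finite A"
    and "\<And>x w. (\<And>i. i \<in> A \<Longrightarrow> (\<Sum>v\<in>F. a i v * x v) = 0) \<Longrightarrow> w \<in> F \<Longrightarrow> x w = 0"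
    and "\<And>S. z S \<noteq> 0 \<Longrightarrow> S \<subseteq> A \<and> card S = j" and "\<And>S. pres F (z S) = z S"
    and "\<And>T. kz A (\<lambda>i. lin F (a i)) z T = 0"
    and "card A < j + card F"
  shows "\<exists>y. (\<forall>S. y S \<noteq> 0 \<longrightarrow> S \<subseteq> A \<and> card S = Suc j) \<and> (\<forall>S. pres F (y S) = y S) \<and>
    (\<forall>T. kz A (\<lambda>i. lin F (a i)) y T = z T)"
  using assms
proof (induction F arbitrary: A a z rule: finite_induct)
  case empty
  \<comment> \<open>Without variables the bound says j > |A|, so there is no index set of size
    j.\<close>
  have "z S = 0" for S
  proof (rule ccontr)
    assume "z S \<noteq> 0"
    then have "S \<subseteq> A" "card S = j" using empty by auto
    with empty card_mono[of A S] show False by simp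
  qed
  then show ?case by (intro exI[of _ "\<lambda>_. 0"]) auto
next
  case (insert w F)
  let ?F = "insert w F"
  \<comment> \<open>Otherwise the indicator function of \<open>w\<close> would be a common zero of
    the forms.\<close>
  have "\<exists>k\<in>A. a k w \<noteq> 0"
  proof (rule ccontr)
    assume no: "\<not> (\<exists>k\<in>A. a k w \<noteq> 0)"
    have "(\<Sum>v\<in>?F. a i v * (if v = w then 1 else 0)) = 0" if "i \<in> A" for i
      using no that by (intro sum.neutral) auto
    then have "(if w = w then 1 else (0::'k)) = 0"
      using insert.prems(2)[of "\<lambda>v. if v = w then 1 else 0" w] by simp
    then show False by simp
  qed
  then obtain k where k: "k \<in> A" "a k w \<noteq> 0" by blast
  \<comment> \<open>Solving form \<open>k\<close> for x_w gives x_w = \<open>r\<close>. Substituting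
    this, \<open>\<rho>\<close> realizes the quotient by form \<open>k\<close> as k[F], and
    \<open>a'\<close> holds the coefficients of the other forms in the quotient.\<close>
  define c where "c v = a k v / a k w" for v
  define r where "r = - lin F c"
  define \<rho> :: "('w, 'k) mpoly \<Rightarrow> ('w, 'k) mpoly" where "\<rho> = psubst (Var(w := r))"
  define a' where "a' i v = a i v - a i w * c v" for i v
  let ?A = "A - {k}"
  let ?l = "\<lambda>i. lin ?F (a i)" and ?l' = "\<lambda>i. lin F (a' i)"
  have lin_k: "?l k = Const (a k w) * (Var w - r)"
  proof -
    have "Const (a k w) * lin F c = lin F (a k)"
      unfolding lin_def sum_distrib_left using k(2)
      by (intro sum.cong) (auto simp: c_def mult.assoc[symmetric] simp flip: Const_mult)
    then show ?thesis using insert.hyps by (simp add: r_def lin_def algebra_simps)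
  qed
  have \<rho>l: "\<rho> (?l i) = ?l' i" for i
  proof -
    have "\<rho> (?l i) = Const (a i w) * r + (\<Sum>v\<in>F. Const (a i v) * Var v)"
      using insert.hyps by (auto simp: \<rho>_def psubst_lin intro!: sum.cong)
    also have "\<dots> = ?l' i"
      by (simp add: r_def lin_def a'_def sum_distrib_left Const_mult Const_diff
        algebra_simps sum_subtractf)
    finally show ?thesis .
  qed
  have \<rho>lk: "?l' k = 0"
    using k by (simp add: lin_def a'_def c_def)
  have lk0: "?l k \<noteq> 0"
  proof
    assume "?l k = 0"
    then have "psubst (\<lambda>v. if v = w then 1 else 0) (?l k) = (0 :: ('w, 'k) mpoly)" by simp
    then show False using insert.hyps k by (simp add: psubst_lin if_distrib cong: if_cong)
  qed
  have presl: "pres ?F (?l i) = ?l i" for i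
    using insert.hyps by (simp add: pres_lin)
  have pres\<rho>: "pres F (\<rho> p) = \<rho> p" if "pres ?F p = p" for p
  proof -
    have r: "pres F r = r" using insert.hyps by (simp add: r_def pres_lin)
    have "\<rho> (pres ?F p) = psubst (\<lambda>v. if v \<in> F then Var v else if v = w then r else 0) p"
      using insert.hyps unfolding \<rho>_def psubst_pres by (intro arg_cong2[of _ _ _ _ psubst]) auto
    then have "\<rho> p = psubst (\<lambda>v. if v \<in> F then Var v else if v = w then r else 0) p"
      using that by simp
    moreover have "pres F (psubst (\<lambda>v. if v \<in> F then Var v else if v = w then r else 0) p) =
        psubst (\<lambda>v. if v \<in> F then Var v else if v = w then r else 0) p"
      unfolding pres_def psubst_psubst using r
      by (intro arg_cong2[of _ _ _ _ psubst]) (auto simp: pres_def)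
    ultimately show ?thesis by simp
  qed
  have \<rho>id: "\<rho> p = p" if "pres F p = p" for p
  proof -
    have "\<rho> (pres F p) = pres F p"
      unfolding \<rho>_def psubst_pres unfolding pres_def
      using insert.hyps by (intro arg_cong2[of _ _ _ _ psubst]) auto
    with that show ?thesis by simp
  qed
  \<comment> \<open>On the polynomials in the variables \<open>?F\<close> the kernel of
    \<open>\<rho>\<close> is generated by form \<open>k\<close>.\<close>
  have divide: "\<exists>q. p = ?l k * q \<and> pres ?F q = q" if p0: "\<rho> p = 0" and pF: "pres ?F p = p" for p
  proof -
    have "Var w - r dvd psubst Var p - \<rho> p"
      unfolding \<rho>_def by (rule dvd_psubst_diff) auto
    then obtain q where q: "p = (Var w - r) * q" using p0 by (auto elim: dvdE)
    have "p = ?l k * (Const (1 / a k w) * q)"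
    proof -
      have "Const (a k w) * Const (1 / a k w) = (1 :: ('w, 'k) mpoly)"
        using k by (simp flip: Const_mult)
      then show ?thesis unfolding q lin_k by (simp add: algebra_simps)
    qed
    then have "pres ?F p = ?l k * pres ?F (Const (1 / a k w) * q)"
      using presl[of k] by (metis pres_hom(7))
    with pF show ?thesis
      by (intro exI[of _ "pres ?F (Const (1 / a k w) * q)"]) (simp add: pres_pres)
  qed
  define z0 where "z0 S = (if k \<in> S then 0 else \<rho> (z S))" for S
  have sub: "S \<subseteq> ?A" if "S \<subseteq> A" "k \<notin> S" for S using that by auto
  have kz_split: "kz A ?l f T = ksgn k T * ?l k * f (insert k T) + kz ?A ?l f T" if "k \<notin> T" for f T
  proof -
    have "A - T = insert k (?A - T)" using k(1) that by auto
    moreover have "k \<notin> ?A - T" "finite (?A - T)" using insert.prems(1) by auto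
    ultimately show ?thesis by (simp add: kz_def)
  qed
  have \<rho>kz: "\<rho> (kz B ?l f T) = kz B ?l' (\<lambda>S. \<rho> (f S)) T" for B f T
    using \<rho>l by (simp add: \<rho>_def psubst_kz)
  obtain y0 where y0: "\<And>S. y0 S \<noteq> 0 \<Longrightarrow> S \<subseteq> ?A \<and> card S = Suc j"
    "\<And>S. pres F (y0 S) = y0 S" "\<And>T. kz ?A ?l' y0 T = z0 T"
  proof -
    have "\<exists>y. (\<forall>S. y S \<noteq> 0 \<longrightarrow> S \<subseteq> ?A \<and> card S = Suc j) \<and> (\<forall>S. pres F (y S) = y S) \<and>
        (\<forall>T. kz ?A ?l' y T = z0 T)"
    proof (rule insert.IH)
      show "finite ?A" using insert.prems by simp
      show "card ?A < j + card F"
        using insert.prems(1,6) insert.hyps card_Suc_Diff1[OF insert.prems(1) k(1)] by simp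
    next
      fix x v assume x: "\<And>i. i \<in> ?A \<Longrightarrow> (\<Sum>v\<in>F. a' i v * x v) = 0" and v: "v \<in> F"
      \<comment> \<open>A common zero of the reduced forms extends to one of the original forms,
        with the coordinate at \<open>w\<close> dictated by form \<open>k\<close>.\<close>
      define x' where "x' = x(w := - (\<Sum>v\<in>F. c v * x v))"
      have "x' v = 0"
      proof (rule insert.prems(2))
        show "v \<in> ?F" using v by simp
        fix i assume i: "i \<in> A"
        have "(\<Sum>v\<in>?F. a i v * x' v) = a i w * x' w + (\<Sum>v\<in>F. a i v * x v)"
          using insert.hyps by (auto simp: x'_def intro!: sum.cong)
        also have "\<dots> = (\<Sum>v\<in>F. a' i v * x v)"
          by (simp add: x'_def a'_def algebra_simps sum_subtractf sum_distrib_left)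
        also have "\<dots> = 0"
        proof (cases "i = k")
          case True
          then show ?thesis using k by (simp add: a'_def c_def)
        qed (use x i in auto)
        finally show "(\<Sum>v\<in>?F. a i v * x' v) = 0" .
      qed
      with v insert.hyps show "x v = 0" by (auto simp: x'_def split: if_splits)
    next
      fix S assume "z0 S \<noteq> 0"
      then have "k \<notin> S" "z S \<noteq> 0" by (auto simp: z0_def \<rho>_def split: if_splits)
      with insert.prems(3)[of S] sub show "S \<subseteq> ?A \<and> card S = j" by blast
    next
      fix S show "pres F (z0 S) = z0 S"
        using pres\<rho> insert.prems(4) by (simp add: z0_def)
    next
      fix T
      show "kz ?A ?l' z0 T = 0"
      proof (cases "k \<in> T")
        case True
        then show ?thesis by (intro kz_eq_0I) (simp add: z0_def)
      next
        case False
        have "\<rho> (kz A ?l z T) = 0" using insert.prems(5) by (simp add: \<rho>_def)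
        then have "\<rho> (ksgn k T * ?l k * z (insert k T)) + kz ?A ?l' (\<lambda>S. \<rho> (z S)) T = 0"
          using kz_split[OF False, of z] by (simp add: \<rho>kz[symmetric]) (simp add: \<rho>_def)
        moreover have "\<rho> (ksgn k T * ?l k * z (insert k T)) = 0"
          using \<rho>l[of k] \<rho>lk by (simp add: \<rho>_def)
        moreover have "kz ?A ?l' z0 T = kz ?A ?l' (\<lambda>S. \<rho> (z S)) T"
          using False by (intro kz_cong) (auto simp: z0_def)
        ultimately show ?thesis by simp
      qed
    qed
    then show ?thesis using that by blast
  qed
  \<comment> \<open>Away from \<open>k\<close>, the lift \<open>y0\<close> found modulo form
    \<open>k\<close> is correct up to multiples of that form. The quotients \<open>u\<close> become
    the components of \<open>y\<close> at the sets containing \<open>k\<close>.\<close>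
  have "\<exists>q. z S - kz ?A ?l y0 S = ?l k * q \<and> pres ?F q = q" if "k \<notin> S" for S
  proof (rule divide)
    show "\<rho> (z S - kz ?A ?l y0 S) = 0"
    proof -
      have "\<rho> (z S - kz ?A ?l y0 S) = \<rho> (z S) - \<rho> (kz ?A ?l y0 S)" by (simp add: \<rho>_def)
      also have "\<rho> (kz ?A ?l y0 S) = z0 S" using y0(2,3) \<rho>id by (simp add: \<rho>kz)
      finally show ?thesis using that by (simp add: z0_def)
    qed
    have "pres ?F (y0 S) = y0 S" for S using y0(2) pres_mono by blast
    then show "pres ?F (z S - kz ?A ?l y0 S) = z S - kz ?A ?l y0 S"
      using insert.prems(4) presl by (simp add: pres_kz)
  qed
  then obtain u where u: "\<And>S. k \<notin> S \<Longrightarrow> z S - kz ?A ?l y0 S = ?l k * u S"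
    "\<And>S. k \<notin> S \<Longrightarrow> pres ?F (u S) = u S" by metis
  have u0: "u S = 0" if "k \<notin> S" "\<not> (S \<subseteq> ?A \<and> card S = j)" for S
  proof -
    have "z S = 0" using insert.prems(3)[of S] that sub by blast
    moreover have "kz ?A ?l y0 S = 0"
    proof (rule kz_eq_0I)
      fix i assume i: "i \<in> ?A" "i \<notin> S"
      show "y0 (insert i S) = 0"
      proof (rule ccontr)
        assume "y0 (insert i S) \<noteq> 0"
        then have "insert i S \<subseteq> ?A" "card (insert i S) = Suc j" using y0(1) by auto
        moreover from this have "finite S" using insert.prems(1) by (meson finite_Diff finite_insert finite_subset)
        ultimately show False using i that(2) by auto
      qed
    qed
    ultimately show ?thesis using u(1)[OF that(1)] lk0 by simp
  qed
  define y where "y S = (if k \<in> S then ksgn k (S - {k}) * u (S - {k}) else y0 S)" for S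
  have y_support: "S \<subseteq> A \<and> card S = Suc j" if "y S \<noteq> 0" for S
  proof (cases "k \<in> S")
    case True
    with that have "u (S - {k}) \<noteq> 0" by (auto simp: y_def)
    with u0[of "S - {k}"] have *: "S - {k} \<subseteq> ?A" "card (S - {k}) = j" by auto
    moreover have "finite S"
      using *(1) insert.prems(1) by (meson finite_Diff finite_Diff2 finite.emptyI finite.insertI finite_subset)
    ultimately show ?thesis using True k(1) by (auto simp: card_Suc_Diff1 dest: card_Suc_Diff1)
  next
    case False
    with that y0(1)[of S] show ?thesis by (auto simp: y_def)
  qed
  have y_pres: "pres ?F (y S) = y S" for S
    using u(2)[of "S - {k}"] y0(2)[of S] pres_mono[of F "y0 S" ?F] by (auto simp: y_def)
  have y_off: "kz A ?l y T = z T" if "k \<notin> T" for T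
  proof -
    have "y (insert k T) = ksgn k T * u T" using that by (simp add: y_def)
    moreover have "kz ?A ?l y T = kz ?A ?l y0 T"
      using that by (intro kz_cong) (auto simp: y_def)
    moreover have "ksgn k T * ?l k * (ksgn k T * u T) = (ksgn k T * ksgn k T) * (?l k * u T)"
      by (simp only: ac_simps)
    ultimately show ?thesis using u(1)[OF that] kz_split[OF that, of y] by (simp add: algebra_simps)
  qed
  have "kz A ?l y T = z T" for T
  proof (cases "k \<in> T \<and> finite T")
    case False
    show ?thesis
    proof (cases "k \<in> T")
      case True
      with False have "infinite T" by simp
      then have "z T = 0" using insert.prems(1,3) finite_subset by blast
      moreover have "kz A ?l y T = 0"
      proof (rule kz_eq_0I)
        fix i
        have "\<not> insert i T \<subseteq> A" using \<open>infinite T\<close> insert.prems(1) finite_subset by auto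
        then show "y (insert i T) = 0" using y_support by blast
      qed
      ultimately show ?thesis by simp
    qed (rule y_off)
  next
    case True
    define T' where "T' = T - {k}"
    have T: "T = insert k T'" "k \<notin> T'" "finite T'" using True by (auto simp: T'_def)
    \<comment> \<open>The error \<open>e\<close> is a cycle and vanishes at all sets without
      \<open>k\<close>. Its cycle condition at \<open>T'\<close> therefore has a single term, form
      \<open>k\<close> times \<open>e T\<close>, and form \<open>k\<close> is a
      nonzerodivisor.\<close>
    define e where "e S = z S - kz A ?l y S" for S
    have "kz A ?l e T' = 0"
      unfolding e_def kz_diff using insert.prems(1,5) T(3) kz_kz by simp
    moreover have "kz ?A ?l e T' = 0"
      using T(2) y_off by (intro kz_eq_0I) (auto simp: e_def)
    ultimately have "ksgn k T' * ?l k * e T = 0"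
      using kz_split[OF T(2), of e] T(1) by simp
    moreover have "ksgn k T' \<noteq> (0 :: ('w, 'k) mpoly)"
      by (simp add: ksgn_def)
    ultimately show ?thesis using lk0 by (simp add: e_def)
  qed
  then show ?case using y_support y_pres by blast
qed

section \<open>Monomial ideals and linear systems of parameters\<close>

lemma ksgn_eq_Const: "ksgn i T = Const (ksgn i T)"
proof -
  have "Const ((- 1) ^ k) = (- 1 :: ('a, 'b) mpoly) ^ k" for k
    by (induction k) (auto simp: Const_mult Const_uminus)
  then show ?thesis by (simp add: ksgn_def)
qed

lemma lookup_Const_mult: "lookup (Const a * p) m = a * lookup p m"
proof -
  have "Const a * p = Poly_Mapping.map ((*) a) p"
    by (simp add: Const_def mult_map_scale_conv_mult)
  then show ?thesis by (simp add: Poly_Mapping.map.rep_eq when_def)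
qed

lemma lookup_ksgn_mult:
  fixes p :: "('w, 'k::comm_ring_1) mpoly"
  shows "lookup (ksgn i T * p) m = ksgn i T * lookup p m"
  using lookup_Const_mult[of "ksgn i T" p m] by (simp flip: ksgn_eq_Const)

lemma lookup_kz:
  fixes f :: "'i::linorder set \<Rightarrow> ('w, 'k::comm_ring_1) mpoly"
  shows "lookup (kz W (\<lambda>_. 1) f F) m = kz W (\<lambda>_. 1) (\<lambda>F. lookup (f F) m) F"
  by (simp add: kz_def lookup_sum lookup_ksgn_mult)

lemma ideal_gen_gen:
  assumes "g \<in> G"
  shows "r * g \<in> ideal_gen G"
  unfolding ideal_gen_def using assms by (auto intro!: exI[of _ "{g}"] exI[of _ "\<lambda>_. r"])

lemma ideal_gen_0: "0 \<in> ideal_gen G"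
  unfolding ideal_gen_def by (auto intro!: exI[of _ "{}"])

lemma ideal_gen_add:
  assumes "p \<in> ideal_gen G" "q \<in> ideal_gen G"
  shows "p + q \<in> ideal_gen G"
proof -
  obtain A r where A: "finite A" "A \<subseteq> G" "p = (\<Sum>g\<in>A. r g * g)" using assms(1) by (auto simp: ideal_gen_def)
  obtain B s where B: "finite B" "B \<subseteq> G" "q = (\<Sum>g\<in>B. s g * g)" using assms(2) by (auto simp: ideal_gen_def)
  define t where "t g = (if g \<in> A then r g else 0) + (if g \<in> B then s g else 0)" for g
  have "p = (\<Sum>g\<in>A \<union> B. (if g \<in> A then r g else 0) * g)"
    unfolding A(3) using A(1) B(1) by (intro sum.mono_neutral_cong_left) auto
  moreover have "q = (\<Sum>g\<in>A \<union> B. (if g \<in> B then s g else 0) * g)"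
    unfolding B(3) using A(1) B(1) by (intro sum.mono_neutral_cong_left) auto
  ultimately have "p + q = (\<Sum>g\<in>A \<union> B. t g * g)"
    by (simp add: t_def algebra_simps sum.distrib)
  then show ?thesis unfolding ideal_gen_def using A(1,2) B(1,2) by blast
qed

lemma ideal_gen_sum: "(\<And>i. i \<in> A \<Longrightarrow> f i \<in> ideal_gen G) \<Longrightarrow> sum f A \<in> ideal_gen G"
  by (induction A rule: infinite_finite_induct) (auto intro: ideal_gen_0 ideal_gen_add)

lemma ideal_gen_induct [consumes 1, case_names zero add gen]:
  assumes "p \<in> ideal_gen G" and "P 0" and "\<And>x y. P x \<Longrightarrow> P y \<Longrightarrow> P (x + y)"
    and "\<And>r g. g \<in> G \<Longrightarrow> P (r * g)"
  shows "P p"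
proof -
  obtain A r where A: "finite A" "A \<subseteq> G" "p = (\<Sum>g\<in>A. r g * g)" using assms(1) by (auto simp: ideal_gen_def)
  from A(1,2) have "P (\<Sum>g\<in>A. r g * g)"
    by (induction A rule: finite_induct) (use assms(2-) in auto)
  then show ?thesis using A(3) by simp
qed

lemma ideal_gen_mult: "p \<in> ideal_gen G \<Longrightarrow> q * p \<in> ideal_gen G"
proof (induction rule: ideal_gen_induct)
  case (gen r g)
  then show ?case using ideal_gen_gen[of g G "q * r"] by (simp add: mult.assoc)
qed (auto intro: ideal_gen_0 ideal_gen_add simp: distrib_left)

lemma ideal_gen_mono: "p \<in> ideal_gen G \<Longrightarrow> G \<subseteq> H \<Longrightarrow> p \<in> ideal_gen H"
  by (auto simp: ideal_gen_def)

lemma monom_eq_single: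
  "finite F \<Longrightarrow> monom F = Poly_Mapping.single (\<Sum>w\<in>F. Poly_Mapping.single w 1) 1"
  unfolding monom_def by (induction F rule: finite_induct) (auto simp: Var_def mult_single)

lemma lookup_indicator_monomial:
  "finite F \<Longrightarrow> lookup (\<Sum>w\<in>F. Poly_Mapping.single w (1::nat)) v = (if v \<in> F then 1 else 0)"
  by (simp add: lookup_sum lookup_single when_def)

lemma keys_add_nat: "keys (m + m' :: 'w \<Rightarrow>\<^sub>0 nat) = keys m \<union> keys m'"
  by (auto simp: in_keys_iff lookup_add)

text \<open>A squarefree monomial divides another monomial iff its vertex set lies in the support of
  the latter. Ideal membership thereby becomes a condition on each monomial separately.\<close>

lemma ideal_gen_monom_iff:
  fixes p :: "('w, 'k::comm_ring_1) mpoly"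
  assumes fin: "\<And>F. F \<in> FF \<Longrightarrow> finite F"
  shows "p \<in> ideal_gen (monom ` FF) \<longleftrightarrow> (\<forall>m\<in>keys p. \<exists>F\<in>FF. F \<subseteq> keys m)"
proof
  assume "p \<in> ideal_gen (monom ` FF)"
  then show "\<forall>m\<in>keys p. \<exists>F\<in>FF. F \<subseteq> keys m"
  proof (induction rule: ideal_gen_induct)
    case (add x y)
    then show ?case using keys_add[of x y] by blast
  next
    case (gen r g)
    then obtain F where F: "F \<in> FF" "g = monom F" by auto
    show ?case
    proof
      fix m assume "m \<in> keys (r * g)"
      then obtain a c where m: "m = a + c" "c \<in> keys g" using keys_mult[of r g] by blast
      then have "c = (\<Sum>w\<in>F. Poly_Mapping.single w 1)"
        unfolding F(2) monom_eq_single[OF fin[OF F(1)]] by (auto split: if_splits)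
      then have "F \<subseteq> keys c" using fin[OF F(1)] by (auto simp: in_keys_iff lookup_indicator_monomial simp del: One_nat_def)
      then show "\<exists>F\<in>FF. F \<subseteq> keys m" using F(1) m(1) by (auto simp: keys_add_nat)
    qed
  qed simp
next
  assume R: "\<forall>m\<in>keys p. \<exists>F\<in>FF. F \<subseteq> keys m"
  have "(\<Sum>m\<in>keys p. Poly_Mapping.single m (lookup p m)) \<in> ideal_gen (monom ` FF)"
  proof (rule ideal_gen_sum)
    fix m assume "m \<in> keys p"
    with R obtain F where F: "F \<in> FF" "F \<subseteq> keys m" by blast
    let ?u = "\<Sum>w\<in>F. Poly_Mapping.single w (1::nat)"
    have "m - ?u + ?u = m"
    proof (rule poly_mapping_eqI)
      fix v show "lookup (m - ?u + ?u) v = lookup m v"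
        using F(2) by (auto simp: lookup_add lookup_minus lookup_indicator_monomial[OF fin[OF F(1)]] in_keys_iff
          simp del: One_nat_def)
    qed
    then have "Poly_Mapping.single m (lookup p m) = Poly_Mapping.single (m - ?u) (lookup p m) * monom F"
      by (simp add: monom_eq_single[OF fin[OF F(1)]] mult_single)
    then show "Poly_Mapping.single m (lookup p m) \<in> ideal_gen (monom ` FF)"
      using F(1) by (simp add: ideal_gen_gen)
  qed
  then show "p \<in> ideal_gen (monom ` FF)" by (simp add: sum_single_lookup)
qed

lemma linform_eq_lin: "linform \<Delta> a = lin (vertices \<Delta>) a"
  by (simp add: linform_def lin_def)

lemma finite_vertices:
  assumes "simplicial_complex \<Delta>"
  shows "finite (vertices \<Delta>)"
proof -
  have "vertices \<Delta> \<subseteq> \<Union>\<Delta>" by (auto simp: vertices_def)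
  moreover have "finite (\<Union>\<Delta>)" using assms unfolding simplicial_complex_def by blast
  ultimately show ?thesis by (rule finite_subset)
qed

lemma face_subset_vertices:
  assumes "simplicial_complex \<Delta>" "F \<in> \<Delta>"
  shows "F \<subseteq> vertices \<Delta>"
  using assms unfolding simplicial_complex_def vertices_def by blast

text \<open>Otherwise evaluation along the line spanned by a common zero would map the quotient by the
  parameters onto a polynomial ring in one variable.\<close>
lemma lsop_nondegenerate:
  fixes \<theta> :: "nat \<Rightarrow> 'w \<Rightarrow> 'k::field"
  assumes \<Delta>: "simplicial_complex \<Delta>" and lsop: "lsop \<Delta> \<theta> d" and F: "F \<in> \<Delta>"
    and zero: "\<And>i. i < d \<Longrightarrow> (\<Sum>v\<in>F. \<theta> i v * x v) = 0" and w: "w \<in> F"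
  shows "x w = 0"
proof (rule ccontr)
  assume xw: "x w \<noteq> 0"
  have finF: "finite F" using \<Delta> F by (simp add: simplicial_complex_def)
  \<comment> \<open>Evaluation along the line through \<open>x\<close>, where \<open>Var w\<close>
    serves as the parameter of the line.\<close>
  define ev :: "('w, 'k) mpoly \<Rightarrow> ('w, 'k) mpoly" where
    "ev = psubst (\<lambda>v. if v \<in> F then Const (x v) * Var w else 0)"
  obtain B where B: "finite B" "\<And>p. \<exists>c. p - (\<Sum>b\<in>B. Const (c b) * b)
      \<in> ideal_gen ((\<lambda>i. linform \<Delta> (\<theta> i)) ` {..<d} \<union> SR_gens \<Delta>)"
    using lsop unfolding lsop_def by blast
  have ev_form: "ev (linform \<Delta> (\<theta> i)) = 0" if "i < d" for i
  proof -
    have "ev (linform \<Delta> (\<theta> i)) = (\<Sum>v\<in>vertices \<Delta>. if v \<in> F then Const (\<theta> i v * x v) * Var w else 0)"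
      unfolding ev_def linform_eq_lin psubst_lin
      by (intro sum.cong) (auto simp: Const_mult mult.assoc)
    also have "\<dots> = (\<Sum>v\<in>F. Const (\<theta> i v * x v) * Var w)"
      using finite_vertices[OF \<Delta>] face_subset_vertices[OF \<Delta> F]
      by (simp add: sum.If_cases Int_absorb1)
    also have "\<dots> = Const (\<Sum>v\<in>F. \<theta> i v * x v) * Var w"
      by (simp add: Const_sum sum_distrib_right)
    finally show ?thesis using zero[OF that] by simp
  qed
  have ev_monom: "ev (monom H) = 0" if H: "finite H" "H \<notin> \<Delta>" for H
  proof -
    have "\<not> H \<subseteq> F" using H(2) F \<Delta> unfolding simplicial_complex_def by blast
    then obtain v where "v \<in> H" "v \<notin> F" by blast
    then show ?thesis using H(1) by (auto simp: ev_def monom_def intro!: prod_zero bexI[of _ v])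
  qed
  have ev_ideal: "ev p = 0" if "p \<in> ideal_gen ((\<lambda>i. linform \<Delta> (\<theta> i)) ` {..<d} \<union> SR_gens \<Delta>)" for p
    using that
  proof (induction rule: ideal_gen_induct)
    case (gen r g)
    then have "ev g = 0" using ev_form ev_monom by (auto simp: SR_gens_def)
    then show ?case by (simp add: ev_def)
  qed (simp_all add: ev_def)
  let ?M = "\<Union>b\<in>B. keys (ev b)"
  have keys_ev: "keys (ev p) \<subseteq> ?M" for p
  proof -
    obtain c where "p - (\<Sum>b\<in>B. Const (c b) * b)
      \<in> ideal_gen ((\<lambda>i. linform \<Delta> (\<theta> i)) ` {..<d} \<union> SR_gens \<Delta>)" using B(2) by blast
    then have "ev (p - (\<Sum>b\<in>B. Const (c b) * b)) = 0" by (rule ev_ideal)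
    then have ev: "ev p = (\<Sum>b\<in>B. Const (c b) * ev b)" by (simp add: ev_def)
    show ?thesis
    proof
      fix m assume "m \<in> keys (ev p)"
      then have "(\<Sum>b\<in>B. c b * lookup (ev b) m) \<noteq> 0"
        unfolding ev by (simp add: in_keys_iff lookup_sum lookup_Const_mult)
      then obtain b where "b \<in> B" "c b * lookup (ev b) m \<noteq> 0" by (meson sum.neutral)
      then show "m \<in> ?M" by (auto simp: in_keys_iff)
    qed
  qed
  \<comment> \<open>The k-th power of x_w evaluates to a nonzero multiple of itself because
    \<open>x w\<close> is nonzero, so infinitely many monomials would lie in the finite set
    \<open>?M\<close>.\<close>
  have "Poly_Mapping.single w k \<in> ?M" for k
  proof -
    have "ev (mexp Var (Poly_Mapping.single w k)) = Const (x w ^ k) * Poly_Mapping.single (Poly_Mapping.single w k) 1"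
    proof -
      have "Const (x w ^ k) = (Const (x w) ^ k :: ('w, 'k) mpoly)"
        by (induction k) (auto simp: Const_mult)
      then show ?thesis using w
        by (simp add: ev_def power_mult_distrib flip: mexp_Var)
    qed
    then have "Poly_Mapping.single w k \<in> keys (ev (mexp Var (Poly_Mapping.single w k)))"
      using xw by (simp add: in_keys_iff lookup_Const_mult)
    then show ?thesis using keys_ev by blast
  qed
  then have "range (\<lambda>k. Poly_Mapping.single w k) \<subseteq> ?M" by blast
  moreover have "finite ?M" using B(1) by simp
  ultimately have "finite (range (\<lambda>k::nat. Poly_Mapping.single w k))" by (rule finite_subset)
  moreover have "inj (\<lambda>k::nat. Poly_Mapping.single w k)" by simp
  ultimately show False using finite_imageD by blast
qed

section \<open>Faces containing a given face\<close>

lemma ksgn_Un: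
  assumes "finite G" "finite M" "G \<inter> M = {}"
  shows "ksgn w (G \<union> M) = ksgn w G * ksgn w M"
proof -
  have "{u \<in> G \<union> M. u < w} = {u \<in> G. u < w} \<union> {u \<in> M. u < w}" by auto
  moreover have "{u \<in> G. u < w} \<inter> {u \<in> M. u < w} = {}" using assms by auto
  ultimately show ?thesis using assms by (simp add: ksgn_def card_Un_disjoint power_add)
qed

text \<open>With these signs the chains on faces containing \<open>G\<close> become the chains of the link of \<open>G\<close>.\<close>
definition tw :: "'w::linorder set \<Rightarrow> ('w set \<Rightarrow> 'k::field) \<Rightarrow> 'w set \<Rightarrow> 'k" where
  "tw G c M = (if M \<inter> G = {} then (\<Prod>w\<in>M. ksgn w G) * c (G \<union> M) else 0)"

definition untw :: "'w::linorder set \<Rightarrow> ('w set \<Rightarrow> 'k::field) \<Rightarrow> 'w set \<Rightarrow> 'k" where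
  "untw G c F = (if G \<subseteq> F then (\<Prod>w\<in>F - G. ksgn w G) * c (F - G) else 0)"

lemma ksgn_prod_sq: "(\<Prod>w\<in>M. ksgn w G) * (\<Prod>w\<in>M. ksgn w G) = 1"
  by (simp flip: prod.distrib)

lemma ksgn_prod_sq' [simp]: "(\<Prod>w\<in>M. ksgn w G) * ((\<Prod>w\<in>M. ksgn w G) * x) = x"
  by (simp add: ksgn_prod_sq flip: mult.assoc)

text \<open>The factor of \<open>tw\<close> at a new vertex is the sign of moving it past
  \<open>G\<close>, by \<open>ksgn_Un\<close>. Vertices of \<open>G\<close> drop out because
  \<open>tw\<close> vanishes on sets that meet \<open>G\<close>.\<close>

lemma kz_tw:
  assumes "finite G" "finite M" "M \<inter> G = {}"
  shows "kz W (\<lambda>_. 1) (tw G c) M = (\<Prod>w\<in>M. ksgn w G) * kz W (\<lambda>_. 1) c (G \<union> M)"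
proof (cases "finite W")
  case True
  have "kz W (\<lambda>_. 1) (tw G c) M = (\<Sum>w\<in>W - M. if w \<in> G then 0 else
      (\<Prod>w\<in>M. ksgn w G) * (ksgn w (G \<union> M) * c (insert w (G \<union> M))))"
    unfolding kz_def
  proof (rule sum.cong[OF refl])
    fix w assume w: "w \<in> W - M"
    show "ksgn w M * 1 * tw G c (insert w M) = (if w \<in> G then 0 else
      (\<Prod>w\<in>M. ksgn w G) * (ksgn w (G \<union> M) * c (insert w (G \<union> M))))"
      using w assms by (auto simp: tw_def ksgn_Un Int_commute ac_simps)
  qed
  also have "\<dots> = (\<Sum>w\<in>W - (G \<union> M). (\<Prod>w\<in>M. ksgn w G) * (ksgn w (G \<union> M) * c (insert w (G \<union> M))))"
    using True by (intro sum.mono_neutral_cong_right) auto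
  finally show ?thesis by (simp add: kz_def sum_distrib_left)
qed (use assms in \<open>simp add: kz_def\<close>)

section \<open>Transfer of homology from a link to the faces above \<open>G\<close>\<close>

context
  fixes W :: "'w::linorder set" and G :: "'w set" and L X :: "'w set set"
  assumes W: "finite W" and G: "finite G" and L: "simplicial_complex L" and LW: "\<Union>L \<subseteq> W"
    and disj: "\<And>M. M \<in> L \<Longrightarrow> M \<inter> G = {}"
  defines "X \<equiv> {F. G \<subseteq> F \<and> F - G \<in> L}"
begin

lemma bdry_eq_kz:
  assumes "c \<in> chains L q"
  shows "bdry L c M = kz W (\<lambda>_. 1) c M"
proof -
  have "bdry L c M = (\<Sum>w\<in>\<Union>L - M. ksgn w M * 1 * c (insert w M))"
    by (simp add: bdry_def ksgn_def)
  also have "\<dots> = (\<Sum>w\<in>W - M. ksgn w M * 1 * c (insert w M))"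
  proof (rule sum.mono_neutral_left)
    show "\<forall>i\<in>W - M - (\<Union>L - M). ksgn i M * 1 * c (insert i M) = 0"
    proof
      fix i assume i: "i \<in> W - M - (\<Union>L - M)"
      then have "insert i M \<notin> L" by auto
      then show "ksgn i M * 1 * c (insert i M) = 0" using assms by (auto simp: chains_def)
    qed
  qed (use W LW in auto)
  finally show ?thesis by (simp add: kz_def)
qed

lemma star_finite: "M \<in> L \<Longrightarrow> finite M"
  using L by (auto simp: simplicial_complex_def)

lemma star_member: "M \<in> L \<Longrightarrow> G \<union> M \<in> X"
  using disj[of M] by (simp add: X_def Un_Diff Diff_triv)

lemma card_star: "M \<in> L \<Longrightarrow> card (G \<union> M) = card G + card M"
  using disj[of M] star_finite[of M] G by (intro card_Un_disjoint) auto

lemma untw_chain: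
  assumes "c \<in> chains L (int r - 1)"
  shows "chain_on X (card G + r) (untw G c)"
  unfolding chain_on_def
proof (intro allI impI)
  fix F assume "untw G c F \<noteq> 0"
  then have F: "G \<subseteq> F" "c (F - G) \<noteq> 0" by (auto simp: untw_def split: if_splits)
  then have "F - G \<in> L" "card (F - G) = r" using assms by (auto simp: chains_def)
  moreover from this F have "card F = card G + r" using card_star[of "F - G"] by (simp add: Un_absorb1)
  ultimately show "F \<in> X \<and> card F = card G + r" using F by (simp add: X_def)
qed

lemma tw_untw:
  assumes "c \<in> chains L q"
  shows "tw G (untw G c) = c"
proof
  fix M
  show "tw G (untw G c) M = c M"
  proof (cases "M \<in> L")
    case True
    then have "G \<union> M - G = M" using disj by blast
    then show ?thesis using disj[OF True] by (simp add: tw_def untw_def)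
  next
    case False
    then have "c M = 0" using assms by (auto simp: chains_def)
    moreover have "G \<union> M - G = M" if "M \<inter> G = {}" using that by blast
    ultimately show ?thesis by (simp add: tw_def untw_def)
  qed
qed

lemma tw_cycle:
  assumes "cycle_on W X (card G + r) c"
  shows "tw G c \<in> chains L (int r - 1)" "bdry L (tw G c) = (\<lambda>_. 0)"
proof -
  show ch: "tw G c \<in> chains L (int r - 1)"
    unfolding chains_def
  proof (intro CollectI allI impI)
    fix M assume "tw G c M \<noteq> 0"
    then have M: "M \<inter> G = {}" "c (G \<union> M) \<noteq> 0" by (auto simp: tw_def split: if_splits)
    then have "G \<union> M \<in> X" "card (G \<union> M) = card G + r"
      using assms by (auto simp: cycle_on_def chain_on_def)
    moreover have "G \<union> M - G = M" using M(1) by blast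
    ultimately have "M \<in> L" by (simp add: X_def)
    with card_star[of M] \<open>card (G \<union> M) = card G + r\<close>
    show "M \<in> L \<and> int (card M) = int r - 1 + 1" by simp
  qed
  show "bdry L (tw G c) = (\<lambda>_. 0)"
  proof
    fix M
    show "bdry L (tw G c) M = 0"
    proof (cases "M \<in> L")
      case True
      then show ?thesis
        using assms star_member[OF True] kz_tw[OF G star_finite[OF True] disj[OF True], of W c]
        by (simp add: bdry_eq_kz[OF ch] cycle_on_def)
    next
      case False
      have "insert i M \<notin> L" for i
      proof
        assume "insert i M \<in> L"
        moreover have "M \<subseteq> insert i M" by auto
        ultimately show False using L False unfolding simplicial_complex_def by blast
      qed
      then have "kz W (\<lambda>_. 1) (tw G c) M = 0"
        using ch by (intro kz_eq_0I) (auto simp: chains_def)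
      then show ?thesis by (simp add: bdry_eq_kz[OF ch])
    qed
  qed
qed

lemma kz_untw:
  assumes "c \<in> chains L q" "M \<in> L"
  shows "kz W (\<lambda>_. 1) (untw G c) (G \<union> M) = (\<Prod>w\<in>M. ksgn w G) * bdry L c M"
  using kz_tw[OF G star_finite[OF assms(2)] disj[OF assms(2)], of W "untw G c"]
  by (simp add: tw_untw[OF assms(1)] bdry_eq_kz[OF assms(1)])

text \<open>A face of the link with r vertices has dimension r - 1 and corresponds to a face with
  |G| + r vertices above \<open>G\<close>; this accounts for both shifts.\<close>

lemma exact_at_star:
  assumes "h_vanish K L (int r - 1)"
  shows "exact_at K W X (card G + r)"
  unfolding exact_at_def
proof (intro allI impI)
  fix c :: "'w set \<Rightarrow> 'a" assume c: "cycle_on W X (card G + r) c"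
  from assms obtain e where e: "e \<in> chains L (int r)" "bdry L e = tw G c"
    using tw_cycle[OF c] unfolding h_vanish_def by fastforce
  have "kz W (\<lambda>_. 1) (untw G e) F = c F" if "F \<in> X" for F
  proof -
    define M where "M = F - G"
    have M: "M \<in> L" "F = G \<union> M" using that by (auto simp: X_def M_def)
    have "kz W (\<lambda>_. 1) (untw G e) F = (\<Prod>w\<in>M. ksgn w G) * tw G c M"
      using kz_untw[OF e(1) M(1)] M(2) e(2) by simp
    then show ?thesis using disj[OF M(1)] by (simp add: tw_def M(2))
  qed
  moreover have "chain_on X (Suc (card G + r)) (untw G e)"
    using untw_chain[of e "Suc r"] e(1) by simp
  ultimately show "\<exists>e. chain_on X (Suc (card G + r)) e \<and> (\<forall>F\<in>X. kz W (\<lambda>_. 1) e F = c F)" by blast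
qed

text \<open>The bound on the faces leaves no nonzero boundaries, so homology classes are
  cycles.\<close>

lemma line_at_star:
  assumes h: "h_is_k K L (int r - 1)" and top: "\<And>M. M \<in> L \<Longrightarrow> card M \<le> r"
  shows "line_at K W X (card G + r)"
proof -
  obtain z :: "'w set \<Rightarrow> 'a" where z: "z \<in> chains L (int r - 1)" "bdry L z = (\<lambda>_. 0)"
    and nb: "\<not> (\<exists>e\<in>chains L (int r). bdry L e = z)"
    and gen: "\<And>c. c \<in> chains L (int r - 1) \<Longrightarrow> bdry L c = (\<lambda>_. 0) \<Longrightarrow>
      \<exists>a. \<exists>e\<in>chains L (int r). c = (\<lambda>F. bdry L e F + a * z F)"
    using h unfolding h_is_k_def by auto
  have no: "bdry L e = (\<lambda>_. 0)" if "e \<in> chains L (int r)" for e :: "'w set \<Rightarrow> 'a"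
  proof -
    have "e F = 0" for F
    proof (rule ccontr)
      assume "e F \<noteq> 0"
      with that have "F \<in> L" "card F = Suc r" by (auto simp: chains_def)
      with top[of F] show False by simp
    qed
    then show ?thesis by (auto simp: bdry_def)
  qed
  have cyc: "cycle_on W X (card G + r) (untw G z)"
    unfolding cycle_on_def
  proof
    show "chain_on X (card G + r) (untw G z)" by (rule untw_chain[OF z(1)])
    show "\<forall>F\<in>X. kz W (\<lambda>_. 1) (untw G z) F = 0"
    proof
      fix F assume "F \<in> X"
      then have "F - G \<in> L" "F = G \<union> (F - G)" by (auto simp: X_def)
      then show "kz W (\<lambda>_. 1) (untw G z) F = 0"
        using kz_untw[OF z(1), of "F - G"] z(2) by simp
    qed
  qed
  have nz: "\<exists>F. untw G z F \<noteq> 0"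
  proof (rule ccontr)
    assume "\<not> (\<exists>F. untw G z F \<noteq> 0)"
    then have "tw G (untw G z) = (\<lambda>_. 0)" by (auto simp: tw_def)
    then have "z = (\<lambda>_. 0)" by (simp add: tw_untw[OF z(1)])
    moreover have "(\<lambda>_. 0) \<in> chains L (int r)" by (simp add: chains_def)
    ultimately show False using nb no by blast
  qed
  have "\<exists>a. \<forall>F. c F = a * untw G z F" if c: "cycle_on W X (card G + r) c" for c
  proof -
    obtain a e where ae: "e \<in> chains L (int r)" "tw G c = (\<lambda>F. bdry L e F + a * z F)"
      using gen[OF tw_cycle[OF c]] by blast
    have tw: "tw G c M = a * z M" for M using ae no by simp
    have "c F = a * untw G z F" for F
    proof (cases "F \<in> X")
      case True
      then have F: "G \<subseteq> F" "(F - G) \<inter> G = {}" "G \<union> (F - G) = F" by (auto simp: X_def)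
      have "(\<Prod>w\<in>F - G. ksgn w G) * c F = a * z (F - G)"
        using tw[of "F - G"] F by (simp add: tw_def)
      then have "c F = (\<Prod>w\<in>F - G. ksgn w G) * (a * z (F - G))"
        using ksgn_prod_sq'[of G "F - G" "c F"] by simp
      then show ?thesis using F by (simp add: untw_def)
    next
      case False
      then have "c F = 0" "untw G z F = 0"
        using c cyc unfolding cycle_on_def chain_on_def by blast+
      then show ?thesis by simp
    qed
    then show ?thesis by blast
  qed
  with cyc nz show ?thesis unfolding line_at_def by blast
qed

end

lemma exact_at_empty:
  assumes "\<And>F. F \<in> X \<Longrightarrow> card F \<noteq> q"
  shows "exact_at K W X q"
  unfolding exact_at_def
proof (intro allI impI)
  fix c :: "'a set \<Rightarrow> 'b" assume "cycle_on W X q c"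
  then have "c = (\<lambda>_. 0)" using assms by (auto simp: cycle_on_def chain_on_def)
  then show "\<exists>e. chain_on X (Suc q) e \<and> (\<forall>G\<in>X. kz W (\<lambda>_. 1) e G = c G)"
    by (intro exI[of _ "\<lambda>_. 0"]) (simp add: chain_on_def)
qed

section \<open>Links in homology triangulations\<close>

lemma chains_empty_face:
  assumes "q \<noteq> - 1" "c \<in> chains {{}} q"
  shows "c = (\<lambda>_. 0)"
proof
  fix F
  have "F = {} \<and> int (card F) = q + 1" if "c F \<noteq> 0"
    using assms(2) that by (auto simp: chains_def)
  with assms(1) show "c F = 0" by fastforce
qed

lemma bdry_empty_face [simp]: "bdry {{}} c = (\<lambda>_. 0)"
  by (auto simp: bdry_def)

lemma homology_of_sphere_empty_face:
  fixes K :: "'k::field itself"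
  shows "homology_of_sphere K {{} :: 'w::linorder set} (- 1)"
proof -
  have "h_vanish K {{} :: 'w set} q" if "q \<noteq> - 1" for q
    unfolding h_vanish_def
  proof (intro allI impI, elim conjE)
    fix c :: "'w set \<Rightarrow> 'k" assume "c \<in> chains {{}} q"
    then have "c = (\<lambda>_. 0)" by (rule chains_empty_face[OF that])
    then show "\<exists>e\<in>chains {{}} (q + 1). bdry {{}} e = c"
      by (intro bexI[of _ "\<lambda>_. 0"]) (auto simp: chains_def)
  qed
  moreover have "h_is_k K {{} :: 'w set} (- 1)"
    unfolding h_is_k_def
  proof (intro exI conjI)
    show "(\<lambda>F. if F = {} then 1 else 0) \<in> chains {{} :: 'w set} (- 1)" by (auto simp: chains_def)
    show "\<not> (\<exists>e\<in>chains {{}} (- 1 + 1). bdry {{}} e = (\<lambda>F :: 'w set. if F = {} then 1 else (0::'k)))"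
      by (auto simp: fun_eq_iff)
    show "\<forall>c\<in>chains {{}} (- 1). bdry {{}} c = (\<lambda>_. 0) \<longrightarrow> (\<exists>a. \<exists>e\<in>chains {{}} (- 1 + 1).
        c = (\<lambda>F :: 'w set. bdry {{}} e F + a * (if F = {} then 1 else (0::'k))))"
    proof (intro ballI impI)
      fix c :: "'w set \<Rightarrow> 'k" assume "c \<in> chains {{}} (- 1)"
      then have "c = (\<lambda>F. c {} * (if F = {} then 1 else 0))" by (auto simp: chains_def fun_eq_iff)
      then show "\<exists>a. \<exists>e\<in>chains {{}} (- 1 + 1). c = (\<lambda>F. bdry {{}} e F + a * (if F = {} then 1 else 0))"
        by (intro exI[of _ "c {}"] bexI[of _ "\<lambda>_. 0"]) (auto simp: chains_def)
    qed
  qed simp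
  ultimately show ?thesis by (simp add: homology_of_sphere_def)
qed

text \<open>A largest face \<open>F\<close> has link {\<emptyset>}, whose homology sits in degree
  -1. The sphere condition puts it in degree -1 - |F|, so \<open>F\<close> is empty.\<close>

lemma homology_sphere_minus_one:
  fixes K :: "'k::field itself" and B :: "'w::linorder set set"
  assumes "homology_sphere K B (- 1)"
  shows "B = {{}}"
proof -
  have B: "finite B" "B \<noteq> {}" "\<And>F. F \<in> B \<Longrightarrow> finite F" "\<And>F G. F \<in> B \<Longrightarrow> G \<subseteq> F \<Longrightarrow> G \<in> B"
    and sph: "\<And>F. F \<in> B \<Longrightarrow> homology_of_sphere K (link B F) (- 1 - int (card F))"
    using assms by (auto simp: homology_sphere_def simplicial_complex_def)
  obtain F where F: "F \<in> B" "\<And>H. H \<in> B \<Longrightarrow> card H \<le> card F"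
    using B(1,2) obtains_MAX[of B card] by (metis Max_ge finite_imageI imageI)
  have link: "link B F = {{}}"
  proof
    show "link B F \<subseteq> {{}}"
    proof
      fix H assume "H \<in> link B F"
      then have H: "H \<in> B" "H \<inter> F = {}" "H \<union> F \<in> B" by (auto simp: link_def)
      have "card H + card F \<le> card F"
        using F(2)[OF H(3)] card_Un_disjoint[of H F] B(3) H F(1) by auto
      then show "H \<in> {{}}" using B(3)[OF H(1)] by simp
    qed
    show "{{}} \<subseteq> link B F" using F(1) B(4)[OF F(1), of "{}"] by (auto simp: link_def)
  qed
  have "card F = 0"
  proof (rule ccontr)
    assume "card F \<noteq> 0"
    then have h: "h_vanish K (link B F) (- 1)"
      using sph[OF F(1)] by (simp add: homology_of_sphere_def)
    let ?c = "\<lambda>H :: 'w set. if H = {} then 1 else (0::'k)"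
    have "?c \<in> chains {{}} (- 1)" by (auto simp: chains_def)
    then have "\<exists>e\<in>chains {{}} 0. bdry {{}} e = ?c"
      using h unfolding link h_vanish_def by fastforce
    then have "?c = (\<lambda>_. 0)" by auto
    then show False using fun_cong[of ?c "\<lambda>_. 0" "{}"] by simp
  qed
  then have "H = {}" if "H \<in> B" for H
    using F(2)[OF that] B(3)[OF that] by simp
  with B(2) show ?thesis by auto
qed

text \<open>The ball conditions range over nonempty \<open>U\<close>; a nonempty \<open>V\<close> is
  what makes them say something about the empty face.\<close>

locale triangulation =
  fixes K :: "'k::field itself" and \<Gamma> :: "'w::linorder set set" and \<sigma> :: "'w set \<Rightarrow> 'v set" and V :: "'v set"
  assumes triang: "homology_triangulation K \<Gamma> \<sigma> V" and V_ne: "V \<noteq> {}"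
begin

lemma complex: "simplicial_complex \<Gamma>" and finite_V: "finite V" and carrier_V: "F \<in> \<Gamma> \<Longrightarrow> \<sigma> F \<subseteq> V"
  using triang by (auto simp: homology_triangulation_def)

lemma face_finite: "F \<in> \<Gamma> \<Longrightarrow> finite F" and face_sub: "F \<in> \<Gamma> \<Longrightarrow> G \<subseteq> F \<Longrightarrow> G \<in> \<Gamma>"
  and faces_finite: "finite \<Gamma>"
  using complex unfolding simplicial_complex_def by blast+

lemma ball:
  assumes "U \<subseteq> V" "U \<noteq> {}"
  obtains B where "homology_ball_bd K (restr \<Gamma> \<sigma> U) B (int (card U) - 1)"
    "{F \<in> \<Gamma>. \<sigma> F = U} = restr \<Gamma> \<sigma> U - B"
  using triang assms unfolding homology_triangulation_def by blast

text \<open>For a single \<open>v\<close>, the restriction to {v} is a ball of dimension 0, and its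
  boundary is the (-1)-sphere {\<emptyset>}. Faces carried by {v} with a different carrier are
  exactly the boundary faces.\<close>

lemma carrier_empty_iff:
  assumes "F \<in> \<Gamma>"
  shows "\<sigma> F = {} \<longleftrightarrow> F = {}"
proof -
  obtain v where v: "v \<in> V" using V_ne by blast
  then obtain B where B: "homology_ball_bd K (restr \<Gamma> \<sigma> {v}) B (int (card {v}) - 1)"
    "{F \<in> \<Gamma>. \<sigma> F = {v}} = restr \<Gamma> \<sigma> {v} - B" using ball[of "{v}"] by blast
  have "homology_sphere K B (- 1)" using B(1) by (simp add: homology_ball_bd_def)
  then have B': "B = {{}}" by (rule homology_sphere_minus_one)
  have "{} \<in> restr \<Gamma> \<sigma> {v}" using B(1) B' by (auto simp: homology_ball_bd_def)
  then have "\<sigma> {} \<subseteq> {v}" "\<sigma> {} \<noteq> {v}" using B(2) B' by (auto simp: restr_def)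
  then have "\<sigma> {} = {}" by blast
  moreover have "F = {}" if "\<sigma> F = {}"
  proof -
    have "F \<in> restr \<Gamma> \<sigma> {v}" "F \<notin> {F \<in> \<Gamma>. \<sigma> F = {v}}" using that assms by (auto simp: restr_def)
    then show ?thesis using B(2) B' by blast
  qed
  ultimately show ?thesis by blast
qed

text \<open>The restriction to the carrier of \<open>F\<close> is a ball and hence closed under
  subfaces.\<close>

lemma carrier_mono:
  assumes "F \<in> \<Gamma>" "G \<subseteq> F"
  shows "\<sigma> G \<subseteq> \<sigma> F"
proof (cases "\<sigma> F = {}")
  case True
  then show ?thesis using assms carrier_empty_iff by simp
next
  case False
  obtain B where "homology_ball_bd K (restr \<Gamma> \<sigma> (\<sigma> F)) B (int (card (\<sigma> F)) - 1)"
    using ball[OF carrier_V[OF assms(1)] False] by blast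
  then have "simplicial_complex (restr \<Gamma> \<sigma> (\<sigma> F))" by (simp add: homology_ball_bd_def)
  moreover have "F \<in> restr \<Gamma> \<sigma> (\<sigma> F)" using assms(1) by (simp add: restr_def)
  ultimately have "G \<in> restr \<Gamma> \<sigma> (\<sigma> F)" using assms(2) unfolding simplicial_complex_def by blast
  then show ?thesis by (simp add: restr_def)
qed

lemma card_le_card_carrier:
  assumes "F \<in> \<Gamma>"
  shows "card F \<le> card (\<sigma> F)"
proof (cases "\<sigma> F = {}")
  case True
  then show ?thesis using assms carrier_empty_iff by simp
next
  case False
  obtain B where "homology_ball_bd K (restr \<Gamma> \<sigma> (\<sigma> F)) B (int (card (\<sigma> F)) - 1)"
    using ball[OF carrier_V[OF assms] False] by blast
  then have "cdim (restr \<Gamma> \<sigma> (\<sigma> F)) = int (card (\<sigma> F)) - 1" by (simp add: homology_ball_bd_def)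
  moreover have "F \<in> restr \<Gamma> \<sigma> (\<sigma> F)" "finite (restr \<Gamma> \<sigma> (\<sigma> F))"
    using assms faces_finite by (auto simp: restr_def)
  then have "card F \<le> Max (insert 0 (card ` restr \<Gamma> \<sigma> (\<sigma> F)))" by (intro Max_ge) auto
  ultimately show ?thesis by (simp add: cdim_def)
qed

text \<open>\<open>H\<close> is an interior face of the ball over its own carrier. An empty carrier
  is not covered by the ball conditions; there the link is {\<emptyset>}, the (-1)-sphere.\<close>

lemma link_sphere:
  assumes "H \<in> \<Gamma>"
  shows "homology_of_sphere K (link (restr \<Gamma> \<sigma> (\<sigma> H)) H) (int (card (\<sigma> H)) - 1 - int (card H))"
proof (cases "\<sigma> H = {}")
  case True
  then have H: "H = {}" using assms carrier_empty_iff by simp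
  have "restr \<Gamma> \<sigma> {} = {{}}" using carrier_empty_iff assms H by (auto simp: restr_def)
  then have "link (restr \<Gamma> \<sigma> (\<sigma> H)) H = {{}}" using True H by (auto simp: link_def)
  then show ?thesis using True H homology_of_sphere_empty_face[of K] by simp
next
  case False
  obtain B where B: "homology_ball_bd K (restr \<Gamma> \<sigma> (\<sigma> H)) B (int (card (\<sigma> H)) - 1)"
    "{F \<in> \<Gamma>. \<sigma> F = \<sigma> H} = restr \<Gamma> \<sigma> (\<sigma> H) - B"
    using ball[OF carrier_V[OF assms] False] by blast
  have "H \<in> restr \<Gamma> \<sigma> (\<sigma> H) - B" unfolding B(2)[symmetric] using assms by simp
  then show ?thesis using B(1) unfolding homology_ball_bd_def by blast
qed

text \<open>With a smaller carrier, \<open>H\<close> is a boundary face and its link is a ball. For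
  the empty face the link is the whole ball over \<open>U\<close>.\<close>

lemma link_acyclic:
  assumes "H \<in> \<Gamma>" "\<sigma> H \<subset> U" "U \<subseteq> V"
  shows "acyclic K (link (restr \<Gamma> \<sigma> U) H)"
proof -
  have "U \<noteq> {}" using assms by blast
  then obtain B where B: "homology_ball_bd K (restr \<Gamma> \<sigma> U) B (int (card U) - 1)"
    "{F \<in> \<Gamma>. \<sigma> F = U} = restr \<Gamma> \<sigma> U - B"
    using ball[OF assms(3)] by blast
  show ?thesis
  proof (cases "H = {}")
    case True
    have "link (restr \<Gamma> \<sigma> U) {} = restr \<Gamma> \<sigma> U" by (auto simp: link_def)
    then show ?thesis using B(1) True by (simp add: homology_ball_bd_def)
  next
    case False
    have "H \<in> restr \<Gamma> \<sigma> U" "H \<notin> {F \<in> \<Gamma>. \<sigma> F = U}" using assms by (auto simp: restr_def)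
    then have "H \<in> B" using B(2) by blast
    then have "homology_ball K (link (restr \<Gamma> \<sigma> U) H) (int (card U) - 1 - int (card H))"
      using B(1) False unfolding homology_ball_bd_def by blast
    then show ?thesis by (cases rule: homology_ball.cases) auto
  qed
qed

end

section \<open>Relative chains of a link\<close>

locale triangulation_face = triangulation K \<Gamma> \<sigma> V
  for K :: "'k::field itself" and \<Gamma> :: "'w::linorder set set" and \<sigma> :: "'w set \<Rightarrow> 'v set" and V :: "'v set" +
  fixes E :: "'w set"
  assumes E: "E \<in> \<Gamma>"
begin

definition "\<Delta> = link \<Gamma> E"

definition "d = card V - card E"

text \<open>Faces above \<open>G\<close> of the restriction to \<open>U\<close>, relative to the faces whose carrier misses an
  element of \<open>S\<close>.\<close>
definition "rel_star G S U = {F \<in> \<Delta>. G \<subseteq> F \<and> S \<subseteq> \<sigma> (F \<union> E) \<and> \<sigma> (F \<union> E) \<subseteq> U}"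

lemma link_faceD:
  assumes "F \<in> \<Delta>"
  shows "F \<in> \<Gamma>" "F \<union> E \<in> \<Gamma>" "F \<inter> E = {}" "finite F" "\<sigma> (F \<union> E) \<subseteq> V"
  using assms face_finite carrier_V by (auto simp: \<Delta>_def link_def)

lemma link_face_sub:
  assumes "F \<in> \<Delta>" "G \<subseteq> F"
  shows "G \<in> \<Delta>"
proof -
  have "G \<union> E \<subseteq> F \<union> E" using assms(2) by blast
  then have "G \<union> E \<in> \<Gamma>" using link_faceD(2)[OF assms(1)] face_sub by blast
  moreover have "G \<in> \<Gamma>" using link_faceD(1)[OF assms(1)] assms(2) face_sub by blast
  ultimately show ?thesis using link_faceD(3)[OF assms(1)] assms(2) by (auto simp: \<Delta>_def link_def)
qed

lemma link_carrier_mono: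
  assumes "F \<in> \<Delta>" "G \<subseteq> F"
  shows "\<sigma> (G \<union> E) \<subseteq> \<sigma> (F \<union> E)"
  using assms by (intro carrier_mono link_faceD(2)) auto

lemma finite_E: "finite E" using E face_finite by blast

lemma empty_in_link: "{} \<in> \<Delta>"
  using E face_sub[OF E] by (auto simp: \<Delta>_def link_def)

lemma finite_link: "finite \<Delta>"
  using faces_finite by (auto simp: \<Delta>_def link_def)

lemma finite_W: "finite (\<Union>\<Gamma>)"
  using faces_finite face_finite by blast

lemma card_link_le:
  assumes "F \<in> \<Delta>"
  shows "card F + card E \<le> card (\<sigma> (F \<union> E))"
  using card_le_card_carrier[OF link_faceD(2)[OF assms]] card_Un_disjoint[of F E]
    link_faceD[OF assms] finite_E by simp

lemma card_link_le_d:
  assumes "F \<in> \<Delta>"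
  shows "card F + card E \<le> card V"
  using card_link_le[OF assms] card_mono[OF finite_V link_faceD(5)[OF assms]] by simp

lemma card_E_le: "card E + d = card V"
  using card_link_le_d[OF empty_in_link] by (simp add: d_def)

lemma card_face_le: "F \<in> \<Delta> \<Longrightarrow> card F \<le> d"
  using card_link_le_d[of F] card_E_le by simp

text \<open>Its carrier has at least d + |E| = |V| elements.\<close>

lemma facet_interior:
  assumes "F \<in> \<Delta>" "card F = d"
  shows "\<sigma> (F \<union> E) = V"
  using card_link_le[OF assms(1)] link_faceD(5)[OF assms(1)] assms(2) card_E_le finite_V
  by (intro card_subset_eq) (auto simp: card_mono le_antisym)

lemma rel_star_convex: "convex_family (rel_star G S U)"
  unfolding convex_family_def
proof (intro conjI ballI allI impI)
  fix F assume "F \<in> rel_star G S U"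
  then show "finite F" using link_faceD(4) by (auto simp: rel_star_def)
next
  fix F H F' assume F: "F \<in> rel_star G S U" "H \<in> rel_star G S U" "F \<subseteq> F' \<and> F' \<subseteq> H"
  then have "F' \<in> \<Delta>" using link_face_sub by (auto simp: rel_star_def)
  moreover have "\<sigma> (F \<union> E) \<subseteq> \<sigma> (F' \<union> E)" "\<sigma> (F' \<union> E) \<subseteq> \<sigma> (H \<union> E)"
    using F link_carrier_mono[OF \<open>F' \<in> \<Delta>\<close>, of F] link_carrier_mono[of H F'] by (auto simp: rel_star_def)
  ultimately show "F' \<in> rel_star G S U" using F by (auto simp: rel_star_def)
qed

text \<open>The link of \<open>G\<close> in the link of \<open>E\<close> is the link of their union.
  This is the shape to which the transfer from links applies.\<close>

lemma rel_star_empty: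
  assumes "G \<in> \<Delta>" "\<sigma> (G \<union> E) \<subseteq> U"
  shows "rel_star G {} U = {F. G \<subseteq> F \<and> F - G \<in> link (restr \<Gamma> \<sigma> U) (G \<union> E)}"
proof (rule set_eqI)
  fix F
  show "F \<in> rel_star G {} U \<longleftrightarrow> F \<in> {F. G \<subseteq> F \<and> F - G \<in> link (restr \<Gamma> \<sigma> U) (G \<union> E)}"
  proof
    assume "F \<in> rel_star G {} U"
    then have F: "F \<in> \<Delta>" "G \<subseteq> F" "\<sigma> (F \<union> E) \<subseteq> U" by (auto simp: rel_star_def)
    have "F - G \<union> (G \<union> E) = F \<union> E" using F(2) by blast
    moreover have "F - G \<in> \<Gamma>" using face_sub[OF link_faceD(1)[OF F(1)]] by blast
    moreover have "\<sigma> (F - G) \<subseteq> U"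
      using carrier_mono[OF link_faceD(2)[OF F(1)], of "F - G"] F(3) by blast
    ultimately show "F \<in> {F. G \<subseteq> F \<and> F - G \<in> link (restr \<Gamma> \<sigma> U) (G \<union> E)}"
      using F link_faceD[OF F(1)] by (auto simp: link_def restr_def)
  next
    assume "F \<in> {F. G \<subseteq> F \<and> F - G \<in> link (restr \<Gamma> \<sigma> U) (G \<union> E)}"
    then have F: "G \<subseteq> F" "(F - G) \<inter> (G \<union> E) = {}" "F - G \<union> (G \<union> E) \<in> \<Gamma>"
      "\<sigma> (F - G \<union> (G \<union> E)) \<subseteq> U" by (auto simp: link_def restr_def)
    have eq: "F - G \<union> (G \<union> E) = F \<union> E" using F(1) by blast
    have "F \<inter> E = {}" using F(2) link_faceD(3)[OF assms(1)] by blast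
    moreover have "F \<in> \<Gamma>" using F(3) face_sub unfolding eq by blast
    ultimately have "F \<in> \<Delta>" using F(3) unfolding eq by (auto simp: \<Delta>_def link_def)
    then show "F \<in> rel_star G {} U" using F(1,4) unfolding eq by (simp add: rel_star_def)
  qed
qed

lemma restr_link_complex: "simplicial_complex (link (restr \<Gamma> \<sigma> U) H)"
  unfolding simplicial_complex_def
proof (intro conjI ballI allI impI)
  show "finite (link (restr \<Gamma> \<sigma> U) H)" using faces_finite by (auto simp: link_def restr_def)
  fix F assume F: "F \<in> link (restr \<Gamma> \<sigma> U) H"
  then have F': "F \<in> \<Gamma>" "\<sigma> F \<subseteq> U" "F \<inter> H = {}" "F \<union> H \<in> \<Gamma>" "\<sigma> (F \<union> H) \<subseteq> U"
    by (auto simp: link_def restr_def)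
  then show "finite F" using face_finite by blast
  fix G assume "G \<subseteq> F"
  then have "G \<in> \<Gamma>" "\<sigma> G \<subseteq> U" "G \<inter> H = {}" "G \<union> H \<in> \<Gamma>" "\<sigma> (G \<union> H) \<subseteq> U"
    using F' face_sub[OF F'(1), of G] face_sub[OF F'(4), of "G \<union> H"]
      carrier_mono[OF F'(1), of G] carrier_mono[OF F'(4), of "G \<union> H"] by blast+
  then show "G \<in> link (restr \<Gamma> \<sigma> U) H" by (simp add: link_def restr_def)
qed

text \<open>If \<open>U\<close> is the carrier of \<open>G \<union> E\<close>, the link is a sphere
  and its top faces correspond to faces with |U| - |E| vertices above \<open>G\<close>. If
  \<open>U\<close> is larger, the link is acyclic.\<close>

lemma rel_star_base:
  assumes G: "G \<in> \<Delta>" and U: "\<sigma> (G \<union> E) \<subseteq> U" "U \<subseteq> V"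
  shows "U \<noteq> \<sigma> (G \<union> E) \<or> q \<noteq> card U - card E \<Longrightarrow> exact_at K (\<Union>\<Gamma>) (rel_star G {} U) q"
    and "U = \<sigma> (G \<union> E) \<Longrightarrow> line_at K (\<Union>\<Gamma>) (rel_star G {} U) (card U - card E)"
proof -
  let ?L = "link (restr \<Gamma> \<sigma> U) (G \<union> E)"
  have GE: "card (G \<union> E) = card G + card E" "G \<union> E \<in> \<Gamma>" "finite G"
    using link_faceD[OF G] finite_E by (auto intro: card_Un_disjoint)
  have LW: "\<Union>?L \<subseteq> \<Union>\<Gamma>" by (auto simp: link_def restr_def)
  have disj: "M \<inter> G = {}" if "M \<in> ?L" for M using that by (auto simp: link_def)
  note star = finite_W GE(3) restr_link_complex LW
  have le: "card G + card E \<le> card U"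
    using card_link_le[OF G] card_mono[OF finite_subset[OF U(2) finite_V] U(1)] by simp
  show "exact_at K (\<Union>\<Gamma>) (rel_star G {} U) q" if *: "U \<noteq> \<sigma> (G \<union> E) \<or> q \<noteq> card U - card E"
  proof (cases "card G \<le> q")
    case True
    define r where "r = q - card G"
    have q: "q = card G + r" using True by (simp add: r_def)
    have "h_vanish K ?L (int r - 1)"
    proof (cases "U = \<sigma> (G \<union> E)")
      case True
      with * le q have "int r - 1 \<noteq> int (card (\<sigma> (G \<union> E))) - 1 - int (card (G \<union> E))"
        unfolding GE by auto
      then show ?thesis using link_sphere[OF GE(2)] True unfolding homology_of_sphere_def by blast
    next
      case False
      then show ?thesis using link_acyclic[OF GE(2), of U] U unfolding acyclic_def by blast
    qed
    then show ?thesis unfolding q rel_star_empty[OF G U(1)] by (intro exact_at_star[OF star] disj)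
  next
    case False
    have "card F \<noteq> q" if "F \<in> rel_star G {} U" for F
    proof -
      have "F \<in> \<Delta>" "G \<subseteq> F" using that by (auto simp: rel_star_def)
      then show ?thesis using False card_mono[OF link_faceD(4), of F G] by auto
    qed
    then show ?thesis by (rule exact_at_empty)
  qed
  show "line_at K (\<Union>\<Gamma>) (rel_star G {} U) (card U - card E)" if eq: "U = \<sigma> (G \<union> E)"
  proof -
    define r where "r = card U - card E - card G"
    have q: "card U - card E = card G + r" using le by (simp add: r_def)
    have m: "int r - 1 = int (card (\<sigma> (G \<union> E))) - 1 - int (card (G \<union> E))"
      unfolding GE r_def using le eq by auto
    have "h_is_k K ?L (int r - 1)"
      unfolding m using link_sphere[OF GE(2)] eq by (simp add: homology_of_sphere_def)
    moreover have "card M \<le> r" if "M \<in> ?L" for M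
    proof -
      have M: "M \<union> (G \<union> E) \<in> \<Gamma>" "\<sigma> (M \<union> (G \<union> E)) \<subseteq> U" "M \<inter> (G \<union> E) = {}" "finite M"
        using that face_finite by (auto simp: link_def restr_def)
      have "card M + (card G + card E) \<le> card U"
        using card_le_card_carrier[OF M(1)] card_mono[OF finite_subset[OF U(2) finite_V] M(2)]
          card_Un_disjoint[OF M(4) _ M(3)] GE finite_E by simp
      then show ?thesis by (simp add: r_def)
    qed
    ultimately show ?thesis unfolding q rel_star_empty[OF G U(1)] by (intro line_at_star[OF star] disj)
  qed
qed

text \<open>Adding an element \<open>i\<close> to \<open>S\<close> passes to the quotient by the faces carried by \<open>U - {i}\<close>;
  the middle term of the long exact sequence is acyclic.\<close>
lemma rel_star_homology:
  assumes G: "G \<in> \<Delta>" and "finite S" "S \<inter> \<sigma> (G \<union> E) = {}" "S \<union> \<sigma> (G \<union> E) \<subseteq> U" "U \<subseteq> V"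
  shows "(\<forall>q. U \<noteq> S \<union> \<sigma> (G \<union> E) \<or> q \<noteq> card U - card E \<longrightarrow> exact_at K (\<Union>\<Gamma>) (rel_star G S U) q) \<and>
    (U = S \<union> \<sigma> (G \<union> E) \<longrightarrow> line_at K (\<Union>\<Gamma>) (rel_star G S U) (card U - card E))"
  using assms(2-)
proof (induction S arbitrary: U rule: finite_induct)
  case empty
  then show ?case using rel_star_base[OF G, of U] by auto
next
  case (insert i S)
  let ?W = "\<Union>\<Gamma>" and ?X = "rel_star G S U" and ?Y = "rel_star G S (U - {i})"
  have i: "i \<in> U" "i \<notin> \<sigma> (G \<union> E)" "i \<notin> S" using insert by auto
  have U: "finite U" using insert.prems(3) finite_V finite_subset by blast
  have eq: "rel_star G (insert i S) U = ?X - ?Y" by (auto simp: rel_star_def)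
  have Y: "?Y \<subseteq> ?X" by (auto simp: rel_star_def)
  have down: "F \<in> ?Y" if "F \<in> ?X" "H \<in> ?Y" "F \<subseteq> H" for F H
    using that link_carrier_mono[of H F] by (auto simp: rel_star_def)
  note diff = finite_W rel_star_convex Y
  \<comment> \<open>Since \<open>i\<close> lies in \<open>U\<close> but neither in \<open>S\<close>
    nor in the carrier of \<open>G \<union> E\<close>, the exceptional case of the induction
    hypothesis cannot occur for \<open>U\<close>.\<close>
  have X: "exact_at K ?W ?X q" for q
    using insert.IH[of U] insert.prems i by blast
  have YI: "(\<forall>q. U - {i} \<noteq> S \<union> \<sigma> (G \<union> E) \<or> q \<noteq> card (U - {i}) - card E \<longrightarrow> exact_at K ?W ?Y q) \<and>
      (U - {i} = S \<union> \<sigma> (G \<union> E) \<longrightarrow> line_at K ?W ?Y (card (U - {i}) - card E))"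
    using insert.prems i by (intro insert.IH) auto
  \<comment> \<open>The exceptional cases of subfamily and quotient match, and the connecting map
    raises the degree by one.\<close>
  have iff: "U - {i} = S \<union> \<sigma> (G \<union> E) \<longleftrightarrow> U = insert i S \<union> \<sigma> (G \<union> E)" using i by auto
  have "\<sigma> (G \<union> E) \<subseteq> U - {i}" using insert.prems i by auto
  then have "card E \<le> card (U - {i})"
    using card_link_le[OF G] card_mono[of "U - {i}" "\<sigma> (G \<union> E)"] U by simp
  then have card: "card U - card E = Suc (card (U - {i}) - card E)"
    using card_Suc_Diff1[OF U i(1)] by simp
  have le: "card F + card E \<le> card U'" if "F \<in> rel_star G S U'" "finite U'" for F U'
    using that card_link_le[of F] card_mono[of U' "\<sigma> (F \<union> E)"] by (fastforce simp: rel_star_def)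
  show ?case
  proof (intro conjI allI impI)
    fix q assume q: "U \<noteq> insert i S \<union> \<sigma> (G \<union> E) \<or> q \<noteq> card U - card E"
    show "exact_at K ?W (rel_star G (insert i S) U) q"
      unfolding eq
    proof (rule exact_at_diff[OF diff _ X])
      fix F H assume "F \<in> ?X" "H \<in> ?Y" "F \<subseteq> H"
      then show "F \<in> ?Y" by (rule down)
    next
      fix r assume "q = Suc r"
      with q card have "U - {i} \<noteq> S \<union> \<sigma> (G \<union> E) \<or> r \<noteq> card (U - {i}) - card E"
        unfolding iff by auto
      then show "exact_at K ?W ?Y r" using YI by blast
    qed
  next
    assume "U = insert i S \<union> \<sigma> (G \<union> E)"
    then have line: "line_at K ?W ?Y (card (U - {i}) - card E)" using YI iff by blast
    show "line_at K ?W (rel_star G (insert i S) U) (card U - card E)"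
      unfolding eq card
    proof (rule line_at_diff[OF diff _ X X line])
      fix F H assume "F \<in> ?X" "H \<in> ?Y" "F \<subseteq> H"
      then show "F \<in> ?Y" by (rule down)
    next
      fix F assume "F \<in> ?X"
      then show "card F \<noteq> Suc (Suc (card (U - {i}) - card E))" using le[of F U] U card by auto
    next
      fix F assume "F \<in> ?Y"
      then show "card F \<noteq> Suc (card (U - {i}) - card E)"
        using le[of F "U - {i}"] U \<open>card E \<le> card (U - {i})\<close> by auto
    qed
  qed
qed

text \<open>Faces above \<open>G\<close> automatically carry what \<open>G \<union> E\<close>
  carries. This removes the disjointness assumption of the induction.\<close>

lemma rel_star_disjoint:
  assumes "G \<in> \<Delta>"
  shows "rel_star G S U = rel_star G (S - \<sigma> (G \<union> E)) U"
proof -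
  have "S \<subseteq> \<sigma> (F \<union> E) \<longleftrightarrow> S - \<sigma> (G \<union> E) \<subseteq> \<sigma> (F \<union> E)" if "F \<in> \<Delta>" "G \<subseteq> F" for F
    using link_carrier_mono[OF that] by blast
  then show ?thesis by (auto simp: rel_star_def)
qed

lemma rel_star_exact:
  assumes G: "G \<in> \<Delta>" and S: "S \<subseteq> V" and q: "S \<union> \<sigma> (G \<union> E) \<noteq> V \<or> q \<noteq> d"
  shows "exact_at K (\<Union>\<Gamma>) (rel_star G S V) q"
proof -
  have "exact_at K (\<Union>\<Gamma>) (rel_star G (S - \<sigma> (G \<union> E)) V) q"
    using rel_star_homology[OF G, of "S - \<sigma> (G \<union> E)" V] q S finite_subset[OF S finite_V]
      link_faceD(5)[OF G] by (auto simp: d_def)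
  then show ?thesis using rel_star_disjoint[OF G] by simp
qed

lemma rel_star_line:
  assumes G: "G \<in> \<Delta>" and S: "S \<union> \<sigma> (G \<union> E) = V"
  shows "line_at K (\<Union>\<Gamma>) (rel_star G S V) d"
proof -
  have "finite S" using S finite_V by (metis finite_Un)
  then have "line_at K (\<Union>\<Gamma>) (rel_star G (S - \<sigma> (G \<union> E)) V) d"
    using rel_star_homology[OF G, of "S - \<sigma> (G \<union> E)" V] S by (auto simp: d_def)
  then show ?thesis using rel_star_disjoint[OF G] by simp
qed

text \<open>For S = V only interior faces remain. Their top cycles above \<open>G\<close> form a
  line, so some facet contains \<open>G\<close>.\<close>

lemma exists_facet:
  assumes "G \<in> \<Delta>"
  obtains F where "F \<in> \<Delta>" "G \<subseteq> F" "card F = d"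
proof -
  have "line_at K (\<Union>\<Gamma>) (rel_star G V V) d"
    using link_faceD(5)[OF assms] by (intro rel_star_line[OF assms]) auto
  then obtain z :: "'w set \<Rightarrow> 'k" and F where "cycle_on (\<Union>\<Gamma>) (rel_star G V V) d z" "z F \<noteq> 0"
    unfolding line_at_def by blast
  then have "F \<in> rel_star G V V" "card F = d" unfolding cycle_on_def chain_on_def by blast+
  then show ?thesis by (intro that) (auto simp: rel_star_def)
qed

section \<open>The fundamental class\<close>

text \<open>By connectedness of links, a relative top cycle that is nonzero somewhere is nonzero
  everywhere.\<close>
lemma top_cycle_nowhere_zero:
  fixes c :: "'w set \<Rightarrow> 'k"
  assumes "G \<in> \<Delta>" "cycle_on (\<Union>\<Gamma>) (rel_star G V V) d c" "c F1 \<noteq> 0"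
    and "F \<in> \<Delta>" "G \<subseteq> F" "card F = d"
  shows "c F \<noteq> 0"
  using assms
proof (induction "d - card G" arbitrary: G c F F1)
  case 0
  have F1: "F1 \<in> \<Delta>" "G \<subseteq> F1" "card F1 = d"
    using 0 by (auto simp: cycle_on_def chain_on_def rel_star_def)
  have "card G = d" using 0 card_face_le[of G] by simp
  then have "G = F1" "G = F"
    using F1 0 card_subset_eq[OF link_faceD(4)[OF F1(1)] F1(2)]
      card_subset_eq[OF link_faceD(4)[OF 0(5)] 0(6)] by simp_all
  then show ?case using 0 by simp
next
  case (Suc k)
  let ?W = "\<Union>\<Gamma>"
  have c0: "H \<in> \<Delta> \<and> G \<subseteq> H \<and> card H = d" if "c H \<noteq> 0" for H
    using Suc.prems(2) that by (auto simp: cycle_on_def chain_on_def rel_star_def)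
  have finG: "finite G" using link_faceD(4)[OF Suc.prems(1)] .
  have cardG: "card G < d" using Suc.hyps(2) by simp
  \<comment> \<open>By the induction hypothesis above \<open>insert w G\<close>: among the facets
    above \<open>G\<close> that contain \<open>w\<close>, the cycle is nonzero on all or on
    none.\<close>
  have Q: "c H \<noteq> 0" if w: "w \<notin> G" "w \<in> H'" "c H' \<noteq> 0" and H: "H \<in> \<Delta>" "insert w G \<subseteq> H" "card H = d"
    for w H H'
  proof -
    define c' where "c' F = (if w \<in> F then c F else 0)" for F
    have wG: "insert w G \<in> \<Delta>" using H link_face_sub by blast
    have "c' H \<noteq> 0"
    proof (rule Suc.hyps(1))
      show "k = d - card (insert w G)" using Suc.hyps(2) w(1) finG by simp
      show "cycle_on ?W (rel_star (insert w G) V V) d c'"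
        unfolding cycle_on_def
      proof
        show "chain_on (rel_star (insert w G) V V) d c'"
          using Suc.prems(2) by (auto simp: c'_def cycle_on_def chain_on_def rel_star_def split: if_splits)
        show "\<forall>F\<in>rel_star (insert w G) V V. kz ?W (\<lambda>_. 1) c' F = 0"
        proof
          fix F assume F: "F \<in> rel_star (insert w G) V V"
          then have "kz ?W (\<lambda>_. 1) c' F = kz ?W (\<lambda>_. 1) c F"
            by (intro kz_cong) (auto simp: c'_def rel_star_def)
          moreover have "F \<in> rel_star G V V" using F by (auto simp: rel_star_def)
          ultimately show "kz ?W (\<lambda>_. 1) c' F = 0" using Suc.prems(2) by (simp add: cycle_on_def)
        qed
      qed
      show "c' H' \<noteq> 0" using w by (simp add: c'_def)
    qed (use wG H in auto)
    then show ?thesis by (simp add: c'_def split: if_splits)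
  qed
  show "c F \<noteq> 0"
  proof
    assume cF: "c F = 0"
    have F1: "F1 \<in> \<Delta>" "G \<subseteq> F1" "card F1 = d" using c0 Suc.prems(3) by auto
    have "F1 \<noteq> G" "F \<noteq> G" using F1(3) Suc.prems(6) cardG by auto
    then obtain w1 w2 where w1: "w1 \<in> F1" "w1 \<notin> G" and w2: "w2 \<in> F" "w2 \<notin> G"
      using F1(2) Suc.prems(5) by blast
    have ne: "w1 \<noteq> w2" using Q[of w1 F1 F] w1 w2 Suc.prems cF by auto
    have W: "w1 \<in> ?W" "w2 \<in> ?W" using w1 w2 F1 Suc.prems(4) link_faceD(1) by blast+
    have v: "insert w1 G \<in> \<Delta>" "insert w2 G \<in> \<Delta>"
      using w1 w2 F1 Suc.prems(4,5) link_face_sub[of F1] link_face_sub[of F] by auto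
    \<comment> \<open>The difference of two points of the link of \<open>G\<close>, as a reduced
      0-cycle: \<open>w1\<close> lies on a facet where \<open>c\<close> is nonzero,
      \<open>w2\<close> on one where it is zero.\<close>
    define c2 :: "'w set \<Rightarrow> 'k" where
      "c2 H = (if H = insert w1 G then ksgn w1 G else if H = insert w2 G then - ksgn w2 G else 0)" for H
    have ins_inj: "insert w G = insert w1 G \<longleftrightarrow> w = w1" "insert w G = insert w2 G \<longleftrightarrow> w = w2"
      if "w \<notin> G" for w using that w1 w2 by auto
    have c2_card: "card H = Suc (card G)" if "c2 H \<noteq> 0" for H
      using that w1 w2 finG by (auto simp: c2_def split: if_splits)
    have c2_cycle: "kz ?W (\<lambda>_. 1) c2 H = 0" if "H \<in> \<Delta>" "G \<subseteq> H" for H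
    proof (cases "H = G")
      case True
      have "kz ?W (\<lambda>_. 1) c2 G = (\<Sum>w\<in>?W - G. (if w = w1 then 1 else 0) + (if w = w2 then - 1 else 0))"
        unfolding kz_def using ins_inj ne by (intro sum.cong) (auto simp: c2_def)
      also have "\<dots> = 0"
        using finite_W W w1 w2 by (simp add: sum.distrib)
      finally show ?thesis using True by simp
    next
      case False
      have "finite H" using that link_faceD(4) by blast
      then have "card G < card H" using False that(2) by (intro psubset_card_mono) auto
      then show ?thesis using c2_card \<open>finite H\<close> by (intro kz_eq_0I) (metis card_insert_disjoint less_irrefl nat.inject)
    qed
    show False
    proof (cases "\<sigma> (G \<union> E) = V \<and> Suc (card G) = d")
      case True
      \<comment> \<open>The link of \<open>G\<close> is a 0-sphere, so \<open>c2\<close> is a top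
        cycle itself; \<open>c\<close> is proportional to it and thus nonzero at
        \<open>F\<close>.\<close>
      have "cycle_on ?W (rel_star G V V) d c2"
        unfolding cycle_on_def
      proof
        show "chain_on (rel_star G V V) d c2"
          unfolding chain_on_def
        proof (intro allI impI)
          fix H assume "c2 H \<noteq> 0"
          then have "H = insert w1 G \<or> H = insert w2 G" "card H = d"
            using c2_card True by (auto simp: c2_def split: if_splits)
          then show "H \<in> rel_star G V V \<and> card H = d"
            using v facet_interior by (auto simp: rel_star_def)
        qed
        show "\<forall>H\<in>rel_star G V V. kz ?W (\<lambda>_. 1) c2 H = 0"
          using c2_cycle by (auto simp: rel_star_def)
      qed
      moreover have "line_at K ?W (rel_star G V V) d"
        using True by (intro rel_star_line Suc.prems(1)) auto
      ultimately obtain z :: "'w set \<Rightarrow> 'k" and a a' where z: "\<And>F. c F = a * z F" "\<And>F. c2 F = a' * z F"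
        using Suc.prems(2) unfolding line_at_def by blast
      have "F = insert w2 G"
        using True w2 Suc.prems(4-6) finG link_faceD(4)[OF Suc.prems(4)]
        by (intro card_subset_eq[symmetric]) auto
      then have "c2 F \<noteq> 0" using ins_inj(1)[of w2] ne w2 by (auto simp: c2_def ksgn_def)
      moreover have "a \<noteq> 0" using z(1)[of F1] Suc.prems(3) by auto
      ultimately show False using z(1)[of F] z(2)[of F] cF by simp
    next
      case False
      \<comment> \<open>In all other cases the link of \<open>G\<close> is connected, so
        \<open>c2\<close> bounds a chain \<open>e\<close> of edges.\<close>
      have "exact_at K ?W (rel_star G {} V) (Suc (card G))"
        using False by (intro rel_star_exact Suc.prems(1)) auto
      moreover have "cycle_on ?W (rel_star G {} V) (Suc (card G)) c2"
        unfolding cycle_on_def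
      proof
        show "chain_on (rel_star G {} V) (Suc (card G)) c2"
          unfolding chain_on_def
        proof (intro allI impI)
          fix H assume H: "c2 H \<noteq> 0"
          then have "H = insert w1 G \<or> H = insert w2 G" by (auto simp: c2_def split: if_splits)
          then show "H \<in> rel_star G {} V \<and> card H = Suc (card G)"
            using v link_faceD(5) c2_card[OF H] by (auto simp: rel_star_def)
        qed
        show "\<forall>H\<in>rel_star G {} V. kz ?W (\<lambda>_. 1) c2 H = 0"
          using c2_cycle by (auto simp: rel_star_def)
      qed
      ultimately obtain e :: "'w set \<Rightarrow> 'k" where e: "chain_on (rel_star G {} V) (Suc (Suc (card G))) e"
        "\<And>H. H \<in> rel_star G {} V \<Longrightarrow> kz ?W (\<lambda>_. 1) e H = c2 H"
        unfolding exact_at_def by blast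
      \<comment> \<open>Each edge of \<open>e\<close> lies in a facet, so by \<open>Q\<close> both
        or neither of its ends are in \<open>Z\<close>. Summed over \<open>Z\<close>, the boundary
        of \<open>e\<close> gives 0 but \<open>c2\<close> gives 1, as \<open>Z\<close> contains
        \<open>w1\<close> and not \<open>w2\<close>.\<close>
      define Z where "Z = {w \<in> ?W - G. insert w G \<in> \<Delta> \<and> (\<exists>H. w \<in> H \<and> c H \<noteq> 0)}"
      have finZ: "finite Z" by (rule finite_subset[OF _ finite_W]) (auto simp: Z_def)
      have closed: "v \<in> Z" if "w \<in> Z" "v \<in> ?W" "v \<notin> insert w G" "e (insert v (insert w G)) \<noteq> 0" for v w
      proof -
        have "insert v (insert w G) \<in> \<Delta>" using e(1) that(4) by (auto simp: chain_on_def rel_star_def)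
        then obtain H where H: "H \<in> \<Delta>" "insert v (insert w G) \<subseteq> H" "card H = d" by (rule exists_facet)
        then have "c H \<noteq> 0" using Q[of w _ H] that(1) by (auto simp: Z_def)
        moreover have "insert v G \<in> \<Delta>" using H(2) link_face_sub[OF H(1)] by auto
        ultimately show ?thesis using H(2) that by (auto simp: Z_def)
      qed
      define u where "u w v = (if w \<in> G \<or> v \<in> G \<or> w = v then 0
        else ksgn w G * (ksgn v (insert w G) * e (insert v (insert w G))))" for w v
      have "(\<Sum>w\<in>Z. ksgn w G * kz ?W (\<lambda>_. 1) e (insert w G)) = (\<Sum>w\<in>Z. \<Sum>v\<in>Z. u w v)"
      proof (rule sum.cong[OF refl])
        fix w assume w: "w \<in> Z"
        have "ksgn w G * kz ?W (\<lambda>_. 1) e (insert w G) = (\<Sum>v\<in>?W - insert w G. u w v)"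
          using w unfolding kz_def sum_distrib_left by (intro sum.cong) (auto simp: u_def Z_def)
        also have "\<dots> = (\<Sum>v\<in>Z. u w v)"
        proof (rule sum.mono_neutral_cong)
          fix v assume "v \<in> (?W - insert w G) - Z"
          then show "u w v = 0" using closed[OF w, of v] by (auto simp: u_def)
        next
          fix v assume "v \<in> Z - (?W - insert w G)"
          then show "u w v = 0" by (auto simp: u_def Z_def)
        qed (use finZ finite_W in auto)
        finally show "ksgn w G * kz ?W (\<lambda>_. 1) e (insert w G) = (\<Sum>v\<in>Z. u w v)" .
      qed
      also have "\<dots> = 0"
      proof (rule antisymmetric_sum_eq_0[OF finZ])
        fix i j show "u j i = - u i j"
          using finG by (auto simp: u_def ksgn_insert insert_commute)
      qed (simp add: u_def)
      finally have "(\<Sum>w\<in>Z. ksgn w G * kz ?W (\<lambda>_. 1) e (insert w G)) = 0" .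
      moreover have "(\<Sum>w\<in>Z. ksgn w G * kz ?W (\<lambda>_. 1) e (insert w G)) = (\<Sum>w\<in>Z. if w = w1 then 1 else 0)"
      proof (rule sum.cong[OF refl])
        fix w assume w: "w \<in> Z"
        have "w \<noteq> w2" using w Q[of w2 _ F] w2 Suc.prems cF by (auto simp: Z_def)
        moreover have "insert w G \<in> rel_star G {} V" using w link_faceD(5)[of "insert w G"] by (auto simp: Z_def rel_star_def)
        ultimately show "ksgn w G * kz ?W (\<lambda>_. 1) e (insert w G) = (if w = w1 then 1 else 0)"
          using e(2) w ins_inj[of w] by (auto simp: c2_def Z_def)
      qed
      moreover have "w1 \<in> Z" using W(1) w1 v(1) Suc.prems(3) by (auto simp: Z_def)
      ultimately show False using finZ by simp
    qed
  qed
qed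

end

section \<open>The double complex\<close>

locale module_setup = triangulation_face K \<Gamma> \<sigma> "{..<n}" E
  for K :: "'k::field itself" and \<Gamma> :: "'w::linorder set set" and \<sigma> :: "'w set \<Rightarrow> nat set"
    and n :: nat and E :: "'w set" +
  fixes \<theta> :: "nat \<Rightarrow> 'w \<Rightarrow> 'k" and b :: nat
  assumes params: "lsop \<Delta> \<theta> d" and b: "{..<n} - \<sigma> E = {..<b}"
    and special: "\<And>i. i < b \<Longrightarrow> supp (\<theta> i) \<subseteq> {w \<in> vertices \<Delta>. i \<in> \<sigma> {w}}"
begin

lemma card_E_d: "card E + d = n"
  using card_E_le by simp

lemma b_le_d: "b \<le> d"
proof -
  have "card ({..<n} - \<sigma> E) = n - card (\<sigma> E)"
    using carrier_V[OF E] finite_subset[OF carrier_V[OF E]] by (simp add: card_Diff_subset)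
  then show ?thesis using b card_le_card_carrier[OF E] card_E_d by simp
qed

lemma not_carrier_less_b:
  assumes "F \<in> \<Delta>" "i < n" "i \<notin> \<sigma> (F \<union> E)"
  shows "i < b"
proof -
  have "\<sigma> ({} \<union> E) \<subseteq> \<sigma> (F \<union> E)" using link_carrier_mono[OF assms(1), of "{}"] by blast
  then have "i \<in> {..<n} - \<sigma> E" using assms by auto
  then show ?thesis using b by auto
qed

lemma vertex_carrier:
  assumes "F \<in> \<Delta>" "w \<in> F"
  shows "\<sigma> {w} \<subseteq> \<sigma> (F \<union> E)"
  using carrier_mono[OF link_faceD(2)[OF assms(1)], of "{w}"] assms(2) by auto

text \<open>An index outside the carrier of \<open>F \<union> E\<close> is outside \<sigma>(E), so
  its form is a special one, supported on vertices whose carriers contain the index;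
  \<open>F\<close> has no such vertex.\<close>

lemma form_coeff_zero:
  assumes "F \<in> \<Delta>" "i < d" "i \<notin> \<sigma> (F \<union> E)" "w \<in> F"
  shows "\<theta> i w = 0"
proof (rule ccontr)
  assume "\<theta> i w \<noteq> 0"
  moreover have "i < b" using not_carrier_less_b[of F i] assms card_E_d by simp
  ultimately have "i \<in> \<sigma> {w}" using special[of i] by (auto simp: supp_def)
  then show False using vertex_carrier[OF assms(1,4)] assms(3) by blast
qed

lemma form_zero:
  assumes "F \<in> \<Delta>" "i < d" "i \<notin> \<sigma> (F \<union> E)"
  shows "lin F (\<theta> i) = 0"
  using form_coeff_zero[OF assms] by (simp add: lin_def)

lemma link_complex: "simplicial_complex \<Delta>"
  unfolding simplicial_complex_def using finite_link link_faceD(4) link_face_sub by blast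

lemma pres_form:
  assumes "F \<in> \<Delta>"
  shows "pres F (linform \<Delta> (\<theta> i)) = lin F (\<theta> i)"
  using face_subset_vertices[OF link_complex assms]
  by (simp add: linform_eq_lin pres_lin[OF finite_vertices[OF link_complex]] Int_absorb2)

definition "carried F = \<sigma> (F \<union> E) \<inter> {..<d}"

text \<open>The |E| indices from d to n - 1 are at least b and hence lie in every carrier. This is
  where |E| enters the bound.\<close>

lemma card_carried:
  assumes "F \<in> \<Delta>"
  shows "card (carried F) + card E = card (\<sigma> (F \<union> E))"
proof -
  have "i \<in> \<sigma> (F \<union> E)" if "i < n" "d \<le> i" for i
    using not_carrier_less_b[OF assms that(1)] that(2) b_le_d by force
  then have "\<sigma> (F \<union> E) = carried F \<union> {d..<n}"
    using link_faceD(5)[OF assms] by (force simp: carried_def)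
  moreover have "card (carried F \<union> {d..<n}) = card (carried F) + card {d..<n}"
    by (rule card_Un_disjoint) (auto simp: carried_def)
  ultimately show ?thesis using card_E_d by simp
qed

lemma forms_nondegenerate:
  assumes "F \<in> \<Delta>" "\<And>i. i \<in> carried F \<Longrightarrow> (\<Sum>v\<in>F. \<theta> i v * x v) = 0" "w \<in> F"
  shows "x w = 0"
proof (rule lsop_nondegenerate[OF link_complex params assms(1) _ assms(3)])
  fix i assume i: "i < d"
  show "(\<Sum>v\<in>F. \<theta> i v * x v) = 0"
  proof (cases "i \<in> \<sigma> (F \<union> E)")
    case True
    then show ?thesis using assms(2) i by (simp add: carried_def)
  next
    case False
    then show ?thesis using form_coeff_zero[OF assms(1) i False] by simp
  qed
qed

definition "ok S F \<longleftrightarrow> S \<subseteq> {..<d} \<and> F \<in> \<Delta> \<and> S \<subseteq> \<sigma> (F \<union> E)"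

text \<open>Families of polynomials \<open>\<phi> S F \<in> k[F]\<close>, where \<open>S\<close> is the Koszul index and \<open>F\<close> the chain index.
  For fixed \<open>S\<close> the rows resolve \<open>I\<^sub>S\<close>; for fixed \<open>F\<close> the columns are Koszul complexes over \<open>k[F]\<close>.\<close>
definition D :: "nat \<Rightarrow> nat \<Rightarrow> (nat set \<Rightarrow> 'w set \<Rightarrow> ('w, 'k) mpoly) \<Rightarrow> bool" where
  "D j q \<phi> \<longleftrightarrow> (\<forall>S F. \<phi> S F \<noteq> 0 \<longrightarrow> ok S F \<and> card S = j \<and> card F = q) \<and>
    (\<forall>S F. pres F (\<phi> S F) = \<phi> S F)"

text \<open>Entries are restricted to k[F], and positions that violate the carrier condition are cut
  away.\<close>

definition bd :: "(nat set \<Rightarrow> 'w set \<Rightarrow> ('w, 'k) mpoly) \<Rightarrow> nat set \<Rightarrow> 'w set \<Rightarrow> ('w, 'k) mpoly" where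
  "bd \<phi> S F = (if ok S F then pres F (kz (\<Union>\<Gamma>) (\<lambda>_. 1) (\<phi> S) F) else 0)"

definition kap :: "(nat set \<Rightarrow> 'w set \<Rightarrow> ('w, 'k) mpoly) \<Rightarrow> nat set \<Rightarrow> 'w set \<Rightarrow> ('w, 'k) mpoly" where
  "kap \<phi> S F = kz {..<d} (\<lambda>i. lin F (\<theta> i)) (\<lambda>S. \<phi> S F) S"

lemma D_support: "D j q \<phi> \<Longrightarrow> \<phi> S F \<noteq> 0 \<Longrightarrow> ok S F \<and> card S = j \<and> card F = q"
  and D_pres: "D j q \<phi> \<Longrightarrow> pres F (\<phi> S F) = \<phi> S F"
  unfolding D_def by blast+

lemma DI:
  assumes "\<And>S F. \<phi> S F \<noteq> 0 \<Longrightarrow> ok S F \<and> card S = j \<and> card F = q" "\<And>S F. pres F (\<phi> S F) = \<phi> S F"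
  shows "D j q \<phi>"
  unfolding D_def using assms by blast

lemma D_diff:
  assumes "D j q \<phi>" "D j q \<psi>"
  shows "D j q (\<lambda>S F. \<phi> S F - \<psi> S F)"
proof (rule DI)
  fix S F assume "\<phi> S F - \<psi> S F \<noteq> 0"
  then have "\<phi> S F \<noteq> 0 \<or> \<psi> S F \<noteq> 0" by auto
  then show "ok S F \<and> card S = j \<and> card F = q" using assms D_support by blast
qed (use assms D_pres in simp)

lemma ok_finite: "ok S F \<Longrightarrow> finite S" "ok S F \<Longrightarrow> finite F" "ok S F \<Longrightarrow> F \<in> \<Delta>"
  using link_faceD(4) finite_subset[of S "{..<d}"] by (auto simp: ok_def)

lemma D_kap:
  assumes "D (Suc j) q \<phi>"
  shows "D j q (kap \<phi>)"
proof (rule DI)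
  fix S F assume "kap \<phi> S F \<noteq> 0"
  then obtain i where i: "i \<in> {..<d}" "i \<notin> S" "\<phi> (insert i S) F \<noteq> 0"
    unfolding kap_def using kz_eq_0I[of "{..<d}" S "\<lambda>S. \<phi> S F" "\<lambda>i. lin F (\<theta> i)"] by metis
  then have o: "ok (insert i S) F" "card (insert i S) = Suc j" "card F = q"
    using D_support[OF assms] by auto
  have "finite S" using ok_finite(1)[OF o(1)] by simp
  with o i(2) show "ok S F \<and> card S = j \<and> card F = q" by (auto simp: ok_def)
next
  fix S F
  show "pres F (kap \<phi> S F) = kap \<phi> S F"
  proof (cases "finite F")
    case True
    then show ?thesis by (simp add: kap_def pres_kz pres_lin D_pres[OF assms])
  next
    case False
    then have "lin F (\<theta> i) = 0" for i by (simp add: lin_def)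
    then show ?thesis by (simp add: kap_def kz_def)
  qed
qed

lemma kap_kap:
  assumes "D j q \<phi>"
  shows "kap (kap \<phi>) S F = 0"
proof (cases "finite S")
  case True
  then show ?thesis unfolding kap_def by (intro kz_kz) auto
next
  case False
  have "\<phi> (insert i' (insert i S)) F = 0" for i i'
  proof (rule ccontr)
    assume "\<phi> (insert i' (insert i S)) F \<noteq> 0"
    then have "finite (insert i' (insert i S))"
      by (rule ok_finite(1)[OF conjunct1[OF D_support[OF assms]]])
    with False show False by simp
  qed
  then have "kap \<phi> (insert i S) F = 0" for i unfolding kap_def by (rule kz_eq_0I)
  then show ?thesis unfolding kap_def[of "kap \<phi>"] by (rule kz_eq_0I)
qed

lemma kap_diff: "kap (\<lambda>S F. \<phi> S F - \<psi> S F) S F = kap \<phi> S F - kap \<psi> S F"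
  by (simp add: kap_def kz_diff)

lemma bd_diff: "bd (\<lambda>S F. \<phi> S F - \<psi> S F) S F = bd \<phi> S F - bd \<psi> S F"
  by (simp add: bd_def kz_diff)

lemma bd_nonzero:
  assumes "D j (Suc q) \<phi>" "bd \<phi> S F \<noteq> 0"
  shows "ok S F" "card S = j" "card F = q" "\<exists>w. w \<notin> F \<and> \<phi> S (insert w F) \<noteq> 0"
proof -
  show o: "ok S F" using assms(2) by (auto simp: bd_def split: if_splits)
  have "kz (\<Union>\<Gamma>) (\<lambda>_. 1) (\<phi> S) F \<noteq> 0" using assms(2) o by (auto simp: bd_def)
  then obtain w where w: "w \<notin> F" "\<phi> S (insert w F) \<noteq> 0"
    using kz_eq_0I[of "\<Union>\<Gamma>" F "\<phi> S" "\<lambda>_. 1"] by metis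
  then have "card S = j" "card (insert w F) = Suc q" using D_support[OF assms(1)] by auto
  then show "card S = j" "card F = q" using w(1) ok_finite(2)[OF o] by auto
  show "\<exists>w. w \<notin> F \<and> \<phi> S (insert w F) \<noteq> 0" using w by blast
qed

lemma D_bd:
  assumes "D j (Suc q) \<phi>"
  shows "D j q (bd \<phi>)"
proof (rule DI)
  fix S F assume "bd \<phi> S F \<noteq> 0"
  then show "ok S F \<and> card S = j \<and> card F = q" using bd_nonzero[OF assms] by blast
qed (simp add: bd_def pres_pres)

lemma ok_insert_face:
  assumes "ok S F" "insert w F \<in> \<Delta>"
  shows "ok S (insert w F)"
proof -
  have "\<sigma> (F \<union> E) \<subseteq> \<sigma> (insert w F \<union> E)" by (rule link_carrier_mono[OF assms(2)]) auto
  then show ?thesis using assms by (auto simp: ok_def)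
qed

lemma bd_bd:
  assumes "D j q \<phi>"
  shows "bd (bd \<phi>) S F = 0"
proof (cases "ok S F")
  case o: True
  \<comment> \<open>Restricting in two stages is the same as restricting once, and at a non-face the
    discarded boundary was zero anyway.\<close>
  have step: "pres F (bd \<phi> S (insert w F)) = pres F (kz (\<Union>\<Gamma>) (\<lambda>_. 1) (\<phi> S) (insert w F))" for w
  proof (cases "insert w F \<in> \<Delta>")
    case True
    then have "ok S (insert w F)" by (rule ok_insert_face[OF o])
    moreover have "F \<inter> insert w F = F" by blast
    ultimately show ?thesis by (simp add: bd_def pres_pres)
  next
    case False
    have "kz (\<Union>\<Gamma>) (\<lambda>_. 1) (\<phi> S) (insert w F) = 0"
    proof (rule kz_eq_0I)
      fix v
      have "insert v (insert w F) \<notin> \<Delta>" using False link_face_sub[of "insert v (insert w F)" "insert w F"] by blast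
      then show "\<phi> S (insert v (insert w F)) = 0" using D_support[OF assms] ok_finite(3) by blast
    qed
    moreover have "\<not> ok S (insert w F)" using False by (simp add: ok_def)
    ultimately show ?thesis by (simp add: bd_def)
  qed
  have "pres F (kz (\<Union>\<Gamma>) (\<lambda>_. 1) (bd \<phi> S) F) = pres F (kz (\<Union>\<Gamma>) (\<lambda>_. 1) (kz (\<Union>\<Gamma>) (\<lambda>_. 1) (\<phi> S)) F)"
    unfolding pres_kz[of F "\<Union>\<Gamma>" _ _ F] by (rule kz_cong) (rule step)
  also have "\<dots> = 0" by (simp add: kz_kz[OF finite_W ok_finite(2)[OF o]])
  finally show ?thesis by (simp add: bd_def[of "bd \<phi>"])
qed (simp add: bd_def)

text \<open>Truncation threatens commutativity: \<open>S\<close> may be admissible at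
  \<open>F\<close> while \<open>insert i S\<close> is not. Then \<open>i\<close> is missing from the
  carrier and form \<open>i\<close> vanishes on \<open>F\<close>.\<close>

lemma bd_kap: "bd (kap \<phi>) S F = kap (bd \<phi>) S F"
proof (cases "ok S F")
  case o: True
  have F: "F \<in> \<Delta>" "finite F" using ok_finite[OF o] by auto
  have Fw: "pres F (lin (insert w F) (\<theta> i)) = lin F (\<theta> i)" for w i
    using F(2) by (simp add: pres_lin Int_absorb2 subset_insertI)
  let ?t = "\<lambda>i w. ksgn i S * lin F (\<theta> i) * (ksgn w F * pres F (\<phi> (insert i S) (insert w F)))"
  have "bd (kap \<phi>) S F = (\<Sum>w\<in>\<Union>\<Gamma> - F. \<Sum>i\<in>{..<d} - S. ?t i w)"
    using o by (simp add: bd_def kap_def kz_def Fw sum_distrib_left mult_ac)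
  also have "\<dots> = (\<Sum>i\<in>{..<d} - S. \<Sum>w\<in>\<Union>\<Gamma> - F. ?t i w)" by (rule sum.swap)
  also have "\<dots> = kap (bd \<phi>) S F"
    unfolding kap_def kz_def
  proof (rule sum.cong[OF refl])
    fix i assume i: "i \<in> {..<d} - S"
    show "(\<Sum>w\<in>\<Union>\<Gamma> - F. ?t i w) = ksgn i S * lin F (\<theta> i) * bd \<phi> (insert i S) F"
    proof (cases "i \<in> \<sigma> (F \<union> E)")
      case True
      then have "ok (insert i S) F" using o i by (auto simp: ok_def)
      then show ?thesis by (simp add: bd_def kz_def sum_distrib_left)
    next
      case False
      then show ?thesis using form_zero[OF F(1)] i by simp
    qed
  qed
  finally show ?thesis .
next
  case False
  have "bd \<phi> (insert i S) F = 0" for i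
    using False by (auto simp: bd_def ok_def)
  then show ?thesis using False by (simp add: kap_def kz_def bd_def)
qed

section \<open>Exactness of the rows, monomial by monomial\<close>

lemma lookup_bd:
  "lookup (bd \<phi> S F) m =
    (if ok S F \<and> keys m \<subseteq> F then kz (\<Union>\<Gamma>) (\<lambda>_. 1) (\<lambda>F. lookup (\<phi> S F) m) F else 0)"
  by (simp add: bd_def lookup_pres lookup_kz)

text \<open>A monomial occurs in k[F] only if its support lies in \<open>F\<close>, so its
  coefficients form a chain on the faces above the support.\<close>

lemma row_monomial_cycle:
  assumes D: "D j q \<phi>" and cyc: "\<And>S F. bd \<phi> S F = 0" and S: "S \<subseteq> {..<d}"
  shows "cycle_on (\<Union>\<Gamma>) (rel_star (keys m) S {..<n}) q (\<lambda>F. lookup (\<phi> S F) m)"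
  unfolding cycle_on_def
proof
  show "chain_on (rel_star (keys m) S {..<n}) q (\<lambda>F. lookup (\<phi> S F) m)"
    unfolding chain_on_def
  proof (intro allI impI)
    fix F assume nz: "lookup (\<phi> S F) m \<noteq> 0"
    then have "\<phi> S F \<noteq> 0" by auto
    then have o: "ok S F" "card F = q" using D_support[OF D] by auto
    have "keys m \<subseteq> F" using nz D_pres[OF D, of F S] by (metis lookup_pres)
    then show "F \<in> rel_star (keys m) S {..<n} \<and> card F = q"
      using o link_faceD(5) by (auto simp: rel_star_def ok_def)
  qed
  show "\<forall>F\<in>rel_star (keys m) S {..<n}. kz (\<Union>\<Gamma>) (\<lambda>_. 1) (\<lambda>F. lookup (\<phi> S F) m) F = 0"
  proof
    fix F assume "F \<in> rel_star (keys m) S {..<n}"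
    then have "ok S F" "keys m \<subseteq> F" using S by (auto simp: rel_star_def ok_def)
    then show "kz (\<Union>\<Gamma>) (\<lambda>_. 1) (\<lambda>F. lookup (\<phi> S F) m) F = 0"
      using lookup_bd[of \<phi> S F m] cyc[of S F] by simp
  qed
qed

definition "row_monomials \<phi> S = (\<Union>F\<in>\<Delta>. keys (\<phi> S F :: ('w, 'k) mpoly))"

lemma finite_row_monomials: "finite (row_monomials \<phi> S)"
  using finite_link by (simp add: row_monomials_def)

lemma row_monomials_face:
  assumes "D j q \<phi>" "m \<in> row_monomials \<phi> S"
  shows "keys m \<in> \<Delta>"
proof -
  obtain F where F: "F \<in> \<Delta>" "lookup (\<phi> S F) m \<noteq> 0"
    using assms(2) by (auto simp: row_monomials_def in_keys_iff)
  have "keys m \<subseteq> F" using F(2) D_pres[OF assms(1), of F S] by (metis lookup_pres)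
  then show ?thesis using link_face_sub[OF F(1)] by blast
qed

lemma lookup_sum_single:
  assumes "finite M"
  shows "lookup (\<Sum>m\<in>M. Poly_Mapping.single m (c m)) m' = (if m' \<in> M then c m' else 0)"
  using assms by (simp add: lookup_sum lookup_single when_def)

lemma row_exact:
  assumes D: "D j q \<phi>" and cyc: "\<And>S F. bd \<phi> S F = 0" and q: "q \<noteq> d"
  shows "\<exists>\<chi>. D j (Suc q) \<chi> \<and> (\<forall>S F. bd \<chi> S F = \<phi> S F)"
proof -
  let ?W = "\<Union>\<Gamma>"
  have "\<exists>e. chain_on (rel_star (keys m) S {..<n}) (Suc q) e \<and>
      (\<forall>F\<in>rel_star (keys m) S {..<n}. kz ?W (\<lambda>_. 1) e F = lookup (\<phi> S F) m)"
    if "S \<subseteq> {..<d}" "m \<in> row_monomials \<phi> S" for S m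
  proof -
    have "S \<subseteq> {..<n}" using that(1) card_E_d by auto
    then have "exact_at K ?W (rel_star (keys m) S {..<n}) q"
      using rel_star_exact row_monomials_face[OF D that(2)] q by blast
    then show ?thesis using row_monomial_cycle[OF D cyc that(1)] unfolding exact_at_def by blast
  qed
  then obtain e where e: "\<And>S m. S \<subseteq> {..<d} \<Longrightarrow> m \<in> row_monomials \<phi> S \<Longrightarrow>
      chain_on (rel_star (keys m) S {..<n}) (Suc q) (e S m)"
    "\<And>S m F. S \<subseteq> {..<d} \<Longrightarrow> m \<in> row_monomials \<phi> S \<Longrightarrow> F \<in> rel_star (keys m) S {..<n} \<Longrightarrow>
      kz ?W (\<lambda>_. 1) (e S m) F = lookup (\<phi> S F) m"
    by metis
  \<comment> \<open>Only the finitely many monomials that occur in the row are lifted, so that the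
    lifts add up to a polynomial.\<close>
  define \<chi> where "\<chi> S F = (\<Sum>m\<in>row_monomials \<phi> S. Poly_Mapping.single m (e S m F))" for S F
  have lookup_chi: "lookup (\<chi> S F) m = (if m \<in> row_monomials \<phi> S then e S m F else 0)" for S F m
    unfolding \<chi>_def by (rule lookup_sum_single[OF finite_row_monomials])
  have S: "S \<subseteq> {..<d} \<and> card S = j" if m: "m \<in> row_monomials \<phi> S" for S m
  proof -
    obtain F where "m \<in> keys (\<phi> S F)" using m unfolding row_monomials_def by blast
    then have "\<phi> S F \<noteq> 0" by auto
    from D_support[OF D this] show ?thesis by (simp add: ok_def)
  qed
  have mem: "F \<in> rel_star (keys m) S {..<n} \<and> card F = Suc q \<and> S \<subseteq> {..<d} \<and> card S = j"
    if "lookup (\<chi> S F) m \<noteq> 0" for S F m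
  proof -
    have m: "m \<in> row_monomials \<phi> S" "e S m F \<noteq> 0" using that unfolding lookup_chi by metis+
    then show ?thesis using e(1)[of S m] S[OF m(1)] unfolding chain_on_def by blast
  qed
  have "D j (Suc q) \<chi>"
  proof (rule DI)
    fix S F assume "\<chi> S F \<noteq> 0"
    then obtain m where "lookup (\<chi> S F) m \<noteq> 0" by (metis poly_mapping_eqI lookup_zero)
    from mem[OF this] show "ok S F \<and> card S = j \<and> card F = Suc q" by (auto simp: ok_def rel_star_def)
  next
    fix S F
    show "pres F (\<chi> S F) = \<chi> S F"
    proof (rule poly_mapping_eqI)
      fix m show "lookup (pres F (\<chi> S F)) m = lookup (\<chi> S F) m"
        using mem[of S F m] by (auto simp: lookup_pres rel_star_def)
    qed
  qed
  moreover have "bd \<chi> S F = \<phi> S F" for S F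
  proof (rule poly_mapping_eqI)
    fix m
    show "lookup (bd \<chi> S F) m = lookup (\<phi> S F) m"
    proof (cases "ok S F \<and> keys m \<subseteq> F \<and> m \<in> row_monomials \<phi> S")
      case True
      then have "F \<in> rel_star (keys m) S {..<n}" "S \<subseteq> {..<d}"
        using link_faceD(5) by (auto simp: ok_def rel_star_def)
      moreover have "kz ?W (\<lambda>_. 1) (\<lambda>F. lookup (\<chi> S F) m) F = kz ?W (\<lambda>_. 1) (e S m) F"
        using True by (simp add: lookup_chi)
      ultimately show ?thesis using True e(2) by (simp add: lookup_bd)
    next
      case False
      have "lookup (bd \<chi> S F) m = 0"
        using False by (auto simp: lookup_bd lookup_chi)
      moreover have "lookup (\<phi> S F) m = 0"
      proof (rule ccontr)
        assume nz: "lookup (\<phi> S F) m \<noteq> 0"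
        then have "\<phi> S F \<noteq> 0" by auto
        then have o: "ok S F" using D_support[OF D] by blast
        have "keys m \<subseteq> F" using nz D_pres[OF D, of F S] by (metis lookup_pres)
        moreover have "m \<in> row_monomials \<phi> S"
          using nz ok_finite(3)[OF o] by (auto simp: row_monomials_def in_keys_iff)
        ultimately show False using False o by blast
      qed
      ultimately show ?thesis by simp
    qed
  qed
  ultimately show ?thesis by blast
qed

section \<open>Exactness of the columns\<close>

lemma kap_carried:
  assumes "F \<in> \<Delta>"
  shows "kap \<phi> S F = kz (carried F) (\<lambda>i. lin F (\<theta> i)) (\<lambda>S. \<phi> S F) S"
  unfolding kap_def kz_def
proof (rule sum.mono_neutral_right)
  show "\<forall>i\<in>{..<d} - S - (carried F - S). ksgn i S * lin F (\<theta> i) * \<phi> (insert i S) F = 0"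
    using form_zero[OF assms] by (auto simp: carried_def)
qed (auto simp: carried_def)

text \<open>The last clause records that no new faces appear; the chase needs it to pass the size
  bound on to the next row.\<close>

lemma column_exact:
  assumes D: "D j q \<phi>" and cyc: "\<And>S F. kap \<phi> S F = 0"
    and large: "\<And>S F. \<phi> S F \<noteq> 0 \<Longrightarrow> card (\<sigma> (F \<union> E)) < j + card E + card F"
  shows "\<exists>\<psi>. D (Suc j) q \<psi> \<and> (\<forall>S F. kap \<psi> S F = \<phi> S F) \<and>
    (\<forall>S F. \<psi> S F \<noteq> 0 \<longrightarrow> (\<exists>S'. \<phi> S' F \<noteq> 0))"
proof -
  have "\<exists>y. (\<forall>S. y S \<noteq> 0 \<longrightarrow> S \<subseteq> carried F \<and> card S = Suc j) \<and> (\<forall>S. pres F (y S) = y S) \<and>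
      (\<forall>T. kz (carried F) (\<lambda>i. lin F (\<theta> i)) y T = \<phi> T F)" if nz: "\<phi> S F \<noteq> 0" for S F
  proof (rule koszul_exact)
    have F: "F \<in> \<Delta>" using D_support[OF D nz] by (simp add: ok_def)
    show "finite F" using link_faceD(4)[OF F] .
    show "finite (carried F)" by (simp add: carried_def)
    show "card (carried F) < j + card F" using large[OF nz] card_carried[OF F] by simp
    show "x w = 0" if "\<And>i. i \<in> carried F \<Longrightarrow> (\<Sum>v\<in>F. \<theta> i v * x v) = 0" "w \<in> F" for x w
      using forms_nondegenerate[OF F that] .
    show "S \<subseteq> carried F \<and> card S = j" if "\<phi> S F \<noteq> 0" for S
      using D_support[OF D that] by (auto simp: ok_def carried_def)
    show "pres F (\<phi> S F) = \<phi> S F" for S using D_pres[OF D] .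
    show "kz (carried F) (\<lambda>i. lin F (\<theta> i)) (\<lambda>S. \<phi> S F) T = 0" for T
      using cyc[of T F] kap_carried[OF F, of \<phi> T] by simp
  qed
  then have "\<forall>F. \<exists>y. (\<exists>S. \<phi> S F \<noteq> 0) \<longrightarrow> (\<forall>S. y S \<noteq> 0 \<longrightarrow> S \<subseteq> carried F \<and> card S = Suc j) \<and>
      (\<forall>S. pres F (y S) = y S) \<and> (\<forall>T. kz (carried F) (\<lambda>i. lin F (\<theta> i)) y T = \<phi> T F)" by blast
  then obtain y where y: "\<And>F. \<exists>S. \<phi> S F \<noteq> 0 \<Longrightarrow> (\<forall>S. y F S \<noteq> 0 \<longrightarrow> S \<subseteq> carried F \<and> card S = Suc j) \<and>
      (\<forall>S. pres F (y F S) = y F S) \<and> (\<forall>T. kz (carried F) (\<lambda>i. lin F (\<theta> i)) (y F) T = \<phi> T F)"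
    by metis
  define \<psi> where "\<psi> S F = (if \<exists>S. \<phi> S F \<noteq> 0 then y F S else 0)" for S F
  have "D (Suc j) q \<psi>"
  proof (rule DI)
    fix S F assume nz: "\<psi> S F \<noteq> 0"
    then have ex: "\<exists>S. \<phi> S F \<noteq> 0" and "y F S \<noteq> 0" unfolding \<psi>_def by metis+
    then have "S \<subseteq> carried F" "card S = Suc j" using y by blast+
    moreover from ex have "F \<in> \<Delta>" "card F = q" using D_support[OF D] by (auto simp: ok_def)
    ultimately show "ok S F \<and> card S = Suc j \<and> card F = q" by (auto simp: ok_def carried_def)
  next
    fix S F show "pres F (\<psi> S F) = \<psi> S F" using y by (simp add: \<psi>_def)
  qed
  moreover have "kap \<psi> S F = \<phi> S F" for S F
  proof (cases "\<exists>S. \<phi> S F \<noteq> 0")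
    case True
    then have "F \<in> \<Delta>" using D_support[OF D] by (auto simp: ok_def)
    then show ?thesis using y[OF True] True by (simp add: kap_carried \<psi>_def)
  next
    case False
    then show ?thesis by (simp add: kap_def \<psi>_def)
  qed
  moreover have "\<exists>S'. \<phi> S' F \<noteq> 0" if "\<psi> S F \<noteq> 0" for S F
    using that unfolding \<psi>_def by metis
  ultimately show ?thesis by blast
qed

text \<open>A lift \<open>\<psi>\<close> along the columns may fail to be a row cycle. Its row
  boundary is again a cycle in both directions, with one vertex less and one index more, so the
  induction hypothesis applies to it.\<close>

lemma double_complex_exact:
  assumes "D j q \<phi>" "\<And>S F. bd \<phi> S F = 0" "\<And>S F. kap \<phi> S F = 0" "q \<le> d"
    and "\<And>S F. \<phi> S F \<noteq> 0 \<Longrightarrow> card (\<sigma> (F \<union> E)) < j + card E + card F"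
  shows "\<exists>\<psi>. D (Suc j) q \<psi> \<and> (\<forall>S F. bd \<psi> S F = 0) \<and> (\<forall>S F. kap \<psi> S F = \<phi> S F)"
  using assms
proof (induction q arbitrary: j \<phi>)
  case 0
  have "\<exists>\<psi>. D (Suc j) 0 \<psi> \<and> (\<forall>S F. kap \<psi> S F = \<phi> S F) \<and>
      (\<forall>S F. \<psi> S F \<noteq> 0 \<longrightarrow> (\<exists>S'. \<phi> S' F \<noteq> 0))"
    by (rule column_exact[OF 0(1,3)]) (rule 0(5))
  then obtain \<psi> where \<psi>: "D (Suc j) 0 \<psi>" "\<And>S F. kap \<psi> S F = \<phi> S F" by blast
  have "bd \<psi> S F = 0" for S F
  proof (cases "ok S F")
    case True
    have "kz (\<Union>\<Gamma>) (\<lambda>_. 1) (\<psi> S) F = 0"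
    proof (rule kz_eq_0I)
      fix w
      have "card (insert w F) \<noteq> 0" using ok_finite(2)[OF True] by simp
      then show "\<psi> S (insert w F) = 0" using D_support[OF \<psi>(1), of S "insert w F"] by auto
    qed
    then show ?thesis by (simp add: bd_def)
  qed (simp add: bd_def)
  then show ?case using \<psi> by blast
next
  case (Suc q)
  have "\<exists>\<psi>. D (Suc j) (Suc q) \<psi> \<and> (\<forall>S F. kap \<psi> S F = \<phi> S F) \<and>
      (\<forall>S F. \<psi> S F \<noteq> 0 \<longrightarrow> (\<exists>S'. \<phi> S' F \<noteq> 0))"
    by (rule column_exact[OF Suc.prems(1,3)]) (rule Suc.prems(5))
  then obtain \<psi> where \<psi>: "D (Suc j) (Suc q) \<psi>" "\<And>S F. kap \<psi> S F = \<phi> S F"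
    "\<And>S F. \<psi> S F \<noteq> 0 \<Longrightarrow> \<exists>S'. \<phi> S' F \<noteq> 0" by blast
  have kap_psi: "kap \<psi> = \<phi>" using \<psi>(2) by (intro ext)
  have "\<exists>\<beta>. D (Suc (Suc j)) q \<beta> \<and> (\<forall>S F. bd \<beta> S F = 0) \<and> (\<forall>S F. kap \<beta> S F = bd \<psi> S F)"
  proof (rule Suc.IH)
    show "D (Suc j) q (bd \<psi>)" by (rule D_bd[OF \<psi>(1)])
    show "bd (bd \<psi>) S F = 0" for S F by (rule bd_bd[OF \<psi>(1)])
    show "kap (bd \<psi>) S F = 0" for S F
      using bd_kap[of \<psi> S F] Suc.prems(2) by (simp add: kap_psi)
    show "q \<le> d" using Suc.prems(4) by simp
    fix S F assume nz: "bd \<psi> S F \<noteq> 0"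
    obtain w where w: "w \<notin> F" "\<psi> S (insert w F) \<noteq> 0" using bd_nonzero(4)[OF \<psi>(1) nz] by blast
    then obtain S' where S': "\<phi> S' (insert w F) \<noteq> 0" using \<psi>(3) by blast
    have wF: "insert w F \<in> \<Delta>" using D_support[OF Suc.prems(1) S'] by (simp add: ok_def)
    have "card (\<sigma> (F \<union> E)) \<le> card (\<sigma> (insert w F \<union> E))"
      by (rule card_mono[OF finite_subset[OF link_faceD(5)[OF wF]] link_carrier_mono[OF wF]]) auto
    moreover have "card (insert w F) = Suc (card F)"
      using w(1) link_faceD(4)[OF wF] by simp
    ultimately show "card (\<sigma> (F \<union> E)) < Suc j + card E + card F"
      using Suc.prems(5)[OF S'] by simp
  qed
  then obtain \<beta> where \<beta>: "D (Suc (Suc j)) q \<beta>" "\<And>S F. bd \<beta> S F = 0" "\<And>S F. kap \<beta> S F = bd \<psi> S F"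
    by blast
  \<comment> \<open>\<open>\<beta>\<close> has faces with q < d vertices, below the only degree in
    which rows can fail to be exact.\<close>
  obtain \<chi> where \<chi>: "D (Suc (Suc j)) (Suc q) \<chi>" "\<And>S F. bd \<chi> S F = \<beta> S F"
    using row_exact[OF \<beta>(1,2)] Suc.prems(4) by fastforce
  have bd_chi: "bd \<chi> = \<beta>" using \<chi>(2) by (intro ext)
  \<comment> \<open>The correction removes the row boundary of \<open>\<psi>\<close> and leaves its
    image under \<open>kap\<close> unchanged.\<close>
  define \<psi>' where "\<psi>' = (\<lambda>S F. \<psi> S F - kap \<chi> S F)"
  have "D (Suc j) (Suc q) \<psi>'"
    unfolding \<psi>'_def by (rule D_diff[OF \<psi>(1) D_kap[OF \<chi>(1)]])
  moreover have "bd \<psi>' S F = 0" for S F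
    unfolding \<psi>'_def bd_diff bd_kap bd_chi \<beta>(3) by simp
  moreover have "kap \<psi>' S F = \<phi> S F" for S F
    unfolding \<psi>'_def kap_diff kap_kap[OF \<chi>(1)] \<psi>(2) by simp
  ultimately show ?case by blast
qed

end

lemma Const_kz: "Const (kz W (\<lambda>_. 1) c F) = kz W (\<lambda>_. 1) (\<lambda>F. Const (c F)) F"
  by (simp add: kz_def Const_sum Const_mult flip: ksgn_eq_Const)

lemma keys_linform:
  assumes "m \<in> keys (linform \<Delta> a)"
  obtains w where "m = Poly_Mapping.single w 1" "a w \<noteq> 0"
proof -
  have "linform \<Delta> a = (\<Sum>w\<in>vertices \<Delta>. Poly_Mapping.single (Poly_Mapping.single w 1) (a w))"
    by (simp add: linform_def Var_def Const_mult_single)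
  from assms[unfolded this]
  have "m \<in> (\<Union>w\<in>vertices \<Delta>. keys (Poly_Mapping.single (Poly_Mapping.single w 1) (a w)))"
    by (rule subsetD[OF keys_sum])
  then show ?thesis using that by (auto split: if_splits)
qed

context module_setup
begin

section \<open>The embedding by the fundamental class\<close>

text \<open>The fundamental class relative to the non-interior faces, unique up to a scalar.\<close>

definition mu :: "'w set \<Rightarrow> 'k" where
  "mu = (SOME z. cycle_on (\<Union>\<Gamma>) (rel_star {} {..<n} {..<n}) d z \<and> (\<exists>F. z F \<noteq> 0))"

lemma mu: "cycle_on (\<Union>\<Gamma>) (rel_star {} {..<n} {..<n}) d mu" "\<exists>F. mu F \<noteq> 0"
proof -
  have "line_at K (\<Union>\<Gamma>) (rel_star {} {..<n} {..<n}) d"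
    using link_faceD(5)[OF empty_in_link] by (intro rel_star_line[OF empty_in_link]) auto
  then have "\<exists>z :: 'w set \<Rightarrow> 'k. cycle_on (\<Union>\<Gamma>) (rel_star {} {..<n} {..<n}) d z \<and> (\<exists>F. z F \<noteq> 0)"
    unfolding line_at_def by blast
  from someI_ex[OF this] show "cycle_on (\<Union>\<Gamma>) (rel_star {} {..<n} {..<n}) d mu" "\<exists>F. mu F \<noteq> 0"
    unfolding mu_def by auto
qed

lemma mu_support: "mu F \<noteq> 0 \<Longrightarrow> F \<in> \<Delta> \<and> card F = d"
  using mu(1) unfolding cycle_on_def chain_on_def rel_star_def by blast

lemma mu_nonzero: "F \<in> \<Delta> \<Longrightarrow> card F = d \<Longrightarrow> mu F \<noteq> 0"
  using mu(2) top_cycle_nowhere_zero[OF empty_in_link mu(1)] by blast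

lemma mu_cycle:
  assumes "F \<in> \<Delta>" "\<sigma> (F \<union> E) = {..<n}"
  shows "kz (\<Union>\<Gamma>) (\<lambda>_. 1) mu F = 0"
  using mu(1) assms by (auto simp: cycle_on_def rel_star_def)

definition emb :: "(nat set \<Rightarrow> ('w, 'k) mpoly) \<Rightarrow> nat set \<Rightarrow> 'w set \<Rightarrow> ('w, 'k) mpoly" where
  "emb g S F = (if S \<subseteq> {..<d} then Const (mu F) * pres F (g S) else 0)"

abbreviation "koszul \<equiv> kz {..<d} (\<lambda>i. linform \<Delta> (\<theta> i))"

text \<open>Membership in the preimage of I_S, read off from monomials; monomials supported on
  non-faces are unrestricted. \<open>ideal_carrier_iff\<close> gives the link to generators.\<close>

definition "inI S p \<longleftrightarrow> (\<forall>m\<in>keys (p :: ('w, 'k) mpoly). keys m \<in> \<Delta> \<longrightarrow> {..<n} - \<sigma> (keys m \<union> E) \<subseteq> S)"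

definition "inJ p \<longleftrightarrow> (\<forall>m\<in>keys (p :: ('w, 'k) mpoly). keys m \<notin> \<Delta>)"

lemma D_emb:
  assumes "\<And>S. g S \<noteq> 0 \<Longrightarrow> card S = j"
  shows "D j d (emb g)"
proof (rule DI)
  fix S F assume "emb g S F \<noteq> 0"
  then have *: "S \<subseteq> {..<d}" "mu F \<noteq> 0" "g S \<noteq> 0" by (auto simp: emb_def split: if_splits)
  then have F: "F \<in> \<Delta>" "card F = d" using mu_support by auto
  then have "S \<subseteq> \<sigma> (F \<union> E)" using facet_interior[OF F] *(1) card_E_d by auto
  then show "ok S F \<and> card S = j \<and> card F = d" using * F assms by (simp add: ok_def)
qed (simp add: emb_def pres_pres)

lemma kap_emb: "kap (emb g) S F = emb (koszul g) S F"
proof (cases "S \<subseteq> {..<d} \<and> F \<in> \<Delta>")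
  case True
  have "kap (emb g) S F = kz {..<d} (\<lambda>i. lin F (\<theta> i)) (\<lambda>S. Const (mu F) * pres F (g S)) S"
    unfolding kap_def using True by (intro kz_cong) (auto simp: emb_def)
  then show ?thesis using True by (simp add: kz_mult emb_def pres_kz pres_form)
next
  case False
  have "emb g (insert i S) F = 0" for i
    using False mu_support[of F] by (auto simp: emb_def)
  then have "kap (emb g) S F = 0" unfolding kap_def by (intro kz_eq_0I)
  moreover have "emb (koszul g) S F = 0" using False mu_support[of F] by (auto simp: emb_def)
  ultimately show ?thesis by simp
qed

text \<open>On \<open>F\<close>, all entries at larger faces restrict to the same polynomial, so the
  boundary acts on \<open>mu\<close> alone.\<close>

lemma bd_emb:
  assumes "ok S F"
  shows "bd (emb g) S F = Const (kz (\<Union>\<Gamma>) (\<lambda>_. 1) mu F) * pres F (g S)"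
proof -
  have S: "S \<subseteq> {..<d}" using assms by (simp add: ok_def)
  have "bd (emb g) S F = kz (\<Union>\<Gamma>) (\<lambda>_. 1) (\<lambda>F'. pres F (emb g S F')) F"
    using assms by (simp add: bd_def pres_kz)
  also have "\<dots> = kz (\<Union>\<Gamma>) (\<lambda>_. 1) (\<lambda>F'. pres F (g S) * Const (mu F')) F"
  proof (rule kz_cong)
    fix w
    have "F \<inter> insert w F = F" by blast
    then show "pres F (emb g S (insert w F)) = pres F (g S) * Const (mu (insert w F))"
      using S by (simp add: emb_def pres_pres mult.commute)
  qed
  also have "\<dots> = Const (kz (\<Union>\<Gamma>) (\<lambda>_. 1) mu F) * pres F (g S)"
    by (simp add: kz_mult Const_kz mult.commute)
  finally show ?thesis .
qed

lemma bd_emb_interior: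
  assumes "\<sigma> (F \<union> E) = {..<n}"
  shows "bd (emb g) S F = 0"
proof (cases "ok S F")
  case True
  then show ?thesis using bd_emb[OF True] mu_cycle[OF _ assms] by (simp add: ok_def)
qed (simp add: bd_def)

text \<open>At interior faces \<open>mu\<close> is a cycle. At any other admissible \<open>F\<close>
  the polynomial restricts to zero: a monomial of I_S on \<open>F\<close> misses only elements of
  \<open>S\<close>, which \<open>F \<union> E\<close> carries, so \<open>F\<close> would be
  interior.\<close>

lemma bd_emb_zero:
  assumes "\<And>S. inI S (g S)"
  shows "bd (emb g) S F = 0"
proof (cases "ok S F \<and> \<sigma> (F \<union> E) \<noteq> {..<n}")
  case True
  then have F: "F \<in> \<Delta>" and S: "S \<subseteq> \<sigma> (F \<union> E)" by (auto simp: ok_def)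
  have "pres F (g S) = 0"
  proof (rule poly_mapping_eqI)
    fix m
    have "lookup (g S) m = 0" if m: "keys m \<subseteq> F"
    proof (rule ccontr)
      assume "lookup (g S) m \<noteq> 0"
      then have "m \<in> keys (g S)" by (simp add: in_keys_iff)
      then have "{..<n} - \<sigma> (keys m \<union> E) \<subseteq> S"
        using assms[of S] link_face_sub[OF F m] by (simp add: inI_def)
      moreover have "\<sigma> (keys m \<union> E) \<subseteq> \<sigma> (F \<union> E)" by (rule link_carrier_mono[OF F m])
      ultimately have "{..<n} \<subseteq> \<sigma> (F \<union> E)" using S by blast
      then show False using True link_faceD(5)[OF F] by blast
    qed
    then show "lookup (pres F (g S)) m = lookup 0 m" by (simp add: lookup_pres)
  qed
  then show ?thesis using True by (simp add: bd_emb)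
next
  case False
  show ?thesis
  proof (cases "ok S F")
    case True
    with False show ?thesis by (intro bd_emb_interior) simp
  qed (simp add: bd_def)
qed

text \<open>Every face lies in a facet, and \<open>mu\<close> vanishes on no facet.\<close>

lemma emb_inject:
  assumes "\<And>F. emb g S F = emb h S F" "S \<subseteq> {..<d}"
  shows "inJ (g S - h S)"
  unfolding inJ_def
proof
  fix m assume m: "m \<in> keys (g S - h S)"
  show "keys m \<notin> \<Delta>"
  proof
    assume "keys m \<in> \<Delta>"
    then obtain F where F: "F \<in> \<Delta>" "keys m \<subseteq> F" "card F = d" by (rule exists_facet)
    have "Const (mu F) * pres F (g S) = Const (mu F) * pres F (h S)"
      using assms(1)[of F] assms(2) by (simp add: emb_def)
    then have "pres F (g S) = pres F (h S)" using mu_nonzero[OF F(1,3)] by simp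
    then have "lookup (g S) m = lookup (h S) m" using F(2) by (metis lookup_pres)
    then show False using m by (simp add: in_keys_iff lookup_minus)
  qed
qed

lemma emb_inJ:
  assumes "inJ (g S - h S)"
  shows "emb g S F = emb h S F"
proof (cases "mu F = 0")
  case False
  have F: "F \<in> \<Delta>" using mu_support[OF False] by blast
  have "pres F (g S) = pres F (h S)"
  proof (rule poly_mapping_eqI)
    fix m
    have "lookup (g S) m = lookup (h S) m" if "keys m \<subseteq> F"
    proof (rule ccontr)
      assume "lookup (g S) m \<noteq> lookup (h S) m"
      then have "m \<in> keys (g S - h S)" by (simp add: in_keys_iff lookup_minus)
      then show False using assms link_face_sub[OF F that] by (simp add: inJ_def)
    qed
    then show "lookup (pres F (g S)) m = lookup (pres F (h S)) m" by (simp add: lookup_pres)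
  qed
  then show ?thesis by (simp add: emb_def)
qed (simp add: emb_def)

text \<open>A nonzero relative top cycle above the support of \<open>m\<close> forces the support to
  satisfy the carrier condition of I_S. Cycles then form a line, spanned by the part of
  \<open>mu\<close> above the support.\<close>

lemma top_row_monomial:
  assumes D: "D j d \<psi>" and cyc: "\<And>S F. bd \<psi> S F = 0" and S: "S \<subseteq> {..<d}"
    and m: "m \<in> row_monomials \<psi> S"
  shows "{..<n} - \<sigma> (keys m \<union> E) \<subseteq> S"
    "\<exists>a. \<forall>F. lookup (\<psi> S F) m = (if keys m \<subseteq> F then a * mu F else 0)"
proof -
  let ?W = "\<Union>\<Gamma>" and ?G = "keys m"
  let ?X = "rel_star ?G S {..<n}"
  define c where "c = (\<lambda>F. lookup (\<psi> S F) m)"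
  have G: "?G \<in> \<Delta>" by (rule row_monomials_face[OF D m])
  have Sn: "S \<subseteq> {..<n}" using S card_E_d by auto
  have c: "cycle_on ?W ?X d c" unfolding c_def by (rule row_monomial_cycle[OF D cyc S])
  have "\<exists>F. c F \<noteq> 0" using m by (auto simp: c_def row_monomials_def in_keys_iff)
  then obtain F1 where F1: "c F1 \<noteq> 0" ..
  have full: "S \<union> \<sigma> (?G \<union> E) = {..<n}"
  proof (rule ccontr)
    assume "S \<union> \<sigma> (?G \<union> E) \<noteq> {..<n}"
    then have "exact_at K ?W ?X d" using rel_star_exact[OF G Sn] by blast
    then obtain e :: "'w set \<Rightarrow> 'k" where e: "chain_on ?X (Suc d) e" "\<And>F. F \<in> ?X \<Longrightarrow> kz ?W (\<lambda>_. 1) e F = c F"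
      using c unfolding exact_at_def by blast
    have "e F = 0" for F
    proof (rule ccontr)
      assume "e F \<noteq> 0"
      then have "F \<in> \<Delta>" "card F = Suc d" using e(1) by (auto simp: chain_on_def rel_star_def)
      then show False using card_face_le[of F] by simp
    qed
    then have "e = (\<lambda>_. 0)" by blast
    moreover have "F1 \<in> ?X" using c F1 unfolding cycle_on_def chain_on_def by blast
    ultimately show False using e(2)[of F1] F1 by simp
  qed
  then show "{..<n} - \<sigma> (?G \<union> E) \<subseteq> S" by blast
  \<comment> \<open>Nonzero because \<open>mu\<close> vanishes on no facet; hence it spans the line
    of cycles.\<close>
  define mu' where "mu' F = (if ?G \<subseteq> F then mu F else 0)" for F
  have "cycle_on ?W ?X d mu'"
    unfolding cycle_on_def
  proof
    show "chain_on ?X d mu'"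
      unfolding chain_on_def
    proof (intro allI impI)
      fix F assume "mu' F \<noteq> 0"
      then have "?G \<subseteq> F" "mu F \<noteq> 0" by (auto simp: mu'_def split: if_splits)
      moreover from this have "F \<in> \<Delta>" "card F = d" using mu_support by auto
      ultimately show "F \<in> ?X \<and> card F = d"
        using facet_interior[of F] Sn by (auto simp: rel_star_def)
    qed
    show "\<forall>F\<in>?X. kz ?W (\<lambda>_. 1) mu' F = 0"
    proof
      fix F assume "F \<in> ?X"
      then have F: "F \<in> \<Delta>" "?G \<subseteq> F" "S \<subseteq> \<sigma> (F \<union> E)" "\<sigma> (F \<union> E) \<subseteq> {..<n}" by (auto simp: rel_star_def)
      have "\<sigma> (F \<union> E) = {..<n}" using link_carrier_mono[OF F(1,2)] F(3,4) full by blast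
      then have "kz ?W (\<lambda>_. 1) mu F = 0" by (rule mu_cycle[OF F(1)])
      moreover have "kz ?W (\<lambda>_. 1) mu' F = kz ?W (\<lambda>_. 1) mu F"
        using F(2) by (intro kz_cong) (auto simp: mu'_def)
      ultimately show "kz ?W (\<lambda>_. 1) mu' F = 0" by simp
    qed
  qed
  moreover have "line_at K ?W ?X d" by (rule rel_star_line[OF G full])
  ultimately obtain z :: "'w set \<Rightarrow> 'k" and a1 a2 where z: "\<And>F. c F = a1 * z F" "\<And>F. mu' F = a2 * z F"
    using c unfolding line_at_def by blast
  obtain F0 where F0: "F0 \<in> \<Delta>" "?G \<subseteq> F0" "card F0 = d" by (rule exists_facet[OF G])
  then have "mu' F0 \<noteq> 0" using mu_nonzero by (simp add: mu'_def)
  then have "a2 \<noteq> 0" using z(2)[of F0] by auto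
  then have "c F = a1 / a2 * mu' F" for F using z(1)[of F] z(2)[of F] by simp
  then show "\<exists>a. \<forall>F. lookup (\<psi> S F) m = (if ?G \<subseteq> F then a * mu F else 0)"
    unfolding c_def by (intro exI[of _ "a1 / a2"]) (simp add: mu'_def)
qed

lemma top_row_exact:
  assumes D: "D j d \<psi>" and cyc: "\<And>S F. bd \<psi> S F = 0"
  shows "\<exists>g. (\<forall>S. g S \<noteq> 0 \<longrightarrow> S \<subseteq> {..<d} \<and> card S = j) \<and> (\<forall>S. inI S (g S)) \<and> emb g = \<psi>"
proof -
  have "\<forall>S m. \<exists>a. S \<subseteq> {..<d} \<and> m \<in> row_monomials \<psi> S \<longrightarrow>
      (\<forall>F. lookup (\<psi> S F) m = (if keys m \<subseteq> F then a * mu F else 0))"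
    using top_row_monomial(2)[OF D cyc] by blast
  then obtain a where a: "\<And>S m F. S \<subseteq> {..<d} \<Longrightarrow> m \<in> row_monomials \<psi> S \<Longrightarrow>
      lookup (\<psi> S F) m = (if keys m \<subseteq> F then a S m * mu F else 0)" by metis
  define g where "g S = (\<Sum>m\<in>row_monomials \<psi> S. Poly_Mapping.single m (a S m))" for S
  have lookup_g: "lookup (g S) m = (if m \<in> row_monomials \<psi> S then a S m else 0)" for S m
    unfolding g_def by (rule lookup_sum_single[OF finite_row_monomials])
  have S: "S \<subseteq> {..<d} \<and> card S = j" if m: "m \<in> row_monomials \<psi> S" for S m
  proof -
    obtain F where "m \<in> keys (\<psi> S F)" using m unfolding row_monomials_def by blast
    then have "\<psi> S F \<noteq> 0" by auto
    from D_support[OF D this] show ?thesis by (simp add: ok_def)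
  qed
  have keys_g: "m \<in> row_monomials \<psi> S" if "m \<in> keys (g S)" for S m
    using that by (auto simp: in_keys_iff lookup_g split: if_splits)
  have "S \<subseteq> {..<d} \<and> card S = j" if "g S \<noteq> 0" for S
  proof -
    from that obtain m where "m \<in> keys (g S)" by fastforce
    then show ?thesis using keys_g S by blast
  qed
  moreover have "inI S (g S)" for S
    unfolding inI_def
  proof (intro ballI impI)
    fix m assume "m \<in> keys (g S)"
    then have m: "m \<in> row_monomials \<psi> S" by (rule keys_g)
    show "{..<n} - \<sigma> (keys m \<union> E) \<subseteq> S"
      using top_row_monomial(1)[OF D cyc _ m] S[OF m] by blast
  qed
  moreover have "emb g = \<psi>"
  proof (rule ext, rule ext, rule poly_mapping_eqI)
    fix S F m
    show "lookup (emb g S F) m = lookup (\<psi> S F) m"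
    proof (cases "S \<subseteq> {..<d} \<and> m \<in> row_monomials \<psi> S")
      case True
      then have "lookup (emb g S F) m = (if keys m \<subseteq> F then mu F * a S m else 0)"
        by (simp add: emb_def lookup_Const_mult lookup_pres lookup_g)
      also have "\<dots> = lookup (\<psi> S F) m" using True a[of S m F] by (simp add: mult.commute)
      finally show ?thesis .
    next
      case False
      have "lookup (emb g S F) m = 0"
        using False by (auto simp: emb_def lookup_Const_mult lookup_pres lookup_g)
      moreover have "lookup (\<psi> S F) m = 0"
      proof (rule ccontr)
        assume nz: "lookup (\<psi> S F) m \<noteq> 0"
        then have "\<psi> S F \<noteq> 0" by auto
        from D_support[OF D this] have "S \<subseteq> {..<d}" "F \<in> \<Delta>" by (auto simp: ok_def)
        moreover from this nz have "m \<in> row_monomials \<psi> S"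
          by (auto simp: row_monomials_def in_keys_iff)
        ultimately show False using False by blast
      qed
      ultimately show ?thesis by simp
    qed
  qed
  ultimately show ?thesis by blast
qed

section \<open>Exactness\<close>

lemma koszul_outside:
  assumes "\<And>S. g S \<noteq> 0 \<Longrightarrow> S \<subseteq> {..<d} \<and> card S = Suc j" "koszul g S \<noteq> 0"
  shows "S \<subseteq> {..<d} \<and> card S = j"
proof -
  obtain i where i: "i \<notin> S" "g (insert i S) \<noteq> 0"
    using assms(2) kz_eq_0I[of "{..<d}" S g "\<lambda>i. linform \<Delta> (\<theta> i)"] by metis
  then have "insert i S \<subseteq> {..<d}" "card (insert i S) = Suc j" using assms(1) by auto
  moreover from this have "finite S" using finite_subset[of S "{..<d}"] by simp
  ultimately show ?thesis using i(1) by simp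
qed

lemma inJ_0: "inJ 0"
  by (simp add: inJ_def)

lemma emb_koszul_inJ:
  assumes "emb (koszul g) = emb f" "\<And>S. g S \<noteq> 0 \<Longrightarrow> S \<subseteq> {..<d} \<and> card S = Suc j"
    "\<And>S. f S \<noteq> 0 \<Longrightarrow> S \<subseteq> {..<d} \<and> card S = j"
  shows "inJ (f S - koszul g S)"
proof (cases "S \<subseteq> {..<d}")
  case True
  then show ?thesis using emb_inject[of f S "koszul g"] assms(1) by simp
next
  case False
  then have "f S = 0" "koszul g S = 0" using assms(3) koszul_outside[OF assms(2)] by blast+
  then show ?thesis by (simp add: inJ_0)
qed

text \<open>On facets the size bound reads n < j + |E| + d = j + n, so it holds for every positive
  j.\<close>

lemma exact_positive_degree:
  assumes j: "1 \<le> j" and f: "\<And>S. f S \<noteq> 0 \<Longrightarrow> S \<subseteq> {..<d} \<and> card S = j" "\<And>S. inI S (f S)"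
    and cyc: "\<And>T. inJ (koszul f T)"
  shows "\<exists>g. (\<forall>S. g S \<noteq> 0 \<longrightarrow> S \<subseteq> {..<d} \<and> card S = Suc j) \<and> (\<forall>S. inI S (g S)) \<and>
    (\<forall>S. inJ (f S - koszul g S))"
proof -
  have Df: "D j d (emb f)" using f(1) by (intro D_emb) blast
  have "\<exists>\<psi>. D (Suc j) d \<psi> \<and> (\<forall>S F. bd \<psi> S F = 0) \<and> (\<forall>S F. kap \<psi> S F = emb f S F)"
  proof (rule double_complex_exact[OF Df])
    show "bd (emb f) S F = 0" for S F using f(2) by (rule bd_emb_zero)
    show "kap (emb f) S F = 0" for S F
    proof -
      have "emb (koszul f) S F = emb (\<lambda>_. 0) S F" using cyc by (intro emb_inJ) simp
      then show ?thesis by (simp add: kap_emb) (simp add: emb_def)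
    qed
    fix S F assume "emb f S F \<noteq> 0"
    then have "F \<in> \<Delta>" "card F = d" using D_support[OF Df] by (auto simp: ok_def)
    then show "card (\<sigma> (F \<union> E)) < j + card E + card F"
      using facet_interior[of F] card_E_d j by simp
  qed simp
  then obtain \<psi> where \<psi>: "D (Suc j) d \<psi>" "\<And>S F. bd \<psi> S F = 0" "\<And>S F. kap \<psi> S F = emb f S F" by blast
  obtain g where g: "\<And>S. g S \<noteq> 0 \<Longrightarrow> S \<subseteq> {..<d} \<and> card S = Suc j" "\<And>S. inI S (g S)" "emb g = \<psi>"
    using top_row_exact[OF \<psi>(1,2)] by blast
  have "emb (koszul g) = emb f" using \<psi>(3) by (intro ext) (simp flip: kap_emb add: g(3))
  then have "inJ (f S - koszul g S)" for S using g(1) f(1) by (rule emb_koszul_inJ)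
  then show ?thesis using g by blast
qed

lemma exact_degree_zero:
  assumes d: "0 < d" and p: "inI {} p" "inJ (p - (\<Sum>i<d. r i * linform \<Delta> (\<theta> i)))"
  shows "\<exists>g. (\<forall>S. g S \<noteq> 0 \<longrightarrow> S \<subseteq> {..<d} \<and> card S = 1) \<and> (\<forall>S. inI S (g S)) \<and>
    inJ (p - koszul g {})"
proof -
  \<comment> \<open>The coefficients as a family on singletons; \<open>r i\<close> need not lie in
    I_{i}.\<close>
  define rr where "rr S = (if \<exists>i<d. S = {i} then r (the_elem S) else 0)" for S
  define f where "f S = (if S = {} then p else 0)" for S :: "nat set"
  have rr: "S \<subseteq> {..<d} \<and> card S = Suc 0" if "rr S \<noteq> 0" for S
    using that by (auto simp: rr_def split: if_splits)
  have f: "S \<subseteq> {..<d} \<and> card S = 0" if "f S \<noteq> 0" for S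
    using that by (auto simp: f_def split: if_splits)
  have fI: "inI S (f S)" for S using p(1) by (simp add: f_def inI_def)
  have koszul_rr: "koszul rr {} = (\<Sum>i<d. r i * linform \<Delta> (\<theta> i))"
    unfolding kz_def by (rule sum.cong) (auto simp: rr_def ksgn_def)
  have emb_rr: "emb (koszul rr) S F = emb f S F" for S F
  proof (cases "S = {}")
    case True
    then show ?thesis using p(2) koszul_rr by (intro emb_inJ[symmetric]) (simp add: f_def)
  next
    case False
    have "koszul rr S = 0"
    proof (rule ccontr)
      assume "koszul rr S \<noteq> 0"
      from koszul_outside[OF rr this] have "card S = 0" "finite S" using finite_subset by auto
      with False show False by simp
    qed
    then show ?thesis using False by (simp add: emb_def f_def)
  qed
  have Dr: "D (Suc 0) d (emb rr)" using rr by (intro D_emb) blast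
  obtain e where e: "d = Suc e" using d by (cases d) auto
  \<comment> \<open>\<open>kap\<close> kills the row boundary of the embedded coefficients:
    \<open>p\<close> lies in I, so its own embedding is a row cycle.\<close>
  have "\<exists>\<beta>. D (Suc (Suc 0)) e \<beta> \<and> (\<forall>S F. bd \<beta> S F = 0) \<and> (\<forall>S F. kap \<beta> S F = bd (emb rr) S F)"
  proof (rule double_complex_exact)
    show Db: "D (Suc 0) e (bd (emb rr))" using Dr unfolding e by (rule D_bd)
    show "bd (bd (emb rr)) S F = 0" for S F by (rule bd_bd[OF Dr])
    show "kap (bd (emb rr)) S F = 0" for S F
    proof -
      have "kap (emb rr) = emb f" using emb_rr by (intro ext) (simp add: kap_emb)
      then show ?thesis using bd_emb_zero[of f S F, OF fI] by (simp flip: bd_kap)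
    qed
    show "e \<le> d" using e by simp
    fix S F assume nz: "bd (emb rr) S F \<noteq> 0"
    then have F: "F \<in> \<Delta>" "card F = e" using D_support[OF Db] by (auto simp: ok_def)
    have "\<sigma> (F \<union> E) \<noteq> {..<n}" using nz bd_emb_interior by blast
    then have "card (\<sigma> (F \<union> E)) < card {..<n}"
      using link_faceD(5)[OF F(1)] by (intro psubset_card_mono) auto
    then show "card (\<sigma> (F \<union> E)) < Suc 0 + card E + card F" using F(2) e card_E_d by simp
  qed
  then obtain \<beta> where \<beta>: "D (Suc (Suc 0)) e \<beta>" "\<And>S F. bd \<beta> S F = 0" "\<And>S F. kap \<beta> S F = bd (emb rr) S F"
    by blast
  obtain \<chi> where \<chi>: "D (Suc (Suc 0)) d \<chi>" "\<And>S F. bd \<chi> S F = \<beta> S F"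
    using row_exact[OF \<beta>(1,2)] e by fastforce
  have bd_chi: "bd \<chi> = \<beta>" using \<chi>(2) by (intro ext)
  \<comment> \<open>The corrected coefficients still combine to \<open>p\<close> and are now a row
    cycle, hence the embedding of a family with members in the ideals I_{i}.\<close>
  define \<psi> where "\<psi> = (\<lambda>S F. emb rr S F - kap \<chi> S F)"
  have D\<psi>: "D (Suc 0) d \<psi>" unfolding \<psi>_def by (rule D_diff[OF Dr D_kap[OF \<chi>(1)]])
  have bd\<psi>: "bd \<psi> S F = 0" for S F
    unfolding \<psi>_def bd_diff bd_kap bd_chi \<beta>(3) by simp
  have kap\<psi>: "kap \<psi> S F = emb f S F" for S F
    unfolding \<psi>_def kap_diff kap_kap[OF \<chi>(1)] kap_emb emb_rr by simp
  obtain g where g: "\<And>S. g S \<noteq> 0 \<Longrightarrow> S \<subseteq> {..<d} \<and> card S = Suc 0" "\<And>S. inI S (g S)" "emb g = \<psi>"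
    using top_row_exact[OF D\<psi> bd\<psi>] by blast
  have "emb (koszul g) = emb f" using kap\<psi> by (intro ext) (simp flip: kap_emb add: g(3))
  then have "inJ (f {} - koszul g {})" using g(1) f by (rule emb_koszul_inJ)
  then show ?thesis using g by (intro exI[of _ g]) (simp add: f_def)
qed

text \<open>Nothing outside {0..<b} is missing from any carrier, and b \<le> d. This makes the
  leftmost term the whole face ring.\<close>

lemma inI_full: "inI {..<d} p"
  unfolding inI_def
proof (intro ballI impI subsetI)
  fix m i assume "keys m \<in> \<Delta>" "i \<in> {..<n} - \<sigma> (keys m \<union> E)"
  then have "i < b" using not_carrier_less_b[of "keys m" i] by simp
  then show "i \<in> {..<d}" using b_le_d by simp
qed

text \<open>Each variable occurring in form \<open>i\<close> adds \<open>i\<close> to the carrier as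
  soon as \<open>i\<close> was missing: if \<open>i\<close> were still missing from the product, the
  coefficient of that variable would be zero.\<close>

lemma inI_form_mult:
  assumes p: "inI (insert i T) p" and i: "i < d"
  shows "inI T (linform \<Delta> (\<theta> i) * p)"
  unfolding inI_def
proof (intro ballI impI subsetI)
  fix m v assume m: "m \<in> keys (linform \<Delta> (\<theta> i) * p)" "keys m \<in> \<Delta>"
    and v: "v \<in> {..<n} - \<sigma> (keys m \<union> E)"
  obtain u m' where u: "m = u + m'" "u \<in> keys (linform \<Delta> (\<theta> i))" "m' \<in> keys p"
    using m(1) keys_mult[of "linform \<Delta> (\<theta> i)" p] by blast
  obtain w where w: "u = Poly_Mapping.single w 1" "\<theta> i w \<noteq> 0" using keys_linform[OF u(2)] .
  have keys_m: "keys m = insert w (keys m')" by (simp add: u(1) w(1) keys_add_nat)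
  have sub: "keys m' \<subseteq> keys m" using keys_m by blast
  have "{..<n} - \<sigma> (keys m' \<union> E) \<subseteq> insert i T"
    using p u(3) link_face_sub[OF m(2) sub] by (simp add: inI_def)
  moreover have "v \<notin> \<sigma> (keys m' \<union> E)" using v link_carrier_mono[OF m(2) sub] by blast
  ultimately have "v \<in> insert i T" using v by blast
  moreover have "v \<noteq> i"
  proof
    assume "v = i"
    then have "\<theta> i w = 0" using form_coeff_zero[OF m(2) i] v keys_m by simp
    with w(2) show False by simp
  qed
  ultimately show "v \<in> T" by blast
qed

section \<open>Translation between generated ideals and monomial conditions\<close>

lemma SR_gens_eq: "SR_gens \<Delta> = monom ` {F. finite F \<and> F \<notin> \<Delta>}"
  by (auto simp: SR_gens_def)

lemma SR_ideal_iff: "p \<in> SR_ideal \<Delta> \<longleftrightarrow> inJ p"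
proof -
  have "(\<exists>F\<in>{F. finite F \<and> F \<notin> \<Delta>}. F \<subseteq> keys m) \<longleftrightarrow> keys m \<notin> \<Delta>" for m :: "'w \<Rightarrow>\<^sub>0 nat"
    using link_face_sub[of "keys m"] finite_keys[of m] by blast
  moreover have "p \<in> ideal_gen (monom ` {F. finite F \<and> F \<notin> \<Delta>}) \<longleftrightarrow>
      (\<forall>m\<in>keys p. \<exists>F\<in>{F. finite F \<and> F \<notin> \<Delta>}. F \<subseteq> keys m)"
    by (rule ideal_gen_monom_iff) simp
  ultimately show ?thesis
    unfolding SR_ideal_def SR_gens_eq inJ_def by presburger
qed

text \<open>Carriers grow with faces, so if a generator divides a monomial supported on a face, the
  support itself meets the carrier condition.\<close>

lemma ideal_carrier_iff:
  "p \<in> ideal_gen ({monom F | F. F \<in> \<Delta> \<and> {..<n} - \<sigma> (F \<union> E) \<subseteq> S} \<union> SR_gens \<Delta>) \<longleftrightarrow> inI S p"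
proof -
  let ?FF = "{F \<in> \<Delta>. {..<n} - \<sigma> (F \<union> E) \<subseteq> S} \<union> {F. finite F \<and> F \<notin> \<Delta>}"
  have gens: "{monom F | F. F \<in> \<Delta> \<and> {..<n} - \<sigma> (F \<union> E) \<subseteq> S} \<union> SR_gens \<Delta> =
      (monom ` ?FF :: ('w, 'k) mpoly set)"
    unfolding SR_gens_eq by auto
  have "(\<exists>F\<in>?FF. F \<subseteq> keys m) \<longleftrightarrow> (keys m \<in> \<Delta> \<longrightarrow> {..<n} - \<sigma> (keys m \<union> E) \<subseteq> S)" for m :: "'w \<Rightarrow>\<^sub>0 nat"
  proof (cases "keys m \<in> \<Delta>")
    case True
    have "{..<n} - \<sigma> (keys m \<union> E) \<subseteq> S" if "F \<in> ?FF" "F \<subseteq> keys m" for F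
      using that link_face_sub[OF True that(2)] link_carrier_mono[OF True that(2)] by blast
    then show ?thesis using True by blast
  next
    case False
    then show ?thesis using finite_keys[of m] by blast
  qed
  moreover have "finite F" if "F \<in> ?FF" for F using that link_faceD(4) by auto
  then have "p \<in> ideal_gen (monom ` ?FF) \<longleftrightarrow> (\<forall>m\<in>keys p. \<exists>F\<in>?FF. F \<subseteq> keys m)"
    by (rule ideal_gen_monom_iff)
  ultimately show ?thesis unfolding gens inI_def by presburger
qed

lemma ideal_forms_decompose:
  assumes "p \<in> ideal_gen ((\<lambda>i. linform \<Delta> (\<theta> i)) ` {..<d} \<union> SR_gens \<Delta>)"
  shows "\<exists>r. inJ (p - (\<Sum>i<d. r i * linform \<Delta> (\<theta> i)))"
  using assms
proof (induction rule: ideal_gen_induct)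
  case zero
  show ?case by (intro exI[of _ "\<lambda>_. 0"]) (simp add: inJ_0)
next
  case (add x y)
  then obtain r s where rs: "inJ (x - (\<Sum>i<d. r i * linform \<Delta> (\<theta> i)))" "inJ (y - (\<Sum>i<d. s i * linform \<Delta> (\<theta> i)))"
    by blast
  have "x + y - (\<Sum>i<d. (r i + s i) * linform \<Delta> (\<theta> i)) =
      (x - (\<Sum>i<d. r i * linform \<Delta> (\<theta> i))) + (y - (\<Sum>i<d. s i * linform \<Delta> (\<theta> i)))"
    by (simp add: distrib_right sum.distrib)
  then have "inJ (x + y - (\<Sum>i<d. (r i + s i) * linform \<Delta> (\<theta> i)))"
    using ideal_gen_add[OF rs[folded SR_ideal_iff, unfolded SR_ideal_def]]
    by (simp only: SR_ideal_def flip: SR_ideal_iff)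
  then show ?case by (intro exI[of _ "\<lambda>i. r i + s i"])
next
  case (gen q h)
  show ?case
  proof (cases "h \<in> SR_gens \<Delta>")
    case True
    have "inJ (q * h)" unfolding SR_ideal_iff[symmetric] SR_ideal_def by (rule ideal_gen_gen[OF True])
    then show ?thesis by (intro exI[of _ "\<lambda>_. 0"]) simp
  next
    case False
    then obtain k where k: "k < d" "h = linform \<Delta> (\<theta> k)" using gen by auto
    have "(\<Sum>i<d. (if i = k then q else 0) * linform \<Delta> (\<theta> i)) = (\<Sum>i<d. if i = k then q * h else 0)"
      using k by (intro sum.cong) auto
    then have "q * h - (\<Sum>i<d. (if i = k then q else 0) * linform \<Delta> (\<theta> i)) = 0" using k by simp
    then show ?thesis by (intro exI[of _ "\<lambda>i. if i = k then q else 0"]) (simp add: inJ_0)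
  qed
qed

end

text \<open>Elements of the direct sums are families of representatives, and equality means equality
  modulo \<open>J\<close>. As \<open>C (Suc d)\<close> contains only the zero family, the second
  clause for j = d is injectivity at the left end. The last clause is exactness at I; the map onto
  L(\<Gamma>,E) is surjective because that module is defined as an image.\<close>

theorem theorem1p2:
  fixes \<Gamma> :: "'w::linorder set set"
    and \<sigma> :: "'w set \<Rightarrow> nat set"
    and n b :: nat
    and E :: "'w set"
    and \<theta> :: "nat \<Rightarrow> 'w \<Rightarrow> 'k::field"
  assumes "infinite (UNIV :: 'k set)"
    and "homology_triangulation TYPE('k) \<Gamma> \<sigma> {..<n}"
    and "quasi_geometric \<Gamma> \<sigma> {..<n}"
    and "E \<in> \<Gamma>"
    and "{..<n} - \<sigma> E = {..<b}"
    and "special_lsop \<Gamma> \<sigma> {..<n} E \<theta>"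
    and "\<forall>i<b. supp (\<theta> i) \<subseteq> {w \<in> vertices (link \<Gamma> E). i \<in> \<sigma> {w}}"
  defines "d \<equiv> n - card E"
    and "\<Delta> \<equiv> link \<Gamma> E"
  defines "J \<equiv> SR_ideal \<Delta>"
    and "IS \<equiv> \<lambda>S. ideal_gen ({monom F | F. F \<in> \<Delta> \<and> {..<n} - \<sigma> (F \<union> E) \<subseteq> S} \<union> SR_gens \<Delta>)"
  defines "C \<equiv> \<lambda>j. {f :: nat set \<Rightarrow> ('w, 'k) mpoly.
              \<forall>S. (S \<subseteq> {..<d} \<and> card S = j \<longrightarrow> f S \<in> (if j = d then UNIV else IS S)) \<and>
                  (\<not> (S \<subseteq> {..<d} \<and> card S = j) \<longrightarrow> f S = 0)}"
    and "dd \<equiv> \<lambda>(f :: nat set \<Rightarrow> ('w, 'k) mpoly) T.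
              \<Sum>i\<in>{..<d} - T. (-1) ^ card {u\<in>T. u < i} * linform \<Delta> (\<theta> i) * f (insert i T)"
  shows "(\<forall>j\<in>{1..d}. \<forall>f\<in>C j. dd f \<in> C (j - 1)) \<and>
         (\<forall>j\<in>{1..d}. \<forall>f\<in>C j. (\<forall>T. dd f T \<in> J) \<longleftrightarrow> (\<exists>g\<in>C (Suc j). \<forall>S. f S - dd g S \<in> J)) \<and>
         (\<forall>p\<in>IS {}. p \<in> ideal_gen ((\<lambda>i. linform \<Delta> (\<theta> i)) ` {..<d} \<union> SR_gens \<Delta>)
                      \<longleftrightarrow> (\<exists>g\<in>C 1. p - dd g {} \<in> J))"
proof (cases "d = 0")
  case True
  \<comment> \<open>Without parameters both sides of the last clause say that \<open>p\<close> lies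
    in \<open>J\<close>. The case is separate because n > 0, needed for the locale, follows from d >
    0.\<close>
  have "dd g {} = 0" for g by (simp add: dd_def True)
  moreover have "(\<lambda>_. 0) \<in> C 1" by (simp add: C_def IS_def ideal_gen_0)
  ultimately show ?thesis using True by (auto simp: J_def SR_ideal_def)
next
  case False
  then have d: "0 < d" by simp
  interpret T: triangulation_face "TYPE('k)" \<Gamma> \<sigma> "{..<n}" E
    by unfold_locales (use assms(2,4) d in \<open>auto simp: d_def\<close>)
  interpret M: module_setup "TYPE('k)" \<Gamma> \<sigma> n E \<theta> b
  proof
    show "lsop T.\<Delta> \<theta> T.d"
      using assms(6) by (simp add: special_lsop_def Let_def T.\<Delta>_def T.d_def)
    show "{..<n} - \<sigma> E = {..<b}" by (rule assms(5))
    show "supp (\<theta> i) \<subseteq> {w \<in> vertices T.\<Delta>. i \<in> \<sigma> {w}}" if "i < b" for i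
      using assms(7) that by (simp add: T.\<Delta>_def)
  qed
  have d_eq: "T.d = d" by (simp add: T.d_def d_def)
  have \<Delta>_eq: "T.\<Delta> = \<Delta>" by (simp add: T.\<Delta>_def \<Delta>_def)
  have J: "p \<in> J \<longleftrightarrow> M.inJ p" for p
    using M.SR_ideal_iff[of p] unfolding \<Delta>_eq J_def .
  have IS: "p \<in> IS S \<longleftrightarrow> M.inI S p" for p S
    using M.ideal_carrier_iff[of p S] unfolding \<Delta>_eq IS_def .
  have dd: "dd f T = M.koszul f T" for f T
    by (simp add: dd_def kz_def ksgn_def d_eq \<Delta>_eq)
  have C: "f \<in> C j \<longleftrightarrow> (\<forall>S. f S \<noteq> 0 \<longrightarrow> S \<subseteq> {..<d} \<and> card S = j) \<and> (\<forall>S. M.inI S (f S))" for f j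
  proof -
    \<comment> \<open>For j = d the only index set is {0..<d}, whose ideal is everything, so
      \<open>UNIV\<close> in \<open>C\<close> is no exception.\<close>
    have "M.inI S (f S)" if "S \<subseteq> {..<d}" "card S = d" for S
      using M.inI_full[of "f S"] card_subset_eq[of "{..<d}" S] that by (simp add: d_eq)
    moreover have "M.inI S 0" for S by (simp add: M.inI_def)
    ultimately show ?thesis unfolding C_def mem_Collect_eq IS by (metis UNIV_I IS)
  qed
  have J_mult: "q * p \<in> J" if "p \<in> J" for p q
    using that ideal_gen_mult unfolding J_def SR_ideal_def by blast
  have J_dd: "dd h T \<in> J" if "\<And>S. h S \<in> J" for h T
    unfolding dd_def using J_mult[OF that] unfolding J_def SR_ideal_def by (intro ideal_gen_sum)
  show ?thesis
  proof (intro conjI ballI iffI)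
    fix j f assume j: "j \<in> {1..d}" and f: "f \<in> C j"
    have Sj: "j = Suc (j - 1)" using j by simp
    have f1: "S \<subseteq> {..<T.d} \<and> card S = Suc (j - 1)" if "f S \<noteq> 0" for S
      using f that Sj unfolding C d_eq by metis
    have "M.inI T (dd f T)" for T
      unfolding IS[symmetric] dd_def IS_def
    proof (rule ideal_gen_sum)
      fix i assume i: "i \<in> {..<d} - T"
      have "M.inI T (linform \<Delta> (\<theta> i) * f (insert i T))"
        using M.inI_form_mult[of i T "f (insert i T)"] f i unfolding C d_eq \<Delta>_eq by simp
      then show "(- 1) ^ card {u \<in> T. u < i} * linform \<Delta> (\<theta> i) * f (insert i T)
          \<in> ideal_gen ({monom F | F. F \<in> \<Delta> \<and> {..<n} - \<sigma> (F \<union> E) \<subseteq> T} \<union> SR_gens \<Delta>)"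
        unfolding IS[symmetric] IS_def mult.assoc by (rule ideal_gen_mult)
    qed
    moreover have "T \<subseteq> {..<d} \<and> card T = j - 1" if "dd f T \<noteq> 0" for T
      using M.koszul_outside[of f "j - 1" T] f1 that unfolding dd d_eq by blast
    ultimately show "dd f \<in> C (j - 1)" unfolding C by blast
  next
    fix j f assume j: "j \<in> {1..d}" and f: "f \<in> C j" and cyc: "\<forall>T. dd f T \<in> J"
    have "\<exists>g. (\<forall>S. g S \<noteq> 0 \<longrightarrow> S \<subseteq> {..<T.d} \<and> card S = Suc j) \<and> (\<forall>S. M.inI S (g S)) \<and>
        (\<forall>S. M.inJ (f S - M.koszul g S))"
    proof (rule M.exact_positive_degree)
      show "1 \<le> j" using j by simp
      show "S \<subseteq> {..<T.d} \<and> card S = j" if "f S \<noteq> 0" for S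
        using f that unfolding C d_eq by blast
      show "M.inI S (f S)" for S using f unfolding C by blast
      show "M.inJ (M.koszul f T)" for T using cyc unfolding dd J by blast
    qed
    then show "\<exists>g\<in>C (Suc j). \<forall>S. f S - dd g S \<in> J" unfolding Bex_def C dd J d_eq by blast
  next
    fix j f assume j: "j \<in> {1..d}" and f: "f \<in> C j" and ex: "\<exists>g\<in>C (Suc j). \<forall>S. f S - dd g S \<in> J"
    then obtain g where g: "g \<in> C (Suc j)" "\<And>S. f S - dd g S \<in> J" by blast
    show "\<forall>T. dd f T \<in> J"
    proof
      fix T
      show "dd f T \<in> J"
      proof (cases "finite T")
        case True
        have dd': "dd h = M.koszul h" for h using dd by (rule ext)
        have "dd f T = dd (\<lambda>S. f S - dd g S) T + dd (dd g) T" by (simp add: dd' kz_diff)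
        also have "dd (dd g) T = 0" unfolding dd' by (rule kz_kz[OF _ True]) simp
        finally have "dd f T = dd (\<lambda>S. f S - dd g S) T" by simp
        moreover have "dd (\<lambda>S. f S - dd g S) T \<in> J" by (intro J_dd g(2))
        ultimately show ?thesis by simp
      next
        case False
        \<comment> \<open>The claim covers all sets \<open>T\<close>; at infinite ones a member of
          \<open>C j\<close> vanishes on every \<open>insert i T\<close>.\<close>
        have "f (insert i T) = 0" for i
          using f False finite_subset[of "insert i T" "{..<d}"] unfolding C by auto
        then have "dd f T = 0" by (simp add: dd_def)
        then show ?thesis by (simp add: J M.inJ_0)
      qed
    qed
  next
    fix p assume p: "p \<in> IS {}"
      and "p \<in> ideal_gen ((\<lambda>i. linform \<Delta> (\<theta> i)) ` {..<d} \<union> SR_gens \<Delta>)"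
    then obtain r where r: "M.inJ (p - (\<Sum>i<T.d. r i * linform T.\<Delta> (\<theta> i)))"
      using M.ideal_forms_decompose[of p] unfolding d_eq \<Delta>_eq by blast
    have "0 < T.d" "M.inI {} p" using d p unfolding d_eq IS by auto
    from M.exact_degree_zero[OF this r] show "\<exists>g\<in>C 1. p - dd g {} \<in> J"
      unfolding Bex_def C dd J d_eq by blast
  next
    fix p assume "\<exists>g\<in>C 1. p - dd g {} \<in> J"
    then obtain g where g: "p - dd g {} \<in> J" by blast
    let ?I = "ideal_gen ((\<lambda>i. linform \<Delta> (\<theta> i)) ` {..<d} \<union> SR_gens \<Delta>)"
    have "p - dd g {} \<in> ?I" using g ideal_gen_mono unfolding J_def SR_ideal_def by blast
    moreover have "dd g {} \<in> ?I"
      unfolding dd_def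
    proof (rule ideal_gen_sum)
      fix i assume "i \<in> {..<d} - {}"
      then have "linform \<Delta> (\<theta> i) \<in> (\<lambda>i. linform \<Delta> (\<theta> i)) ` {..<d} \<union> SR_gens \<Delta>" by blast
      from ideal_gen_gen[OF this, of "(- 1) ^ card {u \<in> {}. u < i} * g (insert i {})"]
      show "(- 1) ^ card {u \<in> {}. u < i} * linform \<Delta> (\<theta> i) * g (insert i {}) \<in> ?I"
        by (simp add: mult_ac)
    qed
    ultimately have "p - dd g {} + dd g {} \<in> ?I" by (rule ideal_gen_add)
    then show "p \<in> ?I" by simp
  qed
qed

end
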